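(* For any $X,Y\subset S$ and $w\in[W_X\backslash\widetilde W/W_Y]$, we have $$K_XwK_Y=\bigsqcup_{\tau}\ \bigsqcup_{\vec\kappa\in k_{\tau w}}\mathcal X_{\tau w}(\vec\kappa)\,K_Y$$ where $\tau\in W_X$ runs over the minimal length representatives of $W_X/(W_X\cap wW_Yw^{-1})$.
   Context: $(G,B,N,S)$ is a Tits system: $G$ is generated by $B\cup N$, $T=B\cap N$ is normal in $N$, $S$ is a set of elements of order 2 generating $W=N/T$, and $sBw\subset BwB\cup BswB$, $sBs\neq B$ for all $s\in S$, $w\in W$. Then $(W,S)$ is a Coxeter system with length function $\ell$. It is assumed that $BsB/B$ is finite for every $s\in S$. $\varphi:G\hookrightarrow\widetilde G$ is a $(B,N)$-adapted inclusion of groups: for all $g\in\widetilde G$ there is $h\in G$ with $gBg^{-1}=hBh^{-1}$ and $gNg^{-1}=hNh^{-1}$ ($G$ is viewed as a subgroup of $\widetilde G$). Let $\hat B$, $\hat N$ be the normalizers of $B$, $N$ in $\widetilde G$, $\Gamma=\hat B\cap\hat N$, $\Omega=\hat B/B$ (canonically $\cong\widetilde G/G\cong\Gamma/(\Gamma\cap B)$), $\widetilde N=N\Gamma$, $\widetilde T=\widetilde N\cap B$ and $\widetilde W=\widetilde N/\widetilde T$. One has $\widetilde W=W\rtimes\Omega$, with $\Omega$ acting on $(W,S)$ by automorphisms, and $\ell$ extends to $\widetilde W$ by $\ell(\sigma\rho)=\ell(\sigma)$ for $\sigma\in W$, $\rho\in\Omega$. For $w\in\widetilde W$, expressions such as $wB$,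 $K_XwK_Y$ are formed with any lift of $w$ to $\widetilde N$. For $X\subset S$, $W_X\subset W$ is the subgroup generated by $X$ and $K_X=BW_XB\subset G$. For $X,Y\subset S$, $[W_X\backslash\widetilde W/W_Y]$ is the set of $w\in\widetilde W$ of minimal length in $W_XwW_Y$. For $s\in S$, $k_s\subset G$ is a fixed set of representatives of $BsB/B$. For $w\in\widetilde W$ choose a reduced decomposition $w=s_1\cdots s_m\rho$ ($s_i\in S$, $\rho\in\Omega$, $m=\ell(w)$) and a lift $\tilde\rho\in\hat B$ of $\rho$; put $k_w=k_{s_1}\times\cdots\times k_{s_m}$ and $\mathcal X_w:k_w\to\widetilde G$, $(\kappa_1,\dots,\kappa_m)\mapsto\kappa_1\cdots\kappa_m\tilde\rho$. *)

theory Defs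
  imports "HOL-Algebra.Multiplicative_Group" "HOL-Algebra.Generated_Groups" "HOL-Algebra.Zassenhaus"
    "HOL-Library.Disjoint_Sets"
begin

section \<open>Tits systems\<close>

text \<open>
  Elements of \<open>W = N / T\<close>, \<open>T = B \<inter> N\<close>, are cosets, i.e. subsets of the ambient group. Expressions
  such as \<open>B w B\<close>, \<open>s B w\<close> or \<open>K w K'\<close> (with \<open>B \<subseteq> K\<close>, \<open>B \<subseteq> K'\<close>) are products of sets. As each
  coset stands next to a group containing \<open>T\<close>, this is the same as using any single lift of it.
  The same applies to the extended Weyl group below.
\<close>

definition weyl_group :: "('a, 'b) monoid_scheme \<Rightarrow> 'a set \<Rightarrow> 'a set \<Rightarrow> 'a set monoid" where
  "weyl_group G B N = (G\<lparr>carrier := N\<rparr>) Mod (B \<inter> N)"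

text \<open>The group \<open>N / T\<close> does not depend on the ambient group in which it is formed.\<close>

lemma weyl_group_carrier_update [simp]:
  "weyl_group (G\<lparr>carrier := H\<rparr>) B N = weyl_group G B N"
  by (simp add: weyl_group_def)

locale tits_system = group G for G (structure) +
  fixes B N :: "'a set" and S :: "'a set set"
  assumes B_subgroup: "subgroup B G"
    and N_subgroup: "subgroup N G"
    and generated: "generate G (B \<union> N) = carrier G"
    and T_normal: "(B \<inter> N) \<lhd> (G\<lparr>carrier := N\<rparr>)"
    and S_subset: "S \<subseteq> carrier (weyl_group G B N)"
    and S_order: "\<And>s. s \<in> S \<Longrightarrow> group.ord (weyl_group G B N) s = 2"
    and S_generates: "generate (weyl_group G B N) S = carrier (weyl_group G B N)"
    and exchange: "\<And>s w. s \<in> S \<Longrightarrow> w \<in> carrier (weyl_group G B N) \<Longrightarrow>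
        s <#> B <#> w \<subseteq> (B <#> w <#> B) \<union> (B <#> (s \<otimes>\<^bsub>weyl_group G B N\<^esub> w) <#> B)"
    and nondegenerate: "\<And>s. s \<in> S \<Longrightarrow> s <#> B <#> s \<noteq> B"

definition list_prod :: "('a, 'b) monoid_scheme \<Rightarrow> 'a list \<Rightarrow> 'a" where
  "list_prod G xs = foldr (\<lambda>x y. x \<otimes>\<^bsub>G\<^esub> y) xs \<one>\<^bsub>G\<^esub>"

text \<open>Since \<open>S\<close> consists of involutions, words in \<open>S\<close> without inverses suffice.\<close>

definition word_length :: "('a, 'b) monoid_scheme \<Rightarrow> 'a set \<Rightarrow> 'a \<Rightarrow> nat" where
  "word_length W S w = (LEAST m. \<exists>ss. set ss \<subseteq> S \<and> length ss = m \<and> list_prod W ss = w)"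

text \<open>The set \<open>A / B\<close> of left cosets \<open>g B\<close> with \<open>g \<in> A\<close>, for \<open>A\<close> a set with \<open>A B = A\<close>.\<close>

definition left_cosets_in :: "('a, 'b) monoid_scheme \<Rightarrow> 'a set \<Rightarrow> 'a set \<Rightarrow> 'a set set" where
  "left_cosets_in G A B = (\<lambda>g. g <#\<^bsub>G\<^esub> B) ` A"

definition left_coset_reps ::
  "('a, 'b) monoid_scheme \<Rightarrow> 'a set \<Rightarrow> 'a set \<Rightarrow> 'a set \<Rightarrow> bool" where
  "left_coset_reps G A B R \<longleftrightarrow>
     R \<subseteq> A \<and> bij_betw (\<lambda>g. g <#\<^bsub>G\<^esub> B) R (left_cosets_in G A B)"

section \<open>Adapted inclusions and the extended Weyl group\<close>

text \<open>
  From here on \<open>Gt\<close> is the big group, and \<open>G\<close> is a subset of its carrier carrying the Tits system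
  \<open>(B, N, S)\<close>.
\<close>

definition BN_adapted ::
  "('a, 'b) monoid_scheme \<Rightarrow> 'a set \<Rightarrow> 'a set \<Rightarrow> 'a set \<Rightarrow> bool" where
  "BN_adapted Gt G B N \<longleftrightarrow>
     (\<forall>g\<in>carrier Gt. \<exists>h\<in>G.
        g <#\<^bsub>Gt\<^esub> B #>\<^bsub>Gt\<^esub> inv\<^bsub>Gt\<^esub> g = h <#\<^bsub>Gt\<^esub> B #>\<^bsub>Gt\<^esub> inv\<^bsub>Gt\<^esub> h \<and>
        g <#\<^bsub>Gt\<^esub> N #>\<^bsub>Gt\<^esub> inv\<^bsub>Gt\<^esub> g = h <#\<^bsub>Gt\<^esub> N #>\<^bsub>Gt\<^esub> inv\<^bsub>Gt\<^esub> h)"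

definition Gamma_grp :: "('a, 'b) monoid_scheme \<Rightarrow> 'a set \<Rightarrow> 'a set \<Rightarrow> 'a set" where
  "Gamma_grp Gt B N = normalizer Gt B \<inter> normalizer Gt N"

definition Omega_grp :: "('a, 'b) monoid_scheme \<Rightarrow> 'a set \<Rightarrow> 'a set monoid" where
  "Omega_grp Gt B = (Gt\<lparr>carrier := normalizer Gt B\<rparr>) Mod B"

definition N_ext :: "('a, 'b) monoid_scheme \<Rightarrow> 'a set \<Rightarrow> 'a set \<Rightarrow> 'a set" where
  "N_ext Gt B N = N <#>\<^bsub>Gt\<^esub> Gamma_grp Gt B N"

definition T_ext :: "('a, 'b) monoid_scheme \<Rightarrow> 'a set \<Rightarrow> 'a set \<Rightarrow> 'a set" where
  "T_ext Gt B N = N_ext Gt B N \<inter> B"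

definition W_ext :: "('a, 'b) monoid_scheme \<Rightarrow> 'a set \<Rightarrow> 'a set \<Rightarrow> 'a set monoid" where
  "W_ext Gt B N = (Gt\<lparr>carrier := N_ext Gt B N\<rparr>) Mod (T_ext Gt B N)"

text \<open>The embedding of \<open>W = N / T\<close> into the extended Weyl group sends the class of \<open>n\<close> to the
  class of \<open>n\<close>.\<close>

definition W_emb ::
  "('a, 'b) monoid_scheme \<Rightarrow> 'a set \<Rightarrow> 'a set \<Rightarrow> 'a set \<Rightarrow> 'a set" where
  "W_emb Gt B N w = T_ext Gt B N <#>\<^bsub>Gt\<^esub> w"

text \<open>The embedding of \<open>\<Omega>\<close> uses the canonical isomorphism of \<open>\<Omega>\<close> with \<open>\<Gamma> / (\<Gamma> \<inter> B)\<close>,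
  \<open>\<rho> \<mapsto> \<rho> \<inter> \<Gamma>\<close>.\<close>

definition Omega_emb ::
  "('a, 'b) monoid_scheme \<Rightarrow> 'a set \<Rightarrow> 'a set \<Rightarrow> 'a set \<Rightarrow> 'a set" where
  "Omega_emb Gt B N \<rho> = T_ext Gt B N <#>\<^bsub>Gt\<^esub> (\<rho> \<inter> Gamma_grp Gt B N)"

text \<open>The decomposition \<open>w = \<sigma> \<rho>\<close> exists and is unique, as the extended Weyl group is the
  semidirect product of \<open>W\<close> and \<open>\<Omega>\<close>.\<close>

definition ext_length ::
  "('a, 'b) monoid_scheme \<Rightarrow> 'a set \<Rightarrow> 'a set \<Rightarrow> 'a set set \<Rightarrow> 'a set \<Rightarrow> nat" where
  "ext_length Gt B N S w =
     (THE m. \<exists>\<sigma>\<in>carrier (weyl_group Gt B N). \<exists>\<rho>\<in>carrier (Omega_grp Gt B).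
        w = W_emb Gt B N \<sigma> \<otimes>\<^bsub>W_ext Gt B N\<^esub> Omega_emb Gt B N \<rho> \<and>
        m = word_length (weyl_group Gt B N) S \<sigma>)"

section \<open>Parabolic subgroups and minimal length representatives\<close>

definition W_par :: "('a, 'b) monoid_scheme \<Rightarrow> 'a set \<Rightarrow> 'a set \<Rightarrow> 'a set set \<Rightarrow> 'a set set" where
  "W_par Gt B N X = generate (weyl_group Gt B N) X"

text \<open>\<open>W_X\<close> regarded as a subgroup of the extended Weyl group.\<close>

definition W_par_ext ::
  "('a, 'b) monoid_scheme \<Rightarrow> 'a set \<Rightarrow> 'a set \<Rightarrow> 'a set set \<Rightarrow> 'a set set" where
  "W_par_ext Gt B N X = W_emb Gt B N ` W_par Gt B N X"

definition K_par :: "('a, 'b) monoid_scheme \<Rightarrow> 'a set \<Rightarrow> 'a set \<Rightarrow> 'a set set \<Rightarrow> 'a set" where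
  "K_par Gt B N X = B <#>\<^bsub>Gt\<^esub> \<Union> (W_par Gt B N X) <#>\<^bsub>Gt\<^esub> B"

definition min_double_coset_reps ::
  "('a, 'b) monoid_scheme \<Rightarrow> 'a set \<Rightarrow> 'a set \<Rightarrow> 'a set set \<Rightarrow> 'a set set \<Rightarrow> 'a set set \<Rightarrow> 'a set set"
  where
  "min_double_coset_reps Gt B N S X Y =
     {w \<in> carrier (W_ext Gt B N).
        \<forall>v \<in> W_par_ext Gt B N X #>\<^bsub>W_ext Gt B N\<^esub> w <#>\<^bsub>W_ext Gt B N\<^esub> W_par_ext Gt B N Y.
          ext_length Gt B N S w \<le> ext_length Gt B N S v}"

text \<open>\<open>W_X \<inter> w W_Y w\<^sup>-\<^sup>1\<close> and the minimal length representatives of its left cosets in \<open>W_X\<close>.\<close>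

definition W_par_inter ::
  "('a, 'b) monoid_scheme \<Rightarrow> 'a set \<Rightarrow> 'a set \<Rightarrow> 'a set set \<Rightarrow> 'a set set \<Rightarrow> 'a set \<Rightarrow> 'a set set"
  where
  "W_par_inter Gt B N X Y w =
     W_par_ext Gt B N X \<inter>
     (w <#\<^bsub>W_ext Gt B N\<^esub> W_par_ext Gt B N Y #>\<^bsub>W_ext Gt B N\<^esub> inv\<^bsub>W_ext Gt B N\<^esub> w)"

definition min_coset_reps ::
  "('a, 'b) monoid_scheme \<Rightarrow> 'a set \<Rightarrow> 'a set \<Rightarrow> 'a set set \<Rightarrow> 'a set set \<Rightarrow> 'a set set \<Rightarrow> 'a set
     \<Rightarrow> 'a set set" where
  "min_coset_reps Gt B N S X Y w =
     {\<tau> \<in> W_par_ext Gt B N X.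
        \<forall>\<sigma> \<in> \<tau> <#\<^bsub>W_ext Gt B N\<^esub> W_par_inter Gt B N X Y w.
          ext_length Gt B N S \<tau> \<le> ext_length Gt B N S \<sigma>}"

section \<open>Reduced decompositions and the maps parametrising cosets\<close>

definition reduced_decomposition ::
  "('a, 'b) monoid_scheme \<Rightarrow> 'a set \<Rightarrow> 'a set \<Rightarrow> 'a set set
     \<Rightarrow> 'a set \<Rightarrow> 'a set list \<Rightarrow> 'a set \<Rightarrow> bool" where
  "reduced_decomposition Gt B N S w ss \<rho> \<longleftrightarrow>
     set ss \<subseteq> S \<and> \<rho> \<in> carrier (Omega_grp Gt B) \<and>
     length ss = ext_length Gt B N S w \<and>
     w = W_emb Gt B N (list_prod (weyl_group Gt B N) ss) \<otimes>\<^bsub>W_ext Gt B N\<^esub> Omega_emb Gt B N \<rho>"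

text \<open>Tuples \<open>(\<kappa>\<^sub>1, \<dots>, \<kappa>\<^sub>m)\<close> are lists; \<open>ss\<close> is a reduced decomposition \<open>(s\<^sub>1, \<dots>, s\<^sub>m)\<close>, \<open>r\<close> a lift
  of the component in \<open>\<Omega>\<close>.\<close>

definition k_prod :: "('a set \<Rightarrow> 'a set) \<Rightarrow> 'a set list \<Rightarrow> 'a list set" where
  "k_prod k ss = listset (map k ss)"

definition X_map :: "('a, 'b) monoid_scheme \<Rightarrow> 'a \<Rightarrow> 'a list \<Rightarrow> 'a" where
  "X_map Gt r \<kappa> = list_prod Gt \<kappa> \<otimes>\<^bsub>Gt\<^esub> r"

end

theory Submission
  imports Defs
begin

text \<open>
  Call \<open>t \<in> S\<close> a descent of \<open>x\<close> if \<open>BxBtB\<close> meets \<open>BxB\<close>. If \<open>t\<close> is a descent of \<open>sx\<close> but not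
  of \<open>x\<close>, then \<open>BsxB\<close> meets \<open>BsBxtB \<subseteq> BxtB \<union> BsxtB\<close>, so \<open>sx = xt\<close>. Peeling letters off a
  word, one gets the exchange condition, and with it that descents are exactly the
  length-decreasing letters.

  The minimality of \<open>w\<close> shows that \<open>w\<close> has no descent in \<open>Y\<close>. For \<open>\<tau>\<close> minimal in
  \<open>\<tau> (W\<^sub>X \<inter> w W\<^sub>Y w\<^sup>-\<^sup>1)\<close>, exchange then shows that \<open>v = \<tau> w\<close> has no descent in \<open>Y\<close>
  either. Hence \<open>v\<close> is the unique minimal element of \<open>v W\<^sub>Y\<close>, and \<open>BvB\<sigma>B = Bv\<sigma>B\<close> for
  \<open>\<sigma> \<in> W\<^sub>Y\<close>. So distinct \<open>\<tau>\<close> give disjoint sets \<open>BvK\<^sub>Y\<close>, and \<open>BvB / B \<rightarrow> BvK\<^sub>Y / K\<^sub>Y\<close> is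
  injective. Finally \<open>BvB / B\<close> is parametrised letter by letter along a reduced word.

  Only products of double cosets enter, so the argument covers \<open>W\<close> (with \<open>\<Omega> = 1\<close>) and the
  extended Weyl group alike. For \<open>W\<close> it shows that elements of \<open>N\<close> normalizing \<open>B\<close> lie in \<open>B\<close>,
  and this makes \<open>T_ext\<close> normal in \<open>N_ext\<close>.
\<close>

section \<open>Double cosets indexed by a group\<close>

text \<open>Two definitions shape the proof. The quotient \<open>W_ext\<close> is a group only if
  \<open>T_ext\<close> is normal, and \<open>ext_length\<close> is a definite description that needs
  a unique decomposition into a part in \<open>W\<close> and a part in \<Omega>. Both facts, like
  the exchange condition in \<open>W\<close>, have to be extracted from the axioms of a Tits system.
  Hence the theory of double cosets is developed over an abstract index group, with a length that
  ignores a factor in \<Omega> and makes sense before uniqueness is known. Its application to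
  \<open>W\<close> must precede even the statement that the extended Weyl group is a group; that the
  abstract length agrees with \<open>ext_length\<close> is proved last.\<close>

lemma mem_set_mult: "g \<in> H <#>\<^bsub>G\<^esub> K \<longleftrightarrow> (\<exists>a\<in>H. \<exists>b\<in>K. g = a \<otimes>\<^bsub>G\<^esub> b)"
  by (auto simp: set_mult_def)

lemma set_multI: "a \<in> H \<Longrightarrow> b \<in> K \<Longrightarrow> a \<otimes>\<^bsub>G\<^esub> b \<in> H <#>\<^bsub>G\<^esub> K"
  by (auto simp: set_mult_def)

lemma list_prod_simps [simp]:
  "list_prod W [] = \<one>\<^bsub>W\<^esub>" "list_prod W (x # xs) = x \<otimes>\<^bsub>W\<^esub> list_prod W xs"
  by (simp_all add: list_prod_def)

lemma (in monoid) list_prod_closed [simp]: "set xs \<subseteq> carrier G \<Longrightarrow> list_prod G xs \<in> carrier G"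
  by (induction xs) auto

lemma (in monoid) list_prod_append:
  "set xs \<subseteq> carrier G \<Longrightarrow> set ys \<subseteq> carrier G \<Longrightarrow>
    list_prod G (xs @ ys) = list_prod G xs \<otimes> list_prod G ys"
  by (induction xs) (auto simp: m_assoc)

text \<open>\<open>C x\<close> stands for \<open>B x B\<close>, and \<open>\<Omega>\<close> for the elements of length \<open>0\<close>.\<close>

locale double_coset_system = G: group G + W: group W
  for G :: "('a, 'b) monoid_scheme" (structure) and W :: "('w, 'c) monoid_scheme" +
  fixes B :: "'a set" and C :: "'w \<Rightarrow> 'a set" and S \<Omega> :: "'w set"
  assumes B_subgroup: "subgroup B G"
    and C_carrier: "x \<in> carrier W \<Longrightarrow> C x \<subseteq> carrier G"
    and C_nonempty: "x \<in> carrier W \<Longrightarrow> C x \<noteq> {}"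
    and C_biinvariant:
      "\<lbrakk>x \<in> carrier W; g \<in> C x; b \<in> B; b' \<in> B\<rbrakk> \<Longrightarrow> b \<otimes> g \<otimes> b' \<in> C x"
    and C_single:
      "\<lbrakk>x \<in> carrier W; g \<in> C x; h \<in> C x\<rbrakk> \<Longrightarrow> \<exists>b\<in>B. \<exists>b'\<in>B. h = b \<otimes> g \<otimes> b'"
    and C_one: "C \<one>\<^bsub>W\<^esub> = B"
    and C_inv: "\<lbrakk>x \<in> carrier W; g \<in> C x\<rbrakk> \<Longrightarrow> inv g \<in> C (inv\<^bsub>W\<^esub> x)"
    and C_mult_ex:
      "\<lbrakk>x \<in> carrier W; y \<in> carrier W\<rbrakk> \<Longrightarrow> \<exists>g\<in>C x. \<exists>h\<in>C y. g \<otimes> h \<in> C (x \<otimes>\<^bsub>W\<^esub> y)"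
    and C_meets_B: "\<lbrakk>x \<in> carrier W; C x \<inter> B \<noteq> {}\<rbrakk> \<Longrightarrow> x = \<one>\<^bsub>W\<^esub>"
    and S_carrier: "S \<subseteq> carrier W"
    and S_square: "s \<in> S \<Longrightarrow> s \<otimes>\<^bsub>W\<^esub> s = \<one>\<^bsub>W\<^esub>"
    and one_notin_S: "\<one>\<^bsub>W\<^esub> \<notin> S"
    and exchange_left:
      "\<lbrakk>s \<in> S; x \<in> carrier W\<rbrakk> \<Longrightarrow> C s <#> C x \<subseteq> C x \<union> C (s \<otimes>\<^bsub>W\<^esub> x)"
    and C_square: "s \<in> S \<Longrightarrow> C s <#> C s \<noteq> B"
    and Omega_subgroup: "subgroup \<Omega> W"
    and Omega_left:
      "\<lbrakk>r \<in> \<Omega>; x \<in> carrier W\<rbrakk> \<Longrightarrow> C r <#> C x \<subseteq> C (r \<otimes>\<^bsub>W\<^esub> x)"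
    and factorization:
      "x \<in> carrier W \<Longrightarrow> \<exists>ss r. set ss \<subseteq> S \<and> r \<in> \<Omega> \<and> x = list_prod W ss \<otimes>\<^bsub>W\<^esub> r"
begin

text \<open>Minimising over all factorizations gives a length before the factor in \<Omega> is known
  to be unique. The elements of length \<open>0\<close> are those of \<Omega>, where inductions on
  the length start.\<close>

definition len :: "'w \<Rightarrow> nat" where
  "len x = (LEAST m. \<exists>ss r. set ss \<subseteq> S \<and> r \<in> \<Omega> \<and> length ss = m \<and> x = list_prod W ss \<otimes>\<^bsub>W\<^esub> r)"

definition words :: "'w set \<Rightarrow> 'w set" where
  "words X = {list_prod W ss |ss. set ss \<subseteq> X}"

text \<open>Only words in \<open>X\<close> compete, so for \<open>X \<subseteq> S\<close> this is at
  first weaker than being reduced with respect to \<open>S\<close>; \<open>shortest_len\<close>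
  shows that there is no difference.\<close>

definition shortest :: "'w set \<Rightarrow> 'w list \<Rightarrow> bool" where
  "shortest X ss \<longleftrightarrow> set ss \<subseteq> X \<and>
     (\<forall>ss'. set ss' \<subseteq> X \<and> list_prod W ss' = list_prod W ss \<longrightarrow> length ss \<le> length ss')"

text \<open>In terms of double cosets the condition can be tested by multiplying out. The comparison
  of lengths is then a consequence of the exchange condition and not a prerequisite for it.\<close>

definition descent :: "'w \<Rightarrow> 'w \<Rightarrow> bool" where
  "descent x s \<longleftrightarrow> C x \<inter> (C x <#> C s) \<noteq> {}"

definition par :: "'w set \<Rightarrow> 'a set" where
  "par X = (\<Union>x\<in>words X. C x)"

section \<open>Products of double cosets\<close>

lemma S_closed [simp]: "s \<in> S \<Longrightarrow> s \<in> carrier W"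
  using S_carrier by auto

lemma Omega_closed [simp]: "r \<in> \<Omega> \<Longrightarrow> r \<in> carrier W"
  using Omega_subgroup by (rule subgroup.mem_carrier)

lemma B_closed [simp]: "b \<in> B \<Longrightarrow> b \<in> carrier G"
  using B_subgroup by (rule subgroup.mem_carrier)

lemma C_closed: "\<lbrakk>x \<in> carrier W; g \<in> C x\<rbrakk> \<Longrightarrow> g \<in> carrier G"
  using C_carrier by auto

lemma word_closed [simp]: "set ss \<subseteq> S \<Longrightarrow> list_prod W ss \<in> carrier W"
  using S_carrier by (intro W.list_prod_closed) auto

lemma word_append:
  "set ss \<subseteq> S \<Longrightarrow> set ss' \<subseteq> S \<Longrightarrow>
    list_prod W (ss @ ss') = list_prod W ss \<otimes>\<^bsub>W\<^esub> list_prod W ss'"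
  using S_carrier by (intro W.list_prod_append) auto

lemma S_inv [simp]: "s \<in> S \<Longrightarrow> inv\<^bsub>W\<^esub> s = s"
  using S_square by (intro W.inv_equality) auto

lemma S_cancel [simp]: "s \<in> S \<Longrightarrow> x \<in> carrier W \<Longrightarrow> s \<otimes>\<^bsub>W\<^esub> (s \<otimes>\<^bsub>W\<^esub> x) = x"
  by (simp add: S_square flip: W.m_assoc)

lemma S_cancel_right [simp]: "s \<in> S \<Longrightarrow> x \<in> carrier W \<Longrightarrow> x \<otimes>\<^bsub>W\<^esub> s \<otimes>\<^bsub>W\<^esub> s = x"
  by (simp add: S_square W.m_assoc)

lemma mult_S_neq: "s \<in> S \<Longrightarrow> x \<in> carrier W \<Longrightarrow> x \<otimes>\<^bsub>W\<^esub> s \<noteq> x"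
  using one_notin_S by auto

lemma S_mult_neq: "s \<in> S \<Longrightarrow> x \<in> carrier W \<Longrightarrow> s \<otimes>\<^bsub>W\<^esub> x \<noteq> x"
  using one_notin_S by auto

lemma C_mult_right: "\<lbrakk>x \<in> carrier W; g \<in> C x; b \<in> B\<rbrakk> \<Longrightarrow> g \<otimes> b \<in> C x"
  using C_biinvariant[of x g \<one> b] subgroup.one_closed[OF B_subgroup] C_closed by fastforce

lemma C_mult_left: "\<lbrakk>x \<in> carrier W; g \<in> C x; b \<in> B\<rbrakk> \<Longrightarrow> b \<otimes> g \<in> C x"
  using C_biinvariant[of x g b \<one>] subgroup.one_closed[OF B_subgroup] C_closed by fastforce

lemma C_eqI:
  assumes "x \<in> carrier W" "y \<in> carrier W" "g \<in> C x" "g \<in> C y" shows "C x = C y"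
  using C_single[OF assms(1,3)] C_single[OF assms(2,4)]
    C_biinvariant[OF assms(1,3)] C_biinvariant[OF assms(2,4)] by blast

text \<open>A product of two double cosets is stable under \<open>B\<close> on both sides, because
  its outer factors absorb elements of \<open>B\<close>. It is therefore a union of double
  cosets.\<close>

lemma C_product_subset:
  assumes "x \<in> carrier W" "y \<in> carrier W" "z \<in> carrier W" "C z \<inter> (C x <#> C y) \<noteq> {}"
  shows "C z \<subseteq> C x <#> C y"
proof
  fix h assume h: "h \<in> C z"
  obtain a b where ab: "a \<in> C x" "b \<in> C y" "a \<otimes> b \<in> C z"
    using assms(4) by (auto simp: mem_set_mult)
  obtain p q where pq: "p \<in> B" "q \<in> B" "h = p \<otimes> (a \<otimes> b) \<otimes> q"
    using C_single[OF assms(3) ab(3) h] by blast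
  have "h = (p \<otimes> a) \<otimes> (b \<otimes> q)"
    using pq ab C_closed[OF assms(1)] C_closed[OF assms(2)] by (simp add: G.m_assoc)
  thus "h \<in> C x <#> C y"
    using C_mult_left[OF assms(1) ab(1) pq(1)] C_mult_right[OF assms(2) ab(2) pq(2)]
    by (auto simp: mem_set_mult)
qed

lemma C_mult_subset:
  assumes "x \<in> carrier W" "y \<in> carrier W"
  shows "C (x \<otimes>\<^bsub>W\<^esub> y) \<subseteq> C x <#> C y"
  using C_mult_ex[OF assms] assms set_multI[of _ "C x" _ "C y"]
  by (intro C_product_subset) blast+

lemma C_mult_split:
  assumes "x \<in> carrier W" "y \<in> carrier W" "g \<in> C (x \<otimes>\<^bsub>W\<^esub> y)"
  obtains p q where "p \<in> C x" "q \<in> C y" "g = p \<otimes> q"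
  using C_mult_subset[OF assms(1,2)] assms(3) by (force simp: mem_set_mult)

lemma exchange_left_mem:
  assumes "s \<in> S" "x \<in> carrier W" "p \<in> C s" "q \<in> C x"
  shows "p \<otimes> q \<in> C x \<or> p \<otimes> q \<in> C (s \<otimes>\<^bsub>W\<^esub> x)"
  using exchange_left[OF assms(1,2)] set_multI[OF assms(3,4)] by blast

lemma Omega_left_mem:
  assumes "r \<in> \<Omega>" "x \<in> carrier W" "p \<in> C r" "q \<in> C x"
  shows "p \<otimes> q \<in> C (r \<otimes>\<^bsub>W\<^esub> x)"
  using Omega_left[OF assms(1,2)] set_multI[OF assms(3,4)] by blast

text \<open>Inversion swaps the two sides: it preserves \<open>C s\<close>, since \<open>s\<close>
  is an involution, and turns \<open>C x\<close> into the double coset of the inverse of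
  \<open>x\<close>.\<close>

lemma exchange_right:
  assumes "x \<in> carrier W" "s \<in> S"
  shows "C x <#> C s \<subseteq> C x \<union> C (x \<otimes>\<^bsub>W\<^esub> s)"
proof
  fix g assume "g \<in> C x <#> C s"
  then obtain a b where ab: "a \<in> C x" "b \<in> C s" "g = a \<otimes> b" by (auto simp: mem_set_mult)
  have cl: "a \<in> carrier G" "b \<in> carrier G" using ab assms C_closed S_closed by blast+
  have "inv g = inv b \<otimes> inv a" using ab cl by (simp add: G.inv_mult_group)
  moreover have "inv b \<in> C s" "inv a \<in> C (inv\<^bsub>W\<^esub> x)"
    using C_inv[OF _ ab(2)] C_inv[OF _ ab(1)] assms by auto
  ultimately have "inv g \<in> C (inv\<^bsub>W\<^esub> x) \<union> C (s \<otimes>\<^bsub>W\<^esub> inv\<^bsub>W\<^esub> x)"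
    using exchange_left_mem[of s "inv\<^bsub>W\<^esub> x"] assms by auto
  hence "inv (inv g) \<in> C x \<union> C (x \<otimes>\<^bsub>W\<^esub> s)"
    using C_inv[of "inv\<^bsub>W\<^esub> x" "inv g"] C_inv[of "s \<otimes>\<^bsub>W\<^esub> inv\<^bsub>W\<^esub> x" "inv g"] assms
    by (auto simp: W.inv_mult_group)
  thus "g \<in> C x \<union> C (x \<otimes>\<^bsub>W\<^esub> s)" using ab cl by simp
qed

section \<open>Length and disjointness of the double cosets\<close>

lemma len_le: "set ss \<subseteq> S \<Longrightarrow> r \<in> \<Omega> \<Longrightarrow> len (list_prod W ss \<otimes>\<^bsub>W\<^esub> r) \<le> length ss"
  unfolding len_def by (rule Least_le) auto

lemma len_word_le: "set ss \<subseteq> S \<Longrightarrow> len (list_prod W ss) \<le> length ss"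
  using len_le[of ss "\<one>\<^bsub>W\<^esub>"] subgroup.one_closed[OF Omega_subgroup] by simp

lemma len_factorization:
  assumes "x \<in> carrier W"
  obtains ss r where "set ss \<subseteq> S" "r \<in> \<Omega>" "length ss = len x" "x = list_prod W ss \<otimes>\<^bsub>W\<^esub> r"
proof -
  have "\<exists>m ss r. set ss \<subseteq> S \<and> r \<in> \<Omega> \<and> length ss = m \<and> x = list_prod W ss \<otimes>\<^bsub>W\<^esub> r"
    using factorization[OF assms] by auto
  from LeastI_ex[OF this] show ?thesis using that unfolding len_def by blast
qed

lemma len_S_mult:
  assumes "s \<in> S" "x \<in> carrier W"
  shows "len (s \<otimes>\<^bsub>W\<^esub> x) \<le> Suc (len x)"
proof -
  obtain ss r where *: "set ss \<subseteq> S" "r \<in> \<Omega>" "length ss = len x" "x = list_prod W ss \<otimes>\<^bsub>W\<^esub> r"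
    using len_factorization[OF assms(2)] .
  show ?thesis using len_le[of "s # ss" r] * assms by (simp add: W.m_assoc)
qed

text \<open>This is the disjointness in the Bruhat decomposition. The induction runs over the length
  of the shorter element: with \<open>x = s x'\<close>, equality of \<open>C x\<close> and
  \<open>C y\<close> puts \<open>C x'\<close> inside \<open>C s <#> C y\<close>, and exchange leaves
  only the candidates \<open>y\<close> and \<open>s y\<close> for \<open>x'\<close>.\<close>

lemma C_inj_len:
  "\<lbrakk>x \<in> carrier W; y \<in> carrier W; len x \<le> len y; C x \<inter> C y \<noteq> {}\<rbrakk> \<Longrightarrow> x = y"
proof (induction "len x" arbitrary: x y)
  case 0
  obtain ss r where *: "set ss \<subseteq> S" "r \<in> \<Omega>" "length ss = len x" "x = list_prod W ss \<otimes>\<^bsub>W\<^esub> r"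
    using len_factorization[OF 0(2)] .
  hence x: "x = r" using 0(1) by simp
  obtain g where g: "g \<in> C x" "g \<in> C y" using 0 by auto
  let ?r = "inv\<^bsub>W\<^esub> r"
  have r: "?r \<in> \<Omega>" using *(2) Omega_subgroup by (rule_tac subgroup.m_inv_closed)
  obtain p where p: "p \<in> C ?r" using C_nonempty[of ?r] r by auto
  \<comment> \<open>One element of \<open>C ?r\<close> moves both double cosets at once. The first
    becomes \<open>B\<close>, and only the trivial class meets \<open>B\<close>.\<close>
  have "p \<otimes> g \<in> C (?r \<otimes>\<^bsub>W\<^esub> x)" "p \<otimes> g \<in> C (?r \<otimes>\<^bsub>W\<^esub> y)"
    using Omega_left_mem[OF r 0(2)] Omega_left_mem[OF r 0(3)] p g by auto
  hence "?r \<otimes>\<^bsub>W\<^esub> y = \<one>\<^bsub>W\<^esub>" using x * 0(3) C_meets_B[of "?r \<otimes>\<^bsub>W\<^esub> y"] by (auto simp: C_one)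
  hence "r \<otimes>\<^bsub>W\<^esub> (?r \<otimes>\<^bsub>W\<^esub> y) = r" using * by simp
  thus ?case using x * 0(3) by (simp flip: W.m_assoc)
next
  case (Suc n)
  obtain ss r where *: "set ss \<subseteq> S" "r \<in> \<Omega>" "length ss = len x" "x = list_prod W ss \<otimes>\<^bsub>W\<^esub> r"
    using len_factorization[OF Suc(3)] .
  then obtain s ss' where ss: "ss = s # ss'" using Suc(2) by (cases ss) auto
  define x' where "x' = list_prod W ss' \<otimes>\<^bsub>W\<^esub> r"
  have s: "s \<in> S" and x': "x' \<in> carrier W" using * ss by (auto simp: x'_def)
  have x: "x = s \<otimes>\<^bsub>W\<^esub> x'" using * ss by (simp add: x'_def W.m_assoc)
  have "len x' \<le> n" using len_le[of ss' r] * ss Suc(2) by (simp add: x'_def)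
  hence n: "n = len x'" using len_S_mult[OF s x'] Suc(2) x by simp
  have xy: "C x = C y" using C_eqI Suc by blast
  have "C x' \<subseteq> C s <#> C y"
    using C_mult_subset[of s x] s Suc(3) x x' xy by simp
  moreover have "C s <#> C y \<subseteq> C y \<union> C (s \<otimes>\<^bsub>W\<^esub> y)" using exchange_left s Suc by blast
  ultimately consider "C x' \<inter> C y \<noteq> {}" | "C x' \<inter> C (s \<otimes>\<^bsub>W\<^esub> y) \<noteq> {}"
    using C_nonempty[OF x'] by blast
  thus ?case
  proof cases
    case 1
    \<comment> \<open>This candidate is too long: \<open>len x' = n\<close>, whereas
      \<open>len y\<close> is at least \<open>Suc n\<close>.\<close>
    hence "x' = y" using Suc.hyps(1)[OF n x' Suc(4)] n Suc.hyps(2) Suc(5) by simp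
    thus ?thesis using n Suc(2) Suc(5) by simp
  next
    case 2
    \<comment> \<open>Multiplication by \<open>s\<close> lowers the length of \<open>y\<close> by at
      most one, so \<open>x'\<close> is still not longer than \<open>s y\<close> and the induction
      hypothesis applies.\<close>
    have "len y \<le> Suc (len (s \<otimes>\<^bsub>W\<^esub> y))" using len_S_mult[of s "s \<otimes>\<^bsub>W\<^esub> y"] s Suc(4) by simp
    hence "x' = s \<otimes>\<^bsub>W\<^esub> y" using Suc.hyps(1)[OF n x' _ _ 2] n Suc.hyps(2) Suc(4,5) s by simp
    thus ?thesis using x s Suc(4) by simp
  qed
qed

lemma C_inj:
  assumes "x \<in> carrier W" "y \<in> carrier W" "g \<in> C x" "g \<in> C y" shows "x = y"
  using C_inj_len[of x y] C_inj_len[of y x] assms by (cases "len x \<le> len y") auto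

section \<open>Descents and the exchange condition\<close>

lemma not_descent_mult:
  assumes "x \<in> carrier W" "s \<in> S" "\<not> descent x s"
  shows "C x <#> C s = C (x \<otimes>\<^bsub>W\<^esub> s)"
  using exchange_right[OF assms(1,2)] C_mult_subset[of x s] assms unfolding descent_def by auto

lemma not_descent_mem:
  assumes "x \<in> carrier W" "s \<in> S" "\<not> descent x s" "p \<in> C x" "q \<in> C s"
  shows "p \<otimes> q \<in> C (x \<otimes>\<^bsub>W\<^esub> s)"
  using not_descent_mult[OF assms(1-3)] set_multI[OF assms(4,5)] by blast

lemma descent_subset:
  assumes "x \<in> carrier W" "s \<in> S" "descent x s"
  shows "C x \<subseteq> C x <#> C s"
  using C_product_subset[of x s x] assms by (auto simp: descent_def)

lemma not_descent_one: "s \<in> S \<Longrightarrow> \<not> descent \<one>\<^bsub>W\<^esub> s"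
proof
  assume s: "s \<in> S" and "descent \<one>\<^bsub>W\<^esub> s"
  then obtain a b where ab: "a \<in> B" "b \<in> C s" "a \<otimes> b \<in> B"
    by (auto simp: descent_def C_one mem_set_mult)
  hence "a \<otimes> b \<in> C s" using C_mult_left s by simp
  thus False using C_meets_B[of s] ab s one_notin_S by auto
qed

text \<open>The nondegeneracy \<open>C_square\<close> enters here: without a descent,
  \<open>C s <#> C s\<close> would be the single double coset of \<open>s s\<close>, which is
  \<open>B\<close>.\<close>

lemma descent_S: assumes s: "s \<in> S" shows "descent s s"
proof (rule ccontr)
  assume "\<not> descent s s"
  hence "C s <#> C s = B" using not_descent_mult[of s s] s by (simp add: S_square C_one)
  thus False using C_square s by blast
qed

text \<open>A fixed element of the double coset of the inverse of \<open>r\<close> carries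
  \<open>C (r x)\<close> into \<open>C x\<close> by left multiplication and does not touch the
  factor in \<open>C s\<close> on the right.\<close>

lemma descent_Omega_mult:
  assumes "r \<in> \<Omega>" "x \<in> carrier W" "s \<in> S" "descent (r \<otimes>\<^bsub>W\<^esub> x) s"
  shows "descent x s"
proof -
  let ?r = "inv\<^bsub>W\<^esub> r"
  have r: "?r \<in> \<Omega>" using assms(1) Omega_subgroup by (rule_tac subgroup.m_inv_closed)
  have rx: "?r \<otimes>\<^bsub>W\<^esub> (r \<otimes>\<^bsub>W\<^esub> x) = x" using assms by (simp flip: W.m_assoc)
  obtain a b where ab: "a \<in> C (r \<otimes>\<^bsub>W\<^esub> x)" "b \<in> C s" "a \<otimes> b \<in> C (r \<otimes>\<^bsub>W\<^esub> x)"
    using assms(4) by (auto simp: descent_def mem_set_mult)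
  obtain p where p: "p \<in> C ?r" using C_nonempty[of ?r] r by auto
  have *: "p \<otimes> a \<in> C x" "p \<otimes> (a \<otimes> b) \<in> C x"
    using Omega_left_mem[OF r, of "r \<otimes>\<^bsub>W\<^esub> x" p] assms rx p ab by auto
  have "p \<in> carrier G" "a \<in> carrier G" "b \<in> carrier G"
    using p ab r assms C_closed by (meson Omega_closed S_closed W.m_closed)+
  hence "p \<otimes> (a \<otimes> b) = (p \<otimes> a) \<otimes> b" by (simp add: G.m_assoc)
  thus ?thesis using * ab unfolding descent_def by (fastforce simp: mem_set_mult)
qed

lemma exchange_step:
  assumes s: "s \<in> S" and x: "x \<in> carrier W" and t: "t \<in> S"
    and d: "descent (s \<otimes>\<^bsub>W\<^esub> x) t" and nd: "\<not> descent x t"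
  shows "s \<otimes>\<^bsub>W\<^esub> x \<otimes>\<^bsub>W\<^esub> t = x"
proof -
  obtain a b where ab: "a \<in> C (s \<otimes>\<^bsub>W\<^esub> x)" "b \<in> C t" "a \<otimes> b \<in> C (s \<otimes>\<^bsub>W\<^esub> x)"
    using d by (auto simp: descent_def mem_set_mult)
  obtain p q where pq: "p \<in> C s" "q \<in> C x" "a = p \<otimes> q"
    using C_mult_split[of s x] s x ab by auto
  have cl: "p \<in> carrier G" "q \<in> carrier G" "b \<in> carrier G"
    using C_closed s x t ab pq S_closed by blast+
  \<comment> \<open>Bracketed to the right, the same product \<open>p q b\<close> first uses that
    \<open>t\<close> is no descent of \<open>x\<close>, and only then the exchange for
    \<open>s\<close>.\<close>
  have "q \<otimes> b \<in> C (x \<otimes>\<^bsub>W\<^esub> t)"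
    using not_descent_mem[OF x t nd] pq ab by auto
  hence "p \<otimes> (q \<otimes> b) \<in> C (x \<otimes>\<^bsub>W\<^esub> t) \<union> C (s \<otimes>\<^bsub>W\<^esub> (x \<otimes>\<^bsub>W\<^esub> t))"
    using exchange_left_mem[OF s, of "x \<otimes>\<^bsub>W\<^esub> t"] x t pq by auto
  hence "a \<otimes> b \<in> C (x \<otimes>\<^bsub>W\<^esub> t) \<union> C (s \<otimes>\<^bsub>W\<^esub> x \<otimes>\<^bsub>W\<^esub> t)"
    using pq cl s x t by (simp add: G.m_assoc W.m_assoc)
  hence "s \<otimes>\<^bsub>W\<^esub> x = x \<otimes>\<^bsub>W\<^esub> t \<or> s \<otimes>\<^bsub>W\<^esub> x = s \<otimes>\<^bsub>W\<^esub> x \<otimes>\<^bsub>W\<^esub> t"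
    using C_inj[OF _ _ ab(3), of "x \<otimes>\<^bsub>W\<^esub> t"]
      C_inj[OF _ _ ab(3), of "s \<otimes>\<^bsub>W\<^esub> x \<otimes>\<^bsub>W\<^esub> t"] s x t by auto
  moreover have "s \<otimes>\<^bsub>W\<^esub> x \<noteq> s \<otimes>\<^bsub>W\<^esub> x \<otimes>\<^bsub>W\<^esub> t" using mult_S_neq[of t "s \<otimes>\<^bsub>W\<^esub> x"] s x t by simp
  ultimately show ?thesis using x t by simp
qed

text \<open>Read from right to left, the word has a letter \<open>s\<close> at which
  \<open>t\<close> becomes a descent, and there \<open>exchange_step\<close> trades \<open>t\<close>
  for the deletion of \<open>s\<close>. The tail \<open>u\<close> stays untouched; it will be an
  element of \<Omega>, such an element times a word, or \<open>w\<close>. The new word uses only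
  letters of the old one, so it stays inside a given \<open>X\<close>.\<close>

lemma exchange_word:
  assumes "set ss \<subseteq> S" "u \<in> carrier W" "t \<in> S"
    and "descent (list_prod W ss \<otimes>\<^bsub>W\<^esub> u) t" "\<not> descent u t"
  shows "\<exists>ss'. set ss' \<subseteq> set ss \<and> length ss' < length ss \<and>
           list_prod W ss \<otimes>\<^bsub>W\<^esub> u \<otimes>\<^bsub>W\<^esub> t = list_prod W ss' \<otimes>\<^bsub>W\<^esub> u"
  using assms
proof (induction ss)
  case Nil
  thus ?case by simp
next
  case (Cons s ss)
  let ?x = "list_prod W ss \<otimes>\<^bsub>W\<^esub> u"
  have s: "s \<in> S" and x: "?x \<in> carrier W" using Cons.prems by auto
  have d: "descent (s \<otimes>\<^bsub>W\<^esub> ?x) t" using Cons.prems by (simp add: W.m_assoc)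
  show ?case
  proof (cases "descent ?x t")
    case True
    then obtain ss' where "set ss' \<subseteq> set ss" "length ss' < length ss"
      "?x \<otimes>\<^bsub>W\<^esub> t = list_prod W ss' \<otimes>\<^bsub>W\<^esub> u" using Cons by auto
    moreover have "set ss' \<subseteq> S" using calculation(1) Cons.prems by auto
    ultimately show ?thesis using Cons.prems
      by (intro exI[of _ "s # ss'"]) (auto simp: W.m_assoc)
  next
    case False
    thus ?thesis using exchange_step[OF s x Cons.prems(3) d] Cons.prems
      by (intro exI[of _ ss]) (auto simp: W.m_assoc)
  qed
qed

lemma descent_len:
  assumes "x \<in> carrier W" "t \<in> S" "descent x t"
  shows "len (x \<otimes>\<^bsub>W\<^esub> t) < len x"
proof -
  obtain ss r where *: "set ss \<subseteq> S" "r \<in> \<Omega>" "length ss = len x" "x = list_prod W ss \<otimes>\<^bsub>W\<^esub> r"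
    using len_factorization[OF assms(1)] .
  have "\<not> descent r t"
    using descent_Omega_mult[OF *(2), of "\<one>\<^bsub>W\<^esub>" t] not_descent_one *(2) assms by auto
  then obtain ss' where "set ss' \<subseteq> set ss" "length ss' < length ss"
    "x \<otimes>\<^bsub>W\<^esub> t = list_prod W ss' \<otimes>\<^bsub>W\<^esub> r"
    using exchange_word[of ss r t] * assms by auto
  moreover from this(1) have "set ss' \<subseteq> S" using *(1) by simp
  ultimately show ?thesis using len_le[of ss' r] *(2,3) by simp
qed

lemma descent_mult_S:
  assumes x: "x \<in> carrier W" and t: "t \<in> S" and nd: "\<not> descent x t"
  shows "descent (x \<otimes>\<^bsub>W\<^esub> t) t"
proof (rule ccontr)
  assume "\<not> descent (x \<otimes>\<^bsub>W\<^esub> t) t"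
  hence *: "C (x \<otimes>\<^bsub>W\<^esub> t) <#> C t = C x" using not_descent_mult[of "x \<otimes>\<^bsub>W\<^esub> t" t] x t by simp
  obtain a b where ab: "a \<in> C x" "b \<in> C t" "a \<otimes> b \<in> C (x \<otimes>\<^bsub>W\<^esub> t)"
    using C_mult_ex[OF x, of t] t by auto
  \<comment> \<open>Since \<open>t\<close> is a descent of itself, \<open>b\<close> factors within
    \<open>C t\<close>. Under the assumption to be refuted, \<open>a b = (a p) q\<close> then also
    lies in \<open>C x\<close>.\<close>
  obtain p q where pq: "p \<in> C t" "q \<in> C t" "b = p \<otimes> q"
    using subsetD[OF descent_subset[OF _ t descent_S[OF t]] ab(2)] t
    by (auto simp: mem_set_mult)
  have "a \<otimes> p \<in> C (x \<otimes>\<^bsub>W\<^esub> t)" using not_descent_mem[OF x t nd] ab pq by auto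
  hence "a \<otimes> p \<otimes> q \<in> C x" using set_multI[OF _ pq(2), of "a \<otimes> p" "C (x \<otimes>\<^bsub>W\<^esub> t)" G] * by simp
  moreover have "a \<otimes> p \<otimes> q = a \<otimes> b"
    using ab pq C_closed[OF x] C_closed[of t] t by (simp add: G.m_assoc)
  ultimately have "x \<otimes>\<^bsub>W\<^esub> t = x" using C_inj[OF _ _ ab(3), of x] x t by simp
  thus False using mult_S_neq x t by blast
qed

lemma not_descent_len:
  assumes "x \<in> carrier W" "t \<in> S" "\<not> descent x t"
  shows "len x < len (x \<otimes>\<^bsub>W\<^esub> t)"
  using descent_len[of "x \<otimes>\<^bsub>W\<^esub> t" t] descent_mult_S[OF assms] assms by simp

section \<open>Words in a subset of the generators\<close>

lemma words_closed: "X \<subseteq> S \<Longrightarrow> x \<in> words X \<Longrightarrow> x \<in> carrier W"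
  by (auto simp: words_def)

lemma one_in_words: "\<one>\<^bsub>W\<^esub> \<in> words X"
  by (auto simp: words_def intro: exI[of _ "[]"])

lemma S_in_words: "X \<subseteq> S \<Longrightarrow> s \<in> X \<Longrightarrow> s \<in> words X"
  by (auto simp: words_def intro!: exI[of _ "[s]"])

lemma words_mult:
  assumes "X \<subseteq> S" "x \<in> words X" "y \<in> words X" shows "x \<otimes>\<^bsub>W\<^esub> y \<in> words X"
proof -
  obtain ss ss' where "set ss \<subseteq> X" "x = list_prod W ss" "set ss' \<subseteq> X" "y = list_prod W ss'"
    using assms by (auto simp: words_def)
  thus ?thesis using word_append[of ss ss'] assms(1)
    by (auto simp: words_def intro!: exI[of _ "ss @ ss'"])
qed

lemma words_inv:
  assumes "X \<subseteq> S" "x \<in> words X" shows "inv\<^bsub>W\<^esub> x \<in> words X"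
proof -
  have "inv\<^bsub>W\<^esub> (list_prod W ss) \<in> words X" if "set ss \<subseteq> X" for ss
    using that
  proof (induction ss)
    case Nil
    thus ?case using one_in_words by simp
  next
    case (Cons s ss)
    hence "set ss \<subseteq> S" "s \<in> S" "inv\<^bsub>W\<^esub> (list_prod W ss) \<in> words X" "s \<in> words X"
      using assms(1) S_in_words by auto
    thus ?case using words_mult[OF assms(1)] by (simp add: W.inv_mult_group)
  qed
  thus ?thesis using assms by (auto simp: words_def)
qed

lemma shortest_ex:
  assumes "x \<in> words X"
  obtains ss where "shortest X ss" "x = list_prod W ss"
proof -
  let ?P = "\<lambda>ss. set ss \<subseteq> X \<and> list_prod W ss = x"
  have "\<exists>ss. ?P ss" using assms by (auto simp: words_def)
  then obtain ss where ss: "?P ss" "\<And>ss'. ?P ss' \<Longrightarrow> length ss \<le> length ss'"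
    using ex_has_least_nat[of ?P _ length] by blast
  show ?thesis using ss by (intro that[of ss]) (auto simp: shortest_def)
qed

lemma shortest_append:
  assumes X: "X \<subseteq> S" and sh: "shortest X (ss @ ss')"
  shows "shortest X ss" "shortest X ss'"
proof -
  have *: "set ss \<subseteq> X" "set ss' \<subseteq> X" "set ss \<subseteq> S" "set ss' \<subseteq> S"
    using assms by (auto simp: shortest_def)
  have "length ss \<le> length us" if "set us \<subseteq> X" "list_prod W us = list_prod W ss" for us
  proof -
    have "set (us @ ss') \<subseteq> X" "list_prod W (us @ ss') = list_prod W (ss @ ss')"
      using that * X by (auto simp: word_append)
    hence "length (ss @ ss') \<le> length (us @ ss')" using sh unfolding shortest_def by blast
    thus ?thesis by simp
  qed
  thus "shortest X ss" using * by (auto simp: shortest_def)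
  have "length ss' \<le> length us" if "set us \<subseteq> X" "list_prod W us = list_prod W ss'" for us
  proof -
    have "set (ss @ us) \<subseteq> X" "list_prod W (ss @ us) = list_prod W (ss @ ss')"
      using that * X by (auto simp: word_append)
    hence "length (ss @ ss') \<le> length (ss @ us)" using sh unfolding shortest_def by blast
    thus ?thesis by simp
  qed
  thus "shortest X ss'" using * by (auto simp: shortest_def)
qed

text \<open>Exchange with trivial tail would rewrite the whole word with fewer letters, all of them
  from \<open>ss\<close> and so from \<open>X\<close>. This is why it suffices to compare with words
  in \<open>X\<close>.\<close>

lemma shortest_not_descent:
  assumes X: "X \<subseteq> S" and sh: "shortest X (ss @ [t])"
  shows "\<not> descent (list_prod W ss) t"
proof
  assume d: "descent (list_prod W ss) t"
  have *: "set ss \<subseteq> X" "t \<in> X" "set ss \<subseteq> S" "t \<in> S"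
    using assms by (auto simp: shortest_def)
  then obtain ss' where ss': "set ss' \<subseteq> set ss" "length ss' < length ss"
    "list_prod W ss \<otimes>\<^bsub>W\<^esub> t = list_prod W ss'"
    using exchange_word[of ss "\<one>\<^bsub>W\<^esub>" t] d not_descent_one[of t] by force
  have "list_prod W ss' = list_prod W (ss @ [t])" "set ss' \<subseteq> X"
    using ss' * by (auto simp: word_append)
  hence "length (ss @ [t]) \<le> length ss'" using sh unfolding shortest_def by blast
  thus False using ss' by simp
qed

text \<open>No letter of the word is a descent of the part before it, so each one raises the length.
  Consequently a word that is shortest among words in \<open>X\<close> is shortest among all words
  in \<open>S\<close>, even up to a factor in \<Omega>.\<close>

lemma shortest_len: "X \<subseteq> S \<Longrightarrow> shortest X ss \<Longrightarrow> len (list_prod W ss) = length ss"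
proof (induction ss rule: rev_induct)
  case Nil
  thus ?case using len_word_le[of "[]"] by simp
next
  case (snoc t ss)
  have *: "set ss \<subseteq> S" "t \<in> S" using snoc by (auto simp: shortest_def)
  have "len (list_prod W ss) < len (list_prod W ss \<otimes>\<^bsub>W\<^esub> t)"
    using not_descent_len[OF _ _ shortest_not_descent[OF snoc.prems]] * by simp
  thus ?case using snoc.IH[OF snoc.prems(1) shortest_append(1)[OF snoc.prems]]
      len_word_le[of "ss @ [t]"] * by (simp add: word_append)
qed

section \<open>Shortest elements of cosets of \<open>words Y\<close>\<close>

text \<open>Write \<open>v\<close> as a word \<open>ss\<close> followed by \<open>r\<close> in
  \<Omega>. As \<open>y\<close> is a descent neither of \<open>?x\<close> nor of
  \<open>r ?x\<close>, exchange must delete a letter of \<open>ss\<close>. Then \<open>v\<close>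
  times a conjugate of \<open>y\<close> in \<open>words Y\<close> would be shorter than
  \<open>v\<close>.\<close>

lemma minimal_not_descent:
  assumes Y: "Y \<subseteq> S" and v: "v \<in> carrier W"
    and min: "\<And>y. y \<in> words Y \<Longrightarrow> len v \<le> len (v \<otimes>\<^bsub>W\<^esub> y)"
    and sh: "shortest Y (ys @ [y])"
  shows "\<not> descent (v \<otimes>\<^bsub>W\<^esub> list_prod W ys) y"
proof
  let ?x = "list_prod W ys"
  assume d: "descent (v \<otimes>\<^bsub>W\<^esub> ?x) y"
  have ys: "set ys \<subseteq> Y" "set ys \<subseteq> S" "y \<in> Y" "y \<in> S" using sh Y by (auto simp: shortest_def)
  obtain ss r where *: "set ss \<subseteq> S" "r \<in> \<Omega>" "length ss = len v" "v = list_prod W ss \<otimes>\<^bsub>W\<^esub> r"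
    using len_factorization[OF v] .
  have nd: "\<not> descent (r \<otimes>\<^bsub>W\<^esub> ?x) y"
    using descent_Omega_mult[OF *(2)] shortest_not_descent[OF Y sh] ys by auto
  have rx: "r \<otimes>\<^bsub>W\<^esub> ?x \<in> carrier W" using *(2) ys(2) by simp
  have vx: "v \<otimes>\<^bsub>W\<^esub> ?x = list_prod W ss \<otimes>\<^bsub>W\<^esub> (r \<otimes>\<^bsub>W\<^esub> ?x)"
    using *(2,4) word_closed[OF *(1)] ys(2) by (simp add: W.m_assoc)
  obtain ss' where ss': "set ss' \<subseteq> set ss" "length ss' < length ss"
    "v \<otimes>\<^bsub>W\<^esub> ?x \<otimes>\<^bsub>W\<^esub> y = list_prod W ss' \<otimes>\<^bsub>W\<^esub> (r \<otimes>\<^bsub>W\<^esub> ?x)"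
    using exchange_word[OF *(1) rx ys(4) d[unfolded vx] nd] unfolding vx by blast
  have ss'S: "set ss' \<subseteq> S" using ss' * by auto
  \<comment> \<open>The conjugate of \<open>y\<close> by \<open>?x\<close> is chosen so that in
    \<open>v ?z\<close> the factor \<open>?x\<close> cancels again on the right, leaving
    \<open>ss'\<close> followed by \<open>r\<close>.\<close>
  let ?z = "?x \<otimes>\<^bsub>W\<^esub> y \<otimes>\<^bsub>W\<^esub> inv\<^bsub>W\<^esub> ?x"
  have x: "?x \<in> words Y" using ys by (auto simp: words_def)
  have z: "?z \<in> words Y"
    using x S_in_words[OF Y ys(3)] by (intro words_mult[OF Y] words_inv[OF Y])
  have "v \<otimes>\<^bsub>W\<^esub> ?z = v \<otimes>\<^bsub>W\<^esub> ?x \<otimes>\<^bsub>W\<^esub> y \<otimes>\<^bsub>W\<^esub> inv\<^bsub>W\<^esub> ?x"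
    using v ys(2,4) by (simp add: W.m_assoc)
  also have "\<dots> = list_prod W ss' \<otimes>\<^bsub>W\<^esub> (r \<otimes>\<^bsub>W\<^esub> ?x) \<otimes>\<^bsub>W\<^esub> inv\<^bsub>W\<^esub> ?x"
    by (simp only: ss'(3))
  also have "\<dots> = list_prod W ss' \<otimes>\<^bsub>W\<^esub> r"
    using ss'S *(2) ys(2) by (simp add: W.m_assoc)
  finally have "len v \<le> length ss'" using min[OF z] len_le[OF ss'S *(2)] by simp
  thus False using ss' * by simp
qed

text \<open>Along a shortest word in \<open>Y\<close>, a new letter \<open>y\<close> is a descent
  neither of the word read so far nor of \<open>v\<close> times it, so both sides are multiplied by
  \<open>C y\<close> without splitting.\<close>

lemma minimal_mult:
  assumes Y: "Y \<subseteq> S" and v: "v \<in> carrier W"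
    and min: "\<And>y. y \<in> words Y \<Longrightarrow> len v \<le> len (v \<otimes>\<^bsub>W\<^esub> y)"
    and y: "y \<in> words Y"
  shows "C v <#> C y = C (v \<otimes>\<^bsub>W\<^esub> y)"
proof -
  have "C v <#> C (list_prod W ys) = C (v \<otimes>\<^bsub>W\<^esub> list_prod W ys)" if "shortest Y ys" for ys
    using that
  proof (induction ys rule: rev_induct)
    case Nil
    have "C v <#> B = C v"
      using C_mult_subset[OF v, of "\<one>\<^bsub>W\<^esub>"] C_mult_right[OF v] v by (auto simp: C_one mem_set_mult)
    thus ?case using v by (simp add: C_one)
  next
    case (snoc y ys)
    have ys: "set ys \<subseteq> S" "y \<in> S" using snoc.prems Y by (auto simp: shortest_def)
    have "C (list_prod W (ys @ [y])) = C (list_prod W ys) <#> C y"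
      using not_descent_mult[OF _ _ shortest_not_descent[OF Y snoc.prems]] ys
      by (simp add: word_append)
    hence "C v <#> C (list_prod W (ys @ [y])) = C v <#> C (list_prod W ys) <#> C y"
      using ys v C_carrier by (simp add: G.set_mult_assoc)
    also have "\<dots> = C (v \<otimes>\<^bsub>W\<^esub> list_prod W ys) <#> C y"
      using snoc.IH[OF shortest_append(1)[OF Y snoc.prems]] by simp
    also have "\<dots> = C (v \<otimes>\<^bsub>W\<^esub> list_prod W ys \<otimes>\<^bsub>W\<^esub> y)"
      using not_descent_mult[OF _ _ minimal_not_descent[OF Y v min snoc.prems]] ys v
      by simp
    finally show ?case using ys v by (simp add: word_append W.m_assoc)
  qed
  moreover obtain ys where "shortest Y ys" "y = list_prod W ys" using shortest_ex[OF y] .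
  ultimately show ?thesis by simp
qed

text \<open>If \<open>x\<close> is nontrivial, let \<open>y\<close> be the last letter of a shortest
  word for it. The length rises from \<open>v x y\<close> to \<open>v x\<close> because
  \<open>v\<close> is minimal, and from \<open>v x\<close> to \<open>v x y\<close> because
  \<open>y\<close> is not a descent of \<open>v x\<close>, which is absurd.\<close>

lemma no_descent_unique:
  assumes Y: "Y \<subseteq> S" and v: "v \<in> carrier W"
    and min: "\<And>y. y \<in> words Y \<Longrightarrow> len v \<le> len (v \<otimes>\<^bsub>W\<^esub> y)"
    and x: "x \<in> words Y" and nd: "\<And>y. y \<in> Y \<Longrightarrow> \<not> descent (v \<otimes>\<^bsub>W\<^esub> x) y"
  shows "v \<otimes>\<^bsub>W\<^esub> x = v"
proof -
  obtain ys where ys: "shortest Y ys" "x = list_prod W ys" using shortest_ex[OF x] .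
  show ?thesis
  proof (cases ys rule: rev_cases)
    case Nil
    thus ?thesis using ys v by simp
  next
    case (snoc zs y)
    let ?z = "v \<otimes>\<^bsub>W\<^esub> list_prod W zs"
    have zs: "set zs \<subseteq> S" "y \<in> S" "y \<in> Y" using ys snoc Y by (auto simp: shortest_def)
    have eq: "v \<otimes>\<^bsub>W\<^esub> x = ?z \<otimes>\<^bsub>W\<^esub> y" using ys snoc zs v by (simp add: word_append W.m_assoc)
    have "len ?z < len (?z \<otimes>\<^bsub>W\<^esub> y)"
      using not_descent_len[OF _ _ minimal_not_descent[OF Y v min]] ys snoc zs v by simp
    moreover have "?z \<otimes>\<^bsub>W\<^esub> y \<in> carrier W" using zs v by simp
    hence "len (?z \<otimes>\<^bsub>W\<^esub> y) < len (?z \<otimes>\<^bsub>W\<^esub> y \<otimes>\<^bsub>W\<^esub> y)"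
      using not_descent_len[OF _ zs(2) nd[OF zs(3)]] unfolding eq by blast
    ultimately show ?thesis using zs v by simp
  qed
qed

lemma minimal_in_coset:
  assumes "Y \<subseteq> S" "v \<in> carrier W"
  obtains v0 x where "v0 \<in> carrier W" "x \<in> words Y" "v = v0 \<otimes>\<^bsub>W\<^esub> x"
    "\<And>y. y \<in> words Y \<Longrightarrow> len v0 \<le> len (v0 \<otimes>\<^bsub>W\<^esub> y)"
proof -
  obtain z where z: "z \<in> words Y" "\<And>y. y \<in> words Y \<Longrightarrow> len (v \<otimes>\<^bsub>W\<^esub> z) \<le> len (v \<otimes>\<^bsub>W\<^esub> y)"
    using ex_has_least_nat[of "\<lambda>z. z \<in> words Y" _ "\<lambda>z. len (v \<otimes>\<^bsub>W\<^esub> z)"] one_in_words[of Y] by blast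
  have zc: "z \<in> carrier W" using words_closed assms z by blast
  show ?thesis
  proof (rule that[of "v \<otimes>\<^bsub>W\<^esub> z" "inv\<^bsub>W\<^esub> z"])
    show "inv\<^bsub>W\<^esub> z \<in> words Y" using words_inv assms z by blast
    show "len (v \<otimes>\<^bsub>W\<^esub> z) \<le> len (v \<otimes>\<^bsub>W\<^esub> z \<otimes>\<^bsub>W\<^esub> y)" if "y \<in> words Y" for y
      using z(2)[OF words_mult[OF assms(1) z(1) that]] that zc words_closed[OF assms(1)] assms
      by (simp add: W.m_assoc)
  qed (use assms zc in \<open>simp_all add: W.m_assoc\<close>)
qed

text \<open>The condition \<open>u w = w y\<close> says that \<open>u \<in> W\<^sub>X \<inter> w W\<^sub>Y w\<^sup>-\<^sup>1\<close>.\<close>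

definition min_left_reps :: "'w set \<Rightarrow> 'w set \<Rightarrow> 'w \<Rightarrow> 'w set" where
  "min_left_reps X Y w = {\<tau> \<in> words X.
     \<forall>u\<in>words X. \<forall>y\<in>words Y. u \<otimes>\<^bsub>W\<^esub> w = w \<otimes>\<^bsub>W\<^esub> y \<longrightarrow> len \<tau> \<le> len (\<tau> \<otimes>\<^bsub>W\<^esub> u)}"

text \<open>Among the elements \<open>x u\<close> with \<open>u\<close> in \<open>words X\<close>
  and in the conjugate of \<open>words Y\<close> by \<open>w\<close>, a shortest one serves as
  \<tau>. From \<open>u w = w y\<close>, the inverse of \<open>u\<close> passes through
  \<open>w\<close> as the inverse of \<open>y\<close>, which is the factor returned.\<close>

lemma min_left_reps_ex:
  assumes X: "X \<subseteq> S" and Y: "Y \<subseteq> S" and w: "w \<in> carrier W" and x: "x \<in> words X"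
  obtains \<tau> y where "\<tau> \<in> min_left_reps X Y w" "y \<in> words Y"
    "x \<otimes>\<^bsub>W\<^esub> w = \<tau> \<otimes>\<^bsub>W\<^esub> w \<otimes>\<^bsub>W\<^esub> y"
proof -
  let ?U = "{u \<in> words X. \<exists>y\<in>words Y. u \<otimes>\<^bsub>W\<^esub> w = w \<otimes>\<^bsub>W\<^esub> y}"
  have "\<one>\<^bsub>W\<^esub> \<in> ?U" using one_in_words[of X] one_in_words[of Y] w by force
  then obtain u where u: "u \<in> ?U" "\<And>u'. u' \<in> ?U \<Longrightarrow> len (x \<otimes>\<^bsub>W\<^esub> u) \<le> len (x \<otimes>\<^bsub>W\<^esub> u')"
    using ex_has_least_nat[of "\<lambda>u. u \<in> ?U" _ "\<lambda>u. len (x \<otimes>\<^bsub>W\<^esub> u)"] by blast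
  then obtain y where y: "y \<in> words Y" "u \<otimes>\<^bsub>W\<^esub> w = w \<otimes>\<^bsub>W\<^esub> y" and uX: "u \<in> words X" by auto
  have cl: "u \<in> carrier W" "x \<in> carrier W" "y \<in> carrier W"
    using words_closed X Y uX x y by blast+
  show ?thesis
  proof (rule that)
    show "x \<otimes>\<^bsub>W\<^esub> u \<in> min_left_reps X Y w"
    proof -
      have "len (x \<otimes>\<^bsub>W\<^esub> u) \<le> len (x \<otimes>\<^bsub>W\<^esub> u \<otimes>\<^bsub>W\<^esub> u')"
        if "u' \<in> words X" "y' \<in> words Y" "u' \<otimes>\<^bsub>W\<^esub> w = w \<otimes>\<^bsub>W\<^esub> y'" for u' y'
      proof -
        have cl': "u' \<in> carrier W" "y' \<in> carrier W" using words_closed X Y that by blast+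
        \<comment> \<open>The set \<open>?U\<close> is closed under products, so minimality within
          \<open>x ?U\<close> implies minimality within the coset of the new representative.\<close>
        have "u \<otimes>\<^bsub>W\<^esub> u' \<otimes>\<^bsub>W\<^esub> w = u \<otimes>\<^bsub>W\<^esub> w \<otimes>\<^bsub>W\<^esub> y'"
          using cl cl' that w by (simp add: W.m_assoc)
        also have "\<dots> = w \<otimes>\<^bsub>W\<^esub> (y \<otimes>\<^bsub>W\<^esub> y')" using cl cl' y w by (simp add: W.m_assoc)
        finally have "u \<otimes>\<^bsub>W\<^esub> u' \<in> ?U"
          using words_mult[OF X uX that(1)] words_mult[OF Y y(1) that(2)] by auto
        from u(2)[OF this] show ?thesis using cl cl' by (simp add: W.m_assoc)
      qed
      thus ?thesis using words_mult[OF X x uX] by (auto simp: min_left_reps_def)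
    qed
    show "inv\<^bsub>W\<^esub> y \<in> words Y" using words_inv Y y by blast
    have "x \<otimes>\<^bsub>W\<^esub> u \<otimes>\<^bsub>W\<^esub> w \<otimes>\<^bsub>W\<^esub> inv\<^bsub>W\<^esub> y = x \<otimes>\<^bsub>W\<^esub> (w \<otimes>\<^bsub>W\<^esub> y) \<otimes>\<^bsub>W\<^esub> inv\<^bsub>W\<^esub> y"
      using cl w by (simp add: W.m_assoc flip: y(2))
    thus "x \<otimes>\<^bsub>W\<^esub> w = x \<otimes>\<^bsub>W\<^esub> u \<otimes>\<^bsub>W\<^esub> w \<otimes>\<^bsub>W\<^esub> inv\<^bsub>W\<^esub> y" using cl w by (simp add: W.m_assoc)
  qed
qed

lemma min_left_reps_no_descent:
  assumes X: "X \<subseteq> S" and Y: "Y \<subseteq> S" and w: "w \<in> carrier W"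
    and min: "\<And>y. y \<in> words Y \<Longrightarrow> len w \<le> len (w \<otimes>\<^bsub>W\<^esub> y)"
    and \<tau>: "\<tau> \<in> min_left_reps X Y w" and t: "t \<in> Y"
  shows "\<not> descent (\<tau> \<otimes>\<^bsub>W\<^esub> w) t"
proof
  assume d: "descent (\<tau> \<otimes>\<^bsub>W\<^esub> w) t"
  have \<tau>X: "\<tau> \<in> words X" using \<tau> by (simp add: min_left_reps_def)
  then obtain ss where ss: "shortest X ss" "\<tau> = list_prod W ss" using shortest_ex by blast
  have ssX: "set ss \<subseteq> X" "set ss \<subseteq> S" using ss X by (auto simp: shortest_def)
  have tS: "t \<in> S" "t \<in> words Y" using t Y S_in_words by auto
  have "\<not> descent w t" using descent_len[OF w tS(1)] min[OF tS(2)] by auto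
  then obtain ss' where ss': "set ss' \<subseteq> set ss" "length ss' < length ss"
    "\<tau> \<otimes>\<^bsub>W\<^esub> w \<otimes>\<^bsub>W\<^esub> t = list_prod W ss' \<otimes>\<^bsub>W\<^esub> w"
    using exchange_word[of ss w t] ssX w tS d ss by auto
  have ss'X: "set ss' \<subseteq> X" "set ss' \<subseteq> S" using ss' ssX by auto
  \<comment> \<open>Exchange yields \<open>\<tau> w t = ss' w\<close>. The choice of
    \<open>?u\<close> ensures both \<open>?u w = w t\<close> and \<open>\<tau> ?u = ss'\<close>, so
    it leads to a competitor in the coset of \<tau> that is shorter than \<tau>.\<close>
  let ?u = "inv\<^bsub>W\<^esub> \<tau> \<otimes>\<^bsub>W\<^esub> list_prod W ss'"
  have \<tau>c: "\<tau> \<in> carrier W" using ss ssX by simp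
  have "list_prod W ss' \<in> words X" using ss'X by (auto simp: words_def)
  hence u: "?u \<in> words X" using words_mult[OF X] words_inv[OF X] \<tau>X by blast
  have "?u \<otimes>\<^bsub>W\<^esub> w = inv\<^bsub>W\<^esub> \<tau> \<otimes>\<^bsub>W\<^esub> (\<tau> \<otimes>\<^bsub>W\<^esub> w \<otimes>\<^bsub>W\<^esub> t)"
    using \<tau>c ss'X w by (simp add: W.m_assoc ss'(3))
  also have "\<dots> = inv\<^bsub>W\<^esub> \<tau> \<otimes>\<^bsub>W\<^esub> \<tau> \<otimes>\<^bsub>W\<^esub> (w \<otimes>\<^bsub>W\<^esub> t)"
    using \<tau>c w tS by (simp only: W.m_assoc W.inv_closed W.m_closed S_closed)
  finally have "?u \<otimes>\<^bsub>W\<^esub> w = w \<otimes>\<^bsub>W\<^esub> t" using \<tau>c w tS by simp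
  hence "len \<tau> \<le> len (\<tau> \<otimes>\<^bsub>W\<^esub> ?u)" using \<tau> u tS by (auto simp: min_left_reps_def)
  also have "\<tau> \<otimes>\<^bsub>W\<^esub> ?u = list_prod W ss'" using \<tau>c ss'X by (simp flip: W.m_assoc)
  finally have "len \<tau> \<le> length ss'" using len_word_le[OF ss'X(2)] by simp
  thus False using shortest_len[OF X ss(1)] ss ss' by simp
qed

text \<open>Having no descent in \<open>Y\<close> is a local condition. It becomes minimality in the
  whole coset by comparison with a shortest element \<open>v0\<close> of that coset, to which
  \<open>no_descent_unique\<close> applies.\<close>

lemma min_left_reps_minimal:
  assumes X: "X \<subseteq> S" and Y: "Y \<subseteq> S" and w: "w \<in> carrier W"
    and min: "\<And>y. y \<in> words Y \<Longrightarrow> len w \<le> len (w \<otimes>\<^bsub>W\<^esub> y)"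
    and \<tau>: "\<tau> \<in> min_left_reps X Y w" and y: "y \<in> words Y"
  shows "len (\<tau> \<otimes>\<^bsub>W\<^esub> w) \<le> len (\<tau> \<otimes>\<^bsub>W\<^esub> w \<otimes>\<^bsub>W\<^esub> y)"
proof -
  have "\<tau> \<in> carrier W" using \<tau> words_closed[OF X] by (auto simp: min_left_reps_def)
  hence v: "\<tau> \<otimes>\<^bsub>W\<^esub> w \<in> carrier W" using w by simp
  obtain v0 x where *: "v0 \<in> carrier W" "x \<in> words Y" "\<tau> \<otimes>\<^bsub>W\<^esub> w = v0 \<otimes>\<^bsub>W\<^esub> x"
    "\<And>y. y \<in> words Y \<Longrightarrow> len v0 \<le> len (v0 \<otimes>\<^bsub>W\<^esub> y)"
    using minimal_in_coset[OF Y v] by blast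
  have "v0 \<otimes>\<^bsub>W\<^esub> x = v0"
    using no_descent_unique[OF Y *(1,4,2)] min_left_reps_no_descent[OF X Y w min \<tau>] *(3) by simp
  thus ?thesis using * y by simp
qed

text \<open>The elements \<open>\<tau> w\<close> and \<open>\<tau>' w\<close> lie in one coset of
  \<open>words Y\<close> and neither has a descent in \<open>Y\<close>, so they coincide and
  \<open>w\<close> cancels.\<close>

lemma min_left_reps_unique:
  assumes X: "X \<subseteq> S" and Y: "Y \<subseteq> S" and w: "w \<in> carrier W"
    and min: "\<And>y. y \<in> words Y \<Longrightarrow> len w \<le> len (w \<otimes>\<^bsub>W\<^esub> y)"
    and \<tau>: "\<tau> \<in> min_left_reps X Y w" and \<tau>': "\<tau>' \<in> min_left_reps X Y w"
    and y: "y \<in> words Y" and eq: "\<tau>' \<otimes>\<^bsub>W\<^esub> w = \<tau> \<otimes>\<^bsub>W\<^esub> w \<otimes>\<^bsub>W\<^esub> y"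
  shows "\<tau>' = \<tau>"
proof -
  have cl: "\<tau> \<in> carrier W" "\<tau>' \<in> carrier W"
    using \<tau> \<tau>' words_closed[OF X] by (auto simp: min_left_reps_def)
  have "\<tau> \<otimes>\<^bsub>W\<^esub> w \<otimes>\<^bsub>W\<^esub> y = \<tau> \<otimes>\<^bsub>W\<^esub> w"
  proof (rule no_descent_unique[OF Y _ _ y])
    show "len (\<tau> \<otimes>\<^bsub>W\<^esub> w) \<le> len (\<tau> \<otimes>\<^bsub>W\<^esub> w \<otimes>\<^bsub>W\<^esub> y)" if "y \<in> words Y" for y
      using min_left_reps_minimal[OF X Y w min \<tau> that] .
    show "\<not> descent (\<tau> \<otimes>\<^bsub>W\<^esub> w \<otimes>\<^bsub>W\<^esub> y) t" if "t \<in> Y" for t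
      using min_left_reps_no_descent[OF X Y w min \<tau>' that] eq by simp
  qed (use cl w in simp)
  thus ?thesis using eq cl w by simp
qed

section \<open>The subgroups \<open>par X\<close> and their double cosets\<close>

text \<open>Exchange is applied once for each letter, from right to left. A letter is either kept or
  lost, so the left factor \<open>u\<close> stays a product of letters of \<open>X\<close>.\<close>

lemma word_mult_C:
  assumes X: "X \<subseteq> S" and x: "x \<in> carrier W" and "set ss \<subseteq> X"
  shows "C (list_prod W ss) <#> C x \<subseteq> (\<Union>u\<in>words X. C (u \<otimes>\<^bsub>W\<^esub> x))"
  using assms(3)
proof (induction ss)
  case Nil
  thus ?case using C_mult_left[OF x] one_in_words[of X] x by (force simp: mem_set_mult C_one)
next
  case (Cons s ss)
  have s: "s \<in> S" "s \<in> words X" and ss: "set ss \<subseteq> S" using Cons.prems X S_in_words by auto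
  show ?case
  proof
    fix g assume "g \<in> C (list_prod W (s # ss)) <#> C x"
    then obtain a b where ab: "a \<in> C (s \<otimes>\<^bsub>W\<^esub> list_prod W ss)" "b \<in> C x" "g = a \<otimes> b"
      by (auto simp: mem_set_mult)
    obtain p q where pq: "p \<in> C s" "q \<in> C (list_prod W ss)" "a = p \<otimes> q"
      using C_mult_split[of s "list_prod W ss"] s ss ab by auto
    have cl: "p \<in> carrier G" "q \<in> carrier G" "b \<in> carrier G"
      using C_closed s ss x ab pq S_closed word_closed by blast+
    have "q \<otimes> b \<in> C (list_prod W ss) <#> C x" using pq ab by (blast intro: set_multI)
    then obtain u where u: "u \<in> words X" "q \<otimes> b \<in> C (u \<otimes>\<^bsub>W\<^esub> x)" using Cons by auto
    have uc: "u \<in> carrier W" using words_closed[OF X] u by blast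
    have "g \<in> C (u \<otimes>\<^bsub>W\<^esub> x) \<union> C (s \<otimes>\<^bsub>W\<^esub> u \<otimes>\<^bsub>W\<^esub> x)"
      using exchange_left_mem[OF s(1) _ pq(1) u(2)] uc x s pq ab cl
      by (auto simp: W.m_assoc G.m_assoc)
    thus "g \<in> (\<Union>u\<in>words X. C (u \<otimes>\<^bsub>W\<^esub> x))" using u words_mult[OF X s(2) u(1)] by blast
  qed
qed

lemma par_mult_C:
  assumes "X \<subseteq> S" "x \<in> carrier W"
  shows "par X <#> C x \<subseteq> (\<Union>u\<in>words X. C (u \<otimes>\<^bsub>W\<^esub> x))"
proof
  fix g assume "g \<in> par X <#> C x"
  then obtain a b ss where "set ss \<subseteq> X" "a \<in> C (list_prod W ss)" "b \<in> C x" "g = a \<otimes> b"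
    by (auto simp: par_def words_def mem_set_mult)
  thus "g \<in> (\<Union>u\<in>words X. C (u \<otimes>\<^bsub>W\<^esub> x))"
    using word_mult_C[OF assms, of ss] set_multI[of a _ b "C x" G] by blast
qed

lemma par_subgroup: assumes X: "X \<subseteq> S" shows "subgroup (par X) G"
proof
  show "par X \<subseteq> carrier G" using C_closed words_closed[OF X] by (auto simp: par_def)
  show "\<one> \<in> par X"
    using one_in_words[of X] subgroup.one_closed[OF B_subgroup] C_one by (auto simp: par_def)
  show "inv g \<in> par X" if "g \<in> par X" for g
  proof -
    obtain x where x: "x \<in> words X" "g \<in> C x" using \<open>g \<in> par X\<close> by (auto simp: par_def)
    show ?thesis
      using words_inv[OF X x(1)] C_inv[OF words_closed[OF X x(1)] x(2)] by (auto simp: par_def)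
  qed
  show "g \<otimes> h \<in> par X" if gh: "g \<in> par X" "h \<in> par X" for g h
  proof -
    obtain x where x: "x \<in> words X" "h \<in> C x" using gh by (auto simp: par_def)
    have "g \<otimes> h \<in> par X <#> C x" using gh x by (blast intro: set_multI)
    thus ?thesis using par_mult_C[OF X words_closed[OF X x(1)]] words_mult[OF X _ x(1)]
      by (auto simp: par_def)
  qed
qed

text \<open>Only the covering is proved here. A class in \<open>words X\<close> may be replaced by a
  representative \<tau> at the cost of a factor in \<open>words Y\<close>, and the double coset of
  that factor is absorbed by \<open>par Y\<close>.\<close>

lemma double_coset_decomposition:
  assumes X: "X \<subseteq> S" and Y: "Y \<subseteq> S" and w: "w \<in> carrier W"
  shows "par X <#> C w <#> par Y = (\<Union>\<tau>\<in>min_left_reps X Y w. C (\<tau> \<otimes>\<^bsub>W\<^esub> w) <#> par Y)"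
proof (intro equalityI subsetI)
  fix g assume "g \<in> par X <#> C w <#> par Y"
  then obtain a b where ab: "a \<in> par X <#> C w" "b \<in> par Y" "g = a \<otimes> b"
    unfolding mem_set_mult[of g] by blast
  obtain x where x: "x \<in> words X" "a \<in> C (x \<otimes>\<^bsub>W\<^esub> w)" using par_mult_C[OF X w] ab by blast
  obtain \<tau> y where \<tau>: "\<tau> \<in> min_left_reps X Y w" "y \<in> words Y"
    "x \<otimes>\<^bsub>W\<^esub> w = \<tau> \<otimes>\<^bsub>W\<^esub> w \<otimes>\<^bsub>W\<^esub> y" using min_left_reps_ex[OF X Y w x(1)] .
  have \<tau>w: "\<tau> \<otimes>\<^bsub>W\<^esub> w \<in> carrier W"
    using \<tau>(1) words_closed[OF X] w by (auto simp: min_left_reps_def)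
  have y: "y \<in> carrier W" using words_closed[OF Y] \<tau> by blast
  obtain p q where pq: "p \<in> C (\<tau> \<otimes>\<^bsub>W\<^esub> w)" "q \<in> C y" "a = p \<otimes> q"
    using C_mult_split[OF \<tau>w y] x \<tau> by auto
  have q: "q \<in> par Y" using pq \<tau> by (auto simp: par_def)
  have "q \<otimes> b \<in> par Y" using subgroup.m_closed[OF par_subgroup[OF Y] q ab(2)] .
  moreover have "g = p \<otimes> (q \<otimes> b)"
    using ab pq q C_closed[OF \<tau>w] subgroup.mem_carrier[OF par_subgroup[OF Y]]
    by (simp add: G.m_assoc)
  ultimately show "g \<in> (\<Union>\<tau>\<in>min_left_reps X Y w. C (\<tau> \<otimes>\<^bsub>W\<^esub> w) <#> par Y)"
    using pq \<tau> by (blast intro: set_multI)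
next
  fix g assume "g \<in> (\<Union>\<tau>\<in>min_left_reps X Y w. C (\<tau> \<otimes>\<^bsub>W\<^esub> w) <#> par Y)"
  then obtain \<tau> where \<tau>: "\<tau> \<in> min_left_reps X Y w" "g \<in> C (\<tau> \<otimes>\<^bsub>W\<^esub> w) <#> par Y" by blast
  hence "\<tau> \<in> words X" "\<tau> \<in> carrier W" using words_closed[OF X] by (auto simp: min_left_reps_def)
  hence "C (\<tau> \<otimes>\<^bsub>W\<^esub> w) \<subseteq> par X <#> C w"
    using C_mult_subset[of \<tau> w] w by (fastforce simp: par_def mem_set_mult)
  thus "g \<in> par X <#> C w <#> par Y" using \<tau> unfolding mem_set_mult[of g] by blast
qed

text \<open>The quotient of \<open>g\<close> and \<open>g'\<close> lies in \<open>C y\<close> for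
  some \<open>y\<close> in \<open>words Y\<close>. As \<open>C (\<tau> w) <#> C y\<close> is a
  single double coset, \<open>\<tau>' w = \<tau> w y\<close>, and uniqueness of representatives
  makes \<open>y\<close> trivial. Disjointness for different \<tau> and injectivity for equal \<tau>
  come out together.\<close>

lemma par_cosets_meet:
  assumes X: "X \<subseteq> S" and Y: "Y \<subseteq> S" and w: "w \<in> carrier W"
    and min: "\<And>y. y \<in> words Y \<Longrightarrow> len w \<le> len (w \<otimes>\<^bsub>W\<^esub> y)"
    and \<tau>: "\<tau> \<in> min_left_reps X Y w" and \<tau>': "\<tau>' \<in> min_left_reps X Y w"
    and g: "g \<in> C (\<tau> \<otimes>\<^bsub>W\<^esub> w)" and g': "g' \<in> C (\<tau>' \<otimes>\<^bsub>W\<^esub> w)"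
    and meet: "(g <# par Y) \<inter> (g' <# par Y) \<noteq> {}"
  shows "\<tau> = \<tau>' \<and> inv g \<otimes> g' \<in> B"
proof -
  have "\<tau> \<in> carrier W" "\<tau>' \<in> carrier W"
    using \<tau> \<tau>' words_closed[OF X] by (auto simp: min_left_reps_def)
  hence v: "\<tau> \<otimes>\<^bsub>W\<^esub> w \<in> carrier W" "\<tau>' \<otimes>\<^bsub>W\<^esub> w \<in> carrier W" using w by auto
  note P = par_subgroup[OF Y]
  have gc: "g \<in> carrier G" "g' \<in> carrier G" using g g' v C_closed by blast+
  obtain h h' where h: "h \<in> par Y" "h' \<in> par Y" "g \<otimes> h = g' \<otimes> h'"
    using meet by (auto simp: l_coset_def)
  have hc: "h \<in> carrier G" "h' \<in> carrier G" using h subgroup.mem_carrier[OF P] by auto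
  define k where "k = h \<otimes> inv h'"
  have k: "k \<in> par Y"
    using h subgroup.m_closed[OF P] subgroup.m_inv_closed[OF P] by (simp add: k_def)
  have "g \<otimes> k = g' \<otimes> h' \<otimes> inv h'" using gc hc h(3) by (simp add: k_def flip: G.m_assoc)
  hence gk: "g \<otimes> k = g'" using gc hc by (simp add: G.m_assoc)
  obtain y where y: "y \<in> words Y" "k \<in> C y" using k by (auto simp: par_def)
  have yc: "y \<in> carrier W" using words_closed[OF Y y(1)] .
  have "g' \<in> C (\<tau> \<otimes>\<^bsub>W\<^esub> w \<otimes>\<^bsub>W\<^esub> y)"
    using minimal_mult[OF Y v(1) min_left_reps_minimal[OF X Y w min \<tau>] y(1)] gk
      set_multI[OF g y(2), of G] by simp
  hence eq: "\<tau>' \<otimes>\<^bsub>W\<^esub> w = \<tau> \<otimes>\<^bsub>W\<^esub> w \<otimes>\<^bsub>W\<^esub> y" using C_inj[OF _ _ g'] v yc by simp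
  hence "\<tau>' = \<tau>" using min_left_reps_unique[OF X Y w min \<tau> \<tau>' y(1)] by simp
  moreover from this have "y = \<one>\<^bsub>W\<^esub>" using eq v yc by simp
  moreover have "inv g \<otimes> g' = k"
    using G.inv_solve_left'[of k g g'] gk gc subgroup.mem_carrier[OF P k] by simp
  ultimately show ?thesis using y C_one by simp
qed

section \<open>Coset representatives along reduced words\<close>

text \<open>Descents concern the last letter, while the parametrisation peels off the first one.
  Hence the word is grown at its right end with \<open>s\<close> kept in front, and associativity of
  set products moves the bracket.\<close>

lemma reduced_Cons_mult:
  "shortest S (s # ss) \<Longrightarrow> C (list_prod W (s # ss)) = C s <#> C (list_prod W ss)"
proof (induction ss rule: rev_induct)
  case Nil
  hence "s \<in> S" by (simp add: shortest_def)
  moreover have "C s <#> B = C s" if "s \<in> carrier W"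
    using C_mult_subset[OF that, of "\<one>\<^bsub>W\<^esub>"] C_mult_right that by (auto simp: C_one mem_set_mult)
  ultimately show ?case by (simp add: C_one)
next
  case (snoc t ss)
  have *: "s \<in> S" "set ss \<subseteq> S" "t \<in> S" using snoc.prems by (auto simp: shortest_def)
  have sh: "shortest S ((s # ss) @ [t])" using snoc.prems by simp
  have sh': "shortest S (ss @ [t])"
    using shortest_append(2)[of S "[s]" "ss @ [t]"] snoc.prems by simp
  have "C (list_prod W (s # ss @ [t])) = C (list_prod W (s # ss) \<otimes>\<^bsub>W\<^esub> t)"
    using * by (simp add: word_append W.m_assoc)
  also have "\<dots> = C (list_prod W (s # ss)) <#> C t"
    using not_descent_mult[OF _ _ shortest_not_descent[OF subset_refl sh]] * by simp
  also have "\<dots> = C s <#> C (list_prod W ss) <#> C t"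
    using snoc.IH shortest_append(1)[OF subset_refl sh] by simp
  also have "\<dots> = C s <#> (C (list_prod W ss) <#> C t)"
    using * C_carrier by (simp add: G.set_mult_assoc)
  also have "C (list_prod W ss) <#> C t = C (list_prod W (ss @ [t]))"
    using not_descent_mult[OF _ _ shortest_not_descent[OF subset_refl sh']] *
    by (simp add: word_append)
  finally show ?case .
qed

lemma reps_cover:
  assumes "left_coset_reps G (C x) B R" "x \<in> carrier W" "g \<in> C x"
  obtains p b where "p \<in> R" "b \<in> B" "g = p \<otimes> b"
proof -
  have "g <# B \<in> (\<lambda>g. g <# B) ` R"
    using assms by (auto simp: left_coset_reps_def bij_betw_def left_cosets_in_def)
  then obtain p where p: "p \<in> R" "g <# B = p <# B" by auto
  have "g \<in> g <# B"
    using subgroup.one_closed[OF B_subgroup] C_closed[OF assms(2,3)]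
    by (force simp: l_coset_def)
  thus ?thesis using p that by (auto simp: l_coset_def)
qed

lemma reps_unique:
  assumes R: "left_coset_reps G (C x) B R" and x: "x \<in> carrier W"
    and p: "p \<in> R" "q \<in> R" and pq: "inv p \<otimes> q \<in> B"
  shows "p = q"
proof -
  have pqc: "p \<in> C x" "q \<in> C x" "p \<in> carrier G" "q \<in> carrier G"
    using R p C_closed[OF x] by (auto simp: left_coset_reps_def)
  have "q \<in> p <# B"
    unfolding l_coset_def using pq pqc by (force simp flip: G.m_assoc)
  hence "p <# B = q <# B" using G.l_repr_independence[OF _ pqc(3) B_subgroup] by blast
  thus ?thesis using R p by (auto simp: left_coset_reps_def bij_betw_def inj_on_def)
qed

text \<open>The factor in \<open>B\<close> left over when the first letter is replaced by its
  representative is pushed to the right, where the double coset of the remaining word absorbs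
  it.\<close>

lemma reduced_cover:
  assumes "shortest S ss" "\<And>s. s \<in> S \<Longrightarrow> left_coset_reps G (C s) B (k s)"
    "g \<in> C (list_prod W ss)"
  shows "\<exists>\<kappa>\<in>listset (map k ss). \<exists>b\<in>B. g = list_prod G \<kappa> \<otimes> b"
  using assms(1,3)
proof (induction ss arbitrary: g)
  case Nil
  thus ?case by (simp add: C_one)
next
  case (Cons s ss)
  have *: "s \<in> S" "set ss \<subseteq> S" and sh: "shortest S ss"
    using Cons.prems shortest_append(2)[of S "[s]" ss] by (auto simp: shortest_def)
  obtain a h where ah: "a \<in> C s" "h \<in> C (list_prod W ss)" "g = a \<otimes> h"
    using Cons.prems reduced_Cons_mult by (auto simp: mem_set_mult)
  obtain p b where pb: "p \<in> k s" "b \<in> B" "a = p \<otimes> b"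
    using reps_cover[OF assms(2)[OF *(1)] _ ah(1)] * by auto
  have "b \<otimes> h \<in> C (list_prod W ss)" using C_mult_left[OF _ ah(2) pb(2)] * by simp
  then obtain \<kappa> b' where \<kappa>: "\<kappa> \<in> listset (map k ss)" "b' \<in> B" "b \<otimes> h = list_prod G \<kappa> \<otimes> b'"
    using Cons.IH[OF sh] by blast
  have cl: "p \<in> carrier G" "h \<in> carrier G"
    using pb(1) assms(2)[OF *(1)] C_closed[of s] C_closed[OF _ ah(2)] *
    by (auto simp: left_coset_reps_def)
  have "k s \<subseteq> carrier G" if "s \<in> S" for s
    using assms(2)[OF that] C_closed[of s] that by (auto simp: left_coset_reps_def)
  hence "set \<kappa> \<subseteq> carrier G" using \<kappa>(1) *(2)
  proof (induction ss arbitrary: \<kappa>)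
    case (Cons t ts)
    thus ?case by (force simp: set_Cons_def)
  qed (simp)
  hence "g = list_prod G (p # \<kappa>) \<otimes> b'"
    using ah pb \<kappa> cl by (simp add: G.m_assoc)
  moreover have "p # \<kappa> \<in> listset (map k (s # ss))" using pb \<kappa> by (simp add: set_Cons_def)
  ultimately show ?case using \<kappa>(2) by blast
qed

lemma reduced_mem:
  assumes "shortest S ss" "\<And>s. s \<in> S \<Longrightarrow> left_coset_reps G (C s) B (k s)"
    "\<kappa> \<in> listset (map k ss)"
  shows "list_prod G \<kappa> \<in> C (list_prod W ss)"
  using assms(1,3)
proof (induction ss arbitrary: \<kappa>)
  case Nil
  thus ?case using subgroup.one_closed[OF B_subgroup] by (simp add: C_one)
next
  case (Cons s ss)
  obtain p \<kappa>' where \<kappa>: "\<kappa> = p # \<kappa>'" "p \<in> k s" "\<kappa>' \<in> listset (map k ss)"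
    using Cons.prems by (auto simp: set_Cons_def)
  have "s \<in> S" using Cons.prems by (simp add: shortest_def)
  hence "p \<in> C s" using assms(2) \<kappa> by (auto simp: left_coset_reps_def)
  moreover have "list_prod G \<kappa>' \<in> C (list_prod W ss)"
    using Cons.IH[OF _ \<kappa>(3)] shortest_append(2)[of S "[s]" ss] Cons.prems by simp
  ultimately show ?case
    using reduced_Cons_mult[OF Cons.prems(1)] \<kappa> set_multI[of p "C s" _ _ G] by simp
qed

text \<open>The quotient of the two first representatives lies in \<open>C s\<close> or in
  \<open>B\<close>. The former would place one element in both \<open>C (s ?x)\<close> and
  \<open>C ?x\<close>; so the representatives agree, and induction treats the rest.\<close>

lemma reduced_unique:
  assumes "shortest S ss" "\<And>s. s \<in> S \<Longrightarrow> left_coset_reps G (C s) B (k s)"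
    "\<kappa> \<in> listset (map k ss)" "\<kappa>' \<in> listset (map k ss)" "inv (list_prod G \<kappa>) \<otimes> list_prod G \<kappa>' \<in> B"
  shows "\<kappa> = \<kappa>'"
  using assms(1,3-)
proof (induction ss arbitrary: \<kappa> \<kappa>')
  case Nil
  thus ?case by (simp)
next
  case (Cons s ss)
  obtain p \<mu> where \<kappa>: "\<kappa> = p # \<mu>" "p \<in> k s" "\<mu> \<in> listset (map k ss)"
    using Cons.prems by (auto simp: set_Cons_def)
  obtain p' \<mu>' where \<kappa>': "\<kappa>' = p' # \<mu>'" "p' \<in> k s" "\<mu>' \<in> listset (map k ss)"
    using Cons.prems by (auto simp: set_Cons_def)
  have s: "s \<in> S" "set ss \<subseteq> S" and sh: "shortest S ss"
    using Cons.prems shortest_append(2)[of S "[s]" ss] by (auto simp: shortest_def)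
  let ?x = "list_prod W ss" and ?m = "list_prod G \<mu>" and ?m' = "list_prod G \<mu>'"
  have x: "?x \<in> carrier W" using s by simp
  have m: "?m \<in> C ?x" "?m' \<in> C ?x" using reduced_mem[OF sh assms(2)] \<kappa> \<kappa>' by blast+
  have p: "p \<in> C s" "p' \<in> C s"
    using assms(2)[OF s(1)] \<kappa> \<kappa>' by (auto simp: left_coset_reps_def)
  have cl: "p \<in> carrier G" "p' \<in> carrier G" "?m \<in> carrier G" "?m' \<in> carrier G"
    using p m C_closed x s S_closed by blast+
  \<comment> \<open>This is the quotient from the hypothesis with the first letters split off. It
    shows that \<open>inv p p'\<close> maps \<open>?m'\<close> to \<open>?m b\<close>, hence back
    into \<open>C ?x\<close>.\<close>
  define b where "b = inv ?m \<otimes> (inv p \<otimes> p') \<otimes> ?m'"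
  have b: "b \<in> B" using Cons.prems(4) \<kappa> \<kappa>' cl by (simp add: b_def G.inv_mult_group G.m_assoc)
  have eq: "(inv p \<otimes> p') \<otimes> ?m' = ?m \<otimes> b" using cl by (simp add: b_def flip: G.m_assoc)
  hence in1: "(inv p \<otimes> p') \<otimes> ?m' \<in> C ?x" using C_mult_right[OF x m(1) b] by simp
  have "inv p \<in> C s" using C_inv[OF _ p(1)] s by simp
  hence "inv p \<otimes> p' \<in> C s \<union> B"
    using exchange_left_mem[OF s(1), of s] s p by (auto simp: S_square C_one)
  moreover have "inv p \<otimes> p' \<notin> C s"
  proof
    assume "inv p \<otimes> p' \<in> C s"
    hence "(inv p \<otimes> p') \<otimes> ?m' \<in> C (s \<otimes>\<^bsub>W\<^esub> ?x)"
      using reduced_Cons_mult[OF Cons.prems(1)] set_multI[OF _ m(2), of "inv p \<otimes> p'" "C s" G] by simp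
    hence "s \<otimes>\<^bsub>W\<^esub> ?x = ?x" using C_inj[OF _ _ _ in1] s x by simp
    thus False using S_mult_neq s x by blast
  qed
  ultimately have "p = p'" using reps_unique[OF assms(2) _ \<kappa>(2) \<kappa>'(2)] s by auto
  moreover have "\<mu> = \<mu>'"
    using Cons.IH[OF sh \<kappa>(3) \<kappa>'(3)] b cl \<open>p = p'\<close> by (simp add: b_def)
  ultimately show ?case using \<kappa> \<kappa>' by simp
qed

text \<open>The last letter of a shortest word for a nontrivial \<open>x\<close> is a descent of
  \<open>x\<close>, which \<open>norm\<close> excludes. The condition \<open>norm\<close> is what
  remains, at the level of double cosets, of normalizing \<open>B\<close>.\<close>

lemma normalizing_eq_one:
  assumes x: "x \<in> words S" and norm: "\<And>s. s \<in> S \<Longrightarrow> C x <#> C s \<subseteq> C (x \<otimes>\<^bsub>W\<^esub> s)"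
  shows "x = \<one>\<^bsub>W\<^esub>"
proof -
  obtain ss where ss: "shortest S ss" "x = list_prod W ss" using shortest_ex[OF x] .
  show ?thesis
  proof (cases ss rule: rev_cases)
    case Nil
    thus ?thesis using ss by simp
  next
    case (snoc ts t)
    have *: "set ts \<subseteq> S" "t \<in> S" using ss snoc by (auto simp: shortest_def)
    have xc: "x \<in> carrier W" and xt: "x = list_prod W ts \<otimes>\<^bsub>W\<^esub> t"
      using ss snoc * by (auto simp: word_append)
    have "descent x t"
      unfolding xt using ss snoc *
      by (intro descent_mult_S shortest_not_descent[OF subset_refl]) simp_all
    then obtain g where "g \<in> C x" "g \<in> C (x \<otimes>\<^bsub>W\<^esub> t)" using norm[OF *(2)] by (auto simp: descent_def)
    hence "x = x \<otimes>\<^bsub>W\<^esub> t" using C_inj[of x "x \<otimes>\<^bsub>W\<^esub> t"] xc * by simp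
    thus ?thesis using mult_S_neq[OF *(2) xc] by simp
  qed
qed

end

section \<open>Double cosets of a Weyl group\<close>

lemma (in group) generate_involutions:
  assumes X: "X \<subseteq> carrier G" and inv: "\<And>x. x \<in> X \<Longrightarrow> x \<otimes> x = \<one>"
  shows "generate G X = {list_prod G ss |ss. set ss \<subseteq> X}"
proof (intro equalityI subsetI)
  fix x assume "x \<in> generate G X"
  thus "x \<in> {list_prod G ss |ss. set ss \<subseteq> X}"
  proof induction
    case one
    show ?case by (auto intro!: exI[of _ "[]"])
  next
    case (incl h)
    thus ?case using X by (auto intro!: exI[of _ "[h]"])
  next
    case (inv h)
    hence "inv h = h" "h \<in> carrier G" using assms by (auto intro: inv_equality)
    thus ?case using inv by (auto intro!: exI[of _ "[h]"])
  next
    case (eng g h)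
    then obtain ss ts where "set ss \<subseteq> X" "g = list_prod G ss" "set ts \<subseteq> X" "h = list_prod G ts"
      by auto
    thus ?case using list_prod_append[of ss ts] X by (auto intro!: exI[of _ "ss @ ts"])
  qed
next
  have "list_prod G ss \<in> generate G X" if "set ss \<subseteq> X" for ss
    using that by (induction ss) (auto intro: generate.one generate.eng generate.incl)
  thus "x \<in> generate G X" if "x \<in> {list_prod G ss |ss. set ss \<subseteq> X}" for x using that by auto
qed

lemma (in double_coset_system) words_eq_generate:
  "X \<subseteq> S \<Longrightarrow> words X = generate W X"
  unfolding words_def using S_carrier S_square by (subst W.generate_involutions) auto

lemma (in group) normalizer_iff:
  assumes "H \<subseteq> carrier G"
  shows "g \<in> normalizer G H \<longleftrightarrow> g \<in> carrier G \<and> g <# H #> inv g = H"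
  using assms by (auto simp: normalizer_def stabilizer_def)

lemma (in group) normalizer_conj:
  assumes "subgroup H G" "g \<in> normalizer G H" "h \<in> H"
  shows "g \<otimes> h \<otimes> inv g \<in> H" "inv g \<otimes> h \<otimes> g \<in> H"
proof -
  note H = subgroup.subset[OF assms(1)]
  have *: "g \<otimes> h \<otimes> inv g \<in> H" if "g \<in> normalizer G H" for g
    using normalizer_iff[OF H, of g] that assms(3) by (auto simp: l_coset_def r_coset_def)
  show "g \<otimes> h \<otimes> inv g \<in> H" using *[OF assms(2)] .
  have "inv g \<in> normalizer G H" "g \<in> carrier G"
    using subgroup.m_inv_closed[OF normalizer_imp_subgroup[OF H] assms(2)]
      normalizer_iff[OF H] assms(2) by auto
  thus "inv g \<otimes> h \<otimes> g \<in> H" using *[of "inv g"] by simp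
qed

lemma (in group) normalizerI:
  assumes "subgroup H G" "g \<in> carrier G"
    "\<And>h. h \<in> H \<Longrightarrow> g \<otimes> h \<otimes> inv g \<in> H" "\<And>h. h \<in> H \<Longrightarrow> inv g \<otimes> h \<otimes> g \<in> H"
  shows "g \<in> normalizer G H"
proof -
  note H = subgroup.subset[OF assms(1)]
  have "h \<in> g <# H #> inv g" if h: "h \<in> H" for h
  proof -
    have "h = g \<otimes> (inv g \<otimes> h \<otimes> g) \<otimes> inv g"
      using assms(2) subgroup.mem_carrier[OF assms(1) h]
      by (simp add: m_assoc) (simp flip: m_assoc)
    thus ?thesis using assms(4)[OF h] by (force simp: l_coset_def r_coset_def)
  qed
  thus ?thesis using assms(2,3) by (auto simp: normalizer_iff[OF H] l_coset_def r_coset_def)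
qed

definition dcoset :: "('a, 'b) monoid_scheme \<Rightarrow> 'a set \<Rightarrow> 'a set \<Rightarrow> 'a set" where
  "dcoset G B x = B <#>\<^bsub>G\<^esub> x <#>\<^bsub>G\<^esub> B"

lemma mem_dcoset:
  "g \<in> dcoset G B x \<longleftrightarrow> (\<exists>b\<in>B. \<exists>n\<in>x. \<exists>b'\<in>B. g = b \<otimes>\<^bsub>G\<^esub> n \<otimes>\<^bsub>G\<^esub> b')"
  by (simp add: dcoset_def mem_set_mult Bex_def) blast

text \<open>Serves twice: for \<open>B\<close> and \<open>N\<close>, and for \<open>B\<close> and
  the larger group \<open>N_ext G B N\<close>, whose intersection with \<open>B\<close> first has to
  be proved normal.\<close>

locale weyl_pair = group G for G (structure) +
  fixes B N :: "'a set"
  assumes B_sub: "subgroup B G" and N_sub: "subgroup N G"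
    and T_norm: "(B \<inter> N) \<lhd> (G\<lparr>carrier := N\<rparr>)"
begin

abbreviation W where "W \<equiv> weyl_group G B N"

definition cls :: "'a \<Rightarrow> 'a set" where "cls n = (B \<inter> N) #> n"

lemma B_carrier: "b \<in> B \<Longrightarrow> b \<in> carrier G"
  using subgroup.mem_carrier[OF B_sub] .

lemma N_carrier: "n \<in> N \<Longrightarrow> n \<in> carrier G"
  using subgroup.mem_carrier[OF N_sub] .

lemma group_W: "group W"
  unfolding weyl_group_def using normal.factorgroup_is_group[OF T_norm] .

lemma carrier_W: "carrier W = cls ` N"
  by (auto simp: weyl_group_def carrier_FactGroup cls_def r_coset_def)

lemma mult_W: "x \<otimes>\<^bsub>W\<^esub> y = x <#> y"
  by (simp add: weyl_group_def set_mult_def)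

lemma one_W: "\<one>\<^bsub>W\<^esub> = B \<inter> N"
  by (simp add: weyl_group_def)

lemma cls_closed: "n \<in> N \<Longrightarrow> cls n \<in> carrier W"
  by (simp add: carrier_W)

lemma cls_mult: "m \<in> N \<Longrightarrow> n \<in> N \<Longrightarrow> cls m \<otimes>\<^bsub>W\<^esub> cls n = cls (m \<otimes> n)"
  using normal.rcos_sum[OF T_norm, of m n] by (simp add: mult_W cls_def r_coset_def set_mult_def)

lemma cls_one: "cls \<one> = \<one>\<^bsub>W\<^esub>"
  using subgroup.subset[OF B_sub] by (auto simp: one_W cls_def r_coset_def B_carrier)

lemma self_in_cls: "n \<in> N \<Longrightarrow> n \<in> cls n"
  unfolding cls_def r_coset_def
  using subgroup.one_closed[OF B_sub] subgroup.one_closed[OF N_sub] N_carrier by force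

lemma cls_inv: assumes "n \<in> N" shows "inv\<^bsub>W\<^esub> cls n = cls (inv n)"
proof -
  have n: "inv n \<in> N" using subgroup.m_inv_closed[OF N_sub assms] .
  have "cls (inv n) \<otimes>\<^bsub>W\<^esub> cls n = \<one>\<^bsub>W\<^esub>" using assms n N_carrier by (simp add: cls_mult cls_one)
  thus ?thesis using group.inv_equality[OF group_W] cls_closed assms n by simp
qed

lemma cls_eqI: assumes "x \<in> carrier W" "n \<in> x" shows "n \<in> N" "x = cls n"
proof -
  obtain m where m: "m \<in> N" "x = cls m" using assms(1) by (auto simp: carrier_W)
  then obtain t where t: "t \<in> B \<inter> N" "n = t \<otimes> m" using assms(2) by (auto simp: cls_def r_coset_def)
  show "n \<in> N" using t m subgroup.m_closed[OF N_sub] by simp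
  have "subgroup (B \<inter> N) G" using subgroups_Inter_pair[OF B_sub N_sub] .
  thus "x = cls n" unfolding m(2) cls_def
    using repr_independence[of n "B \<inter> N" m] m N_carrier t by (auto simp: r_coset_def)
qed

lemma cls_eq_one: "n \<in> N \<Longrightarrow> n \<in> B \<Longrightarrow> cls n = \<one>\<^bsub>W\<^esub>"
  using cls_eqI(2)[OF monoid.one_closed[OF group.is_monoid[OF group_W]], of n] by (simp add: one_W)

lemma mem_dcoset_cls:
  assumes "n \<in> N"
  shows "g \<in> dcoset G B (cls n) \<longleftrightarrow> (\<exists>b\<in>B. \<exists>b'\<in>B. g = b \<otimes> n \<otimes> b')"
proof
  assume "g \<in> dcoset G B (cls n)"
  then obtain b t b' where *: "b \<in> B" "t \<in> B" "b' \<in> B" "g = b \<otimes> (t \<otimes> n) \<otimes> b'"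
    by (auto simp: mem_dcoset cls_def r_coset_def)
  have "g = (b \<otimes> t) \<otimes> n \<otimes> b'" using * assms by (simp add: m_assoc B_carrier N_carrier)
  thus "\<exists>b\<in>B. \<exists>b'\<in>B. g = b \<otimes> n \<otimes> b'" using * subgroup.m_closed[OF B_sub] by blast
qed (use self_in_cls[OF assms] in \<open>auto simp: mem_dcoset\<close>)

text \<open>Since \<open>m\<close> normalizes \<open>B\<close>, the factor from \<open>B\<close>
  between \<open>m\<close> and \<open>n\<close> can be moved to the left of \<open>m\<close>, so the
  product of double cosets does not split.\<close>

lemma dcoset_normalizer_mult:
  assumes m: "m \<in> N" "m \<in> normalizer G B" and x: "x \<in> carrier W"
  shows "dcoset G B (cls m) <#> dcoset G B x \<subseteq> dcoset G B (cls m \<otimes>\<^bsub>W\<^esub> x)"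
proof
  fix g assume "g \<in> dcoset G B (cls m) <#> dcoset G B x"
  then obtain c h where ch: "c \<in> dcoset G B (cls m)" "h \<in> dcoset G B x" "g = c \<otimes> h"
    by (auto simp: mem_set_mult)
  obtain n where n: "n \<in> N" "x = cls n" using x by (auto simp: carrier_W)
  obtain p q p' q' where *: "p \<in> B" "q \<in> B" "p' \<in> B" "q' \<in> B" "c = p \<otimes> m \<otimes> q"
    "h = p' \<otimes> n \<otimes> q'" using ch m n by (auto simp: mem_dcoset_cls)
  define b where "b = m \<otimes> (q \<otimes> p') \<otimes> inv m"
  have b: "b \<in> B"
    unfolding b_def using normalizer_conj(1)[OF B_sub m(2)] * subgroup.m_closed[OF B_sub] by blast
  have cl: "p \<in> carrier G" "q \<in> carrier G" "p' \<in> carrier G" "q' \<in> carrier G"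
    "m \<in> carrier G" "n \<in> carrier G" using * m n B_carrier N_carrier by auto
  have "(p \<otimes> b) \<otimes> (m \<otimes> n) \<otimes> q' = p \<otimes> m \<otimes> (q \<otimes> p') \<otimes> (inv m \<otimes> m) \<otimes> n \<otimes> q'"
    unfolding b_def using cl by (simp only: m_assoc m_closed inv_closed)
  also have "\<dots> = g" using cl * ch by (simp add: m_assoc)
  finally have "g = (p \<otimes> b) \<otimes> (m \<otimes> n) \<otimes> q'" ..
  thus "g \<in> dcoset G B (cls m \<otimes>\<^bsub>W\<^esub> x)"
    using m n * b subgroup.m_closed[OF B_sub] subgroup.m_closed[OF N_sub]
    by (auto simp: cls_mult mem_dcoset_cls)
qed

lemma dcoset_biinvariant:
  assumes "x \<in> carrier W" "g \<in> dcoset G B x" "b \<in> B" "b' \<in> B"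
  shows "b \<otimes> g \<otimes> b' \<in> dcoset G B x"
proof -
  obtain n where n: "n \<in> N" "x = cls n" using assms(1) by (auto simp: carrier_W)
  then obtain p q where *: "p \<in> B" "q \<in> B" "g = p \<otimes> n \<otimes> q"
    using assms(2) by (auto simp: mem_dcoset_cls)
  have "b \<otimes> g \<otimes> b' = (b \<otimes> p) \<otimes> n \<otimes> (q \<otimes> b')"
    using n * assms by (simp add: m_assoc B_carrier N_carrier)
  thus ?thesis using n * assms subgroup.m_closed[OF B_sub] by (auto simp: mem_dcoset_cls)
qed

lemma self_in_dcoset: "n \<in> N \<Longrightarrow> n \<in> dcoset G B (cls n)"
  using subgroup.one_closed[OF B_sub] N_carrier
  by (auto simp: mem_dcoset_cls intro!: bexI[of _ \<one>])

text \<open>The axioms on single double cosets, products and inverses hold for every such quotient.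
  The premises keep what depends on the generators; elements of \<Omega> are classes of elements
  normalizing \<open>B\<close>, which gives \<open>Omega_left\<close>.\<close>

lemma double_coset_systemI:
  assumes S: "S \<subseteq> carrier W" "\<And>s. s \<in> S \<Longrightarrow> s \<otimes>\<^bsub>W\<^esub> s = \<one>\<^bsub>W\<^esub>" "\<one>\<^bsub>W\<^esub> \<notin> S"
    and exch: "\<And>s x. s \<in> S \<Longrightarrow> x \<in> carrier W \<Longrightarrow>
      dcoset G B s <#> dcoset G B x \<subseteq> dcoset G B x \<union> dcoset G B (s \<otimes>\<^bsub>W\<^esub> x)"
    and square: "\<And>s. s \<in> S \<Longrightarrow> dcoset G B s <#> dcoset G B s \<noteq> B"
    and Om: "subgroup \<Omega> W" "\<Omega> \<subseteq> cls ` (N \<inter> normalizer G B)"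
    and fact: "\<And>x. x \<in> carrier W \<Longrightarrow>
      \<exists>ss r. set ss \<subseteq> S \<and> r \<in> \<Omega> \<and> x = list_prod W ss \<otimes>\<^bsub>W\<^esub> r"
  shows "double_coset_system G W B (dcoset G B) S \<Omega>"
proof -
  interpret W: group W by (rule group_W)
  note Bm = subgroup.m_closed[OF B_sub] and Bi = subgroup.m_inv_closed[OF B_sub]
    and B1 = subgroup.one_closed[OF B_sub] and Nm = subgroup.m_closed[OF N_sub]
    and Ni = subgroup.m_inv_closed[OF N_sub]
  have dN: "\<exists>n\<in>N. x = cls n" if "x \<in> carrier W" for x using that by (auto simp: carrier_W)
  note self = self_in_dcoset
  show ?thesis
  proof (intro double_coset_system.intro double_coset_system_axioms.intro)
    show "group G" by (rule is_group)
    show "subgroup B G" by (rule B_sub)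
    show "dcoset G B x \<subseteq> carrier G" if "x \<in> carrier W" for x
      using dN[OF that] by (auto simp: mem_dcoset_cls B_carrier N_carrier)
    show "dcoset G B x \<noteq> {}" if "x \<in> carrier W" for x using dN[OF that] self by blast
    show "b \<otimes> g \<otimes> b' \<in> dcoset G B x"
      if hyp: "x \<in> carrier W" "g \<in> dcoset G B x" and b: "b \<in> B" "b' \<in> B" for x g b b'
      using dcoset_biinvariant[OF hyp b] .
    show "\<exists>b\<in>B. \<exists>b'\<in>B. h = b \<otimes> g \<otimes> b'"
      if hyp: "x \<in> carrier W" "g \<in> dcoset G B x" "h \<in> dcoset G B x" for x g h
    proof -
      obtain n p q where n: "n \<in> N" "x = cls n" "p \<in> B" "q \<in> B" "g = p \<otimes> n \<otimes> q"
        using hyp dN[OF hyp(1)] by (auto simp: mem_dcoset_cls)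
      obtain p' q' where h: "p' \<in> B" "q' \<in> B" "h = p' \<otimes> n \<otimes> q'"
        using hyp n by (auto simp: mem_dcoset_cls)
      have "inv p \<otimes> g \<otimes> inv q = n"
        using n by (simp add: m_assoc B_carrier N_carrier) (simp add: B_carrier N_carrier flip: m_assoc)
      hence "h = p' \<otimes> (inv p \<otimes> g \<otimes> inv q) \<otimes> q'" using h by simp
      also have "\<dots> = (p' \<otimes> inv p) \<otimes> g \<otimes> (inv q \<otimes> q')"
        using n h by (simp add: m_assoc B_carrier N_carrier) (simp add: B_carrier flip: m_assoc)
      finally show ?thesis using n h Bm Bi by blast
    qed
    show "dcoset G B \<one>\<^bsub>W\<^esub> = B"
    proof -
      have "g \<in> dcoset G B (cls \<one>) \<longleftrightarrow> g \<in> B" for g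
      proof
        assume "g \<in> B"
        hence "g = g \<otimes> \<one> \<otimes> \<one>" using B_carrier by simp
        thus "g \<in> dcoset G B (cls \<one>)"
          unfolding mem_dcoset_cls[OF subgroup.one_closed[OF N_sub]] using \<open>g \<in> B\<close> B1 by blast
      qed (auto simp: mem_dcoset_cls[OF subgroup.one_closed[OF N_sub]] B_carrier intro: Bm)
      thus ?thesis by (auto simp: cls_one)
    qed
    show "inv g \<in> dcoset G B (inv\<^bsub>W\<^esub> x)" if hyp: "x \<in> carrier W" "g \<in> dcoset G B x" for x g
    proof -
      obtain n p q where n: "n \<in> N" "x = cls n" "p \<in> B" "q \<in> B" "g = p \<otimes> n \<otimes> q"
        using hyp dN[OF hyp(1)] by (auto simp: mem_dcoset_cls)
      have "inv g = inv q \<otimes> inv n \<otimes> inv p"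
        using n by (simp add: m_assoc B_carrier N_carrier inv_mult_group)
      thus ?thesis using n Bi Ni by (auto simp: mem_dcoset_cls cls_inv)
    qed
    show "\<exists>g\<in>dcoset G B x. \<exists>h\<in>dcoset G B y. g \<otimes> h \<in> dcoset G B (x \<otimes>\<^bsub>W\<^esub> y)"
      if xy: "x \<in> carrier W" "y \<in> carrier W" for x y
      using dN[OF xy(1)] dN[OF xy(2)] self Nm by (auto simp: cls_mult intro!: bexI)
    show "x = \<one>\<^bsub>W\<^esub>" if hyp: "x \<in> carrier W" "dcoset G B x \<inter> B \<noteq> {}" for x
    proof -
      obtain n where n: "n \<in> N" "x = cls n" using dN[OF hyp(1)] by blast
      then obtain p q where pq: "p \<in> B" "q \<in> B" "p \<otimes> n \<otimes> q \<in> B"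
        using hyp(2) by (auto simp: mem_dcoset_cls)
      have "inv p \<otimes> (p \<otimes> n \<otimes> q) \<otimes> inv q = n"
        using n pq by (simp add: m_assoc B_carrier N_carrier) (simp add: B_carrier N_carrier flip: m_assoc)
      hence "n \<in> B" using pq Bm Bi by metis
      thus ?thesis using n cls_eq_one by simp
    qed
    show "dcoset G B r <#> dcoset G B x \<subseteq> dcoset G B (r \<otimes>\<^bsub>W\<^esub> x)"
      if hyp: "r \<in> \<Omega>" "x \<in> carrier W" for r x
      using dcoset_normalizer_mult[OF _ _ hyp(2)] hyp(1) Om(2) by blast
  qed (use assms W.is_group in auto)
qed

end

section \<open>The extended Weyl group\<close>

text \<open>Here \<open>G\<close> is the ambient group, called \<open>Gt\<close> in the theorem, and
  \<open>H\<close> is the subgroup that carries the Tits system. Both yield the same Weyl group by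
  \<open>weyl_group_carrier_update\<close>.\<close>

locale extended_tits = group G for G (structure) +
  fixes H B N :: "'a set" and S :: "'a set set"
  assumes H_sub: "subgroup H G" and tits: "tits_system (G\<lparr>carrier := H\<rparr>) B N S"

sublocale extended_tits \<subseteq> base: weyl_pair G B N
proof (intro weyl_pair.intro weyl_pair_axioms.intro)
  show "group G" by (rule is_group)
  interpret t: tits_system "G\<lparr>carrier := H\<rparr>" B N S by (rule tits)
  show "subgroup B G" "subgroup N G"
    using incl_subgroup[OF H_sub] t.B_subgroup t.N_subgroup by auto
  show "(B \<inter> N) \<lhd> (G\<lparr>carrier := N\<rparr>)" using t.T_normal by simp
qed

context extended_tits
begin

lemma S_carrier: "S \<subseteq> carrier base.W"
  using tits_system.S_subset[OF tits] by simp

lemma S_involution: assumes "s \<in> S" shows "s \<otimes>\<^bsub>base.W\<^esub> s = \<one>\<^bsub>base.W\<^esub>" "s \<noteq> \<one>\<^bsub>base.W\<^esub>"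
proof -
  interpret W: group base.W by (rule base.group_W)
  have s: "s \<in> carrier base.W" "W.ord s = 2"
    using S_carrier assms tits_system.S_order[OF tits assms] by auto
  have "s [^]\<^bsub>base.W\<^esub> (2::nat) = \<one>\<^bsub>base.W\<^esub>" using W.pow_ord_eq_1[OF s(1)] s(2) by simp
  thus "s \<otimes>\<^bsub>base.W\<^esub> s = \<one>\<^bsub>base.W\<^esub>" using s(1) by (simp add: numeral_2_eq_2)
  show "s \<noteq> \<one>\<^bsub>base.W\<^esub>" using s W.ord_eq_1 by fastforce
qed

lemma exchange_dcoset:
  assumes s: "s \<in> S" and x: "x \<in> carrier base.W"
  shows "dcoset G B s <#> dcoset G B x \<subseteq> dcoset G B x \<union> dcoset G B (s \<otimes>\<^bsub>base.W\<^esub> x)"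
proof
  fix g assume "g \<in> dcoset G B s <#> dcoset G B x"
  then obtain c h where "c \<in> dcoset G B s" "h \<in> dcoset G B x" "g = c \<otimes> h"
    by (auto simp: mem_set_mult)
  then obtain p m q p' n q' where *: "p \<in> B" "m \<in> s" "q \<in> B" "p' \<in> B" "n \<in> x" "q' \<in> B"
    "g = (p \<otimes> m \<otimes> q) \<otimes> (p' \<otimes> n \<otimes> q')" by (auto simp: mem_dcoset)
  have sc: "s \<in> carrier base.W" using s S_carrier by blast
  have cl: "p \<in> carrier G" "q \<in> carrier G" "p' \<in> carrier G" "q' \<in> carrier G"
    "m \<in> carrier G" "n \<in> carrier G"
    using * base.cls_eqI(1)[OF sc] base.cls_eqI(1)[OF x] base.B_carrier base.N_carrier by auto
  have "s <#> B <#> x \<subseteq> dcoset G B x \<union> dcoset G B (s \<otimes>\<^bsub>base.W\<^esub> x)"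
    using tits_system.exchange[OF tits s, of x] x by (simp add: dcoset_def)
  moreover have "m \<otimes> (q \<otimes> p') \<otimes> n \<in> s <#> B <#> x"
    using * subgroup.m_closed[OF base.B_sub] by (intro set_multI)
  ultimately have "m \<otimes> (q \<otimes> p') \<otimes> n \<in> dcoset G B x \<or>
      m \<otimes> (q \<otimes> p') \<otimes> n \<in> dcoset G B (s \<otimes>\<^bsub>base.W\<^esub> x)" by blast
  hence "p \<otimes> (m \<otimes> (q \<otimes> p') \<otimes> n) \<otimes> q' \<in> dcoset G B x \<union> dcoset G B (s \<otimes>\<^bsub>base.W\<^esub> x)"
    using base.dcoset_biinvariant[OF x _ *(1,6)]
      base.dcoset_biinvariant[OF monoid.m_closed[OF group.is_monoid[OF base.group_W] sc x] _ *(1,6)]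
    by blast
  also have "p \<otimes> (m \<otimes> (q \<otimes> p') \<otimes> n) \<otimes> q' = g" using * cl by (simp add: m_assoc)
  finally show "g \<in> dcoset G B x \<union> dcoset G B (s \<otimes>\<^bsub>base.W\<^esub> x)" .
qed

text \<open>From \<open>BsBsB = B\<close> one recovers \<open>sBs = B\<close>, which is excluded.
  The inclusion of \<open>B\<close> in \<open>sBs\<close> uses that the involution \<open>s\<close>
  is the class of both \<open>n\<close> and its inverse.\<close>

lemma dcoset_square:
  assumes s: "s \<in> S" shows "dcoset G B s <#> dcoset G B s \<noteq> B"
proof
  assume eq: "dcoset G B s <#> dcoset G B s = B"
  interpret W: group base.W by (rule base.group_W)
  have sc: "s \<in> carrier base.W" using s S_carrier by blast
  obtain n where n: "n \<in> N" "s = base.cls n" using sc by (auto simp: base.carrier_W)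
  have "inv\<^bsub>base.W\<^esub> s = s" using S_involution[OF s] sc by (intro W.inv_equality)
  hence ni: "s = base.cls (inv n)" using base.cls_inv n by simp
  have niN: "inv n \<in> N" using subgroup.m_inv_closed[OF base.N_sub] n by blast
  have self: "x \<in> dcoset G B s" if "x \<in> s" for x
    using base.self_in_dcoset[of x] base.cls_eqI[OF sc that] by simp
  have ns: "n \<in> s" "inv n \<in> s" using base.self_in_cls n niN ni by auto
  have biR: "x \<otimes> b \<in> dcoset G B s" if "x \<in> s" "b \<in> B" for x b
    using base.dcoset_biinvariant[OF sc self[OF that(1)] subgroup.one_closed[OF base.B_sub] that(2)]
      base.N_carrier[OF base.cls_eqI(1)[OF sc that(1)]] by simp
  have "s <#> B <#> s = B"
  proof (intro equalityI subsetI)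
    fix g assume "g \<in> s <#> B <#> s"
    then obtain x b y where *: "x \<in> s" "b \<in> B" "y \<in> s" "g = x \<otimes> b \<otimes> y"
      by (auto simp: set_mult_def)
    thus "g \<in> B" using eq set_multI[OF biR[OF *(1,2)] self[OF *(3)], of G] by simp
  next
    fix b assume b: "b \<in> B"
    have "inv n \<otimes> b \<otimes> inv n \<in> B"
      using eq set_multI[OF biR[OF ns(2) b] self[OF ns(2)], of G] by simp
    hence "n \<otimes> (inv n \<otimes> b \<otimes> inv n) \<otimes> n \<in> s <#> B <#> s" using ns by (intro set_multI)
    moreover have "n \<otimes> (inv n \<otimes> b \<otimes> inv n) \<otimes> n = (n \<otimes> inv n) \<otimes> b \<otimes> (inv n \<otimes> n)"
      using base.B_carrier[OF b] base.N_carrier[OF n(1)] by (simp only: m_assoc m_closed inv_closed)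
    ultimately show "b \<in> s <#> B <#> s"
      using base.B_carrier[OF b] base.N_carrier[OF n(1)] by simp
  qed
  thus False using tits_system.nondegenerate[OF tits s] by simp
qed

lemma base_words: "carrier base.W = {list_prod base.W ss |ss. set ss \<subseteq> S}"
  using group.generate_involutions[OF base.group_W S_carrier] S_involution
    tits_system.S_generates[OF tits] by simp

end

sublocale extended_tits \<subseteq>
  cox: double_coset_system G "weyl_group G B N" B "dcoset G B" S "{\<one>\<^bsub>weyl_group G B N\<^esub>}"
proof (rule base.double_coset_systemI)
  interpret W: group base.W by (rule base.group_W)
  show "subgroup {\<one>\<^bsub>base.W\<^esub>} base.W" by (rule W.triv_subgroup)
  have "\<one> \<in> normalizer G B"
    using subgroup.one_closed[OF normalizer_imp_subgroup[OF subgroup.subset[OF base.B_sub]]] .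
  thus "{\<one>\<^bsub>base.W\<^esub>} \<subseteq> base.cls ` (N \<inter> normalizer G B)"
    using base.cls_one subgroup.one_closed[OF base.N_sub] by (auto intro!: image_eqI[of _ _ \<one>])
  show "\<exists>ss r. set ss \<subseteq> S \<and> r \<in> {\<one>\<^bsub>base.W\<^esub>} \<and> x = list_prod base.W ss \<otimes>\<^bsub>base.W\<^esub> r"
    if "x \<in> carrier base.W" for x
  proof -
    obtain ss where ss: "set ss \<subseteq> S" "x = list_prod base.W ss" using \<open>x \<in> carrier base.W\<close> base_words by blast
    hence "x = list_prod base.W ss \<otimes>\<^bsub>base.W\<^esub> \<one>\<^bsub>base.W\<^esub>" using that by simp
    thus ?thesis using ss by blast
  qed
qed (use S_carrier S_involution exchange_dcoset dcoset_square in auto)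

context extended_tits
begin

abbreviation \<Gamma> where "\<Gamma> \<equiv> Gamma_grp G B N"

abbreviation E where "E \<equiv> N_ext G B N"

lemma word_length_eq: "word_length base.W S x = cox.len x"
  unfolding word_length_def cox.len_def
  by (rule arg_cong[of _ _ Least], rule ext) auto

section \<open>The group generated by \<open>N\<close> and \<Gamma>, and its intersection with
  \<open>B\<close>\<close>

lemma Gamma_sub: "subgroup \<Gamma> G"
  unfolding Gamma_grp_def using base.B_sub base.N_sub
  by (intro subgroups_Inter_pair normalizer_imp_subgroup subgroup.subset)

lemma Gamma_carrier: "\<gamma> \<in> \<Gamma> \<Longrightarrow> \<gamma> \<in> carrier G"
  using subgroup.mem_carrier[OF Gamma_sub] .

lemma Gamma_conj:
  assumes "\<gamma> \<in> \<Gamma>"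
  shows "b \<in> B \<Longrightarrow> \<gamma> \<otimes> b \<otimes> inv \<gamma> \<in> B" "b \<in> B \<Longrightarrow> inv \<gamma> \<otimes> b \<otimes> \<gamma> \<in> B"
    "n \<in> N \<Longrightarrow> \<gamma> \<otimes> n \<otimes> inv \<gamma> \<in> N" "n \<in> N \<Longrightarrow> inv \<gamma> \<otimes> n \<otimes> \<gamma> \<in> N"
  using assms normalizer_conj base.B_sub base.N_sub by (auto simp: Gamma_grp_def)

lemma normalizing_in_B:
  assumes n: "n \<in> N" "n \<in> normalizer G B" shows "n \<in> B"
proof -
  have "base.cls n \<in> cox.words S"
    using base.cls_closed[OF n(1)] base_words by (auto simp: cox.words_def)
  hence "base.cls n = \<one>\<^bsub>base.W\<^esub>"
    using cox.normalizing_eq_one base.dcoset_normalizer_mult[OF n] S_carrier by blast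
  thus ?thesis using base.self_in_cls[OF n(1)] base.one_W by simp
qed

lemma mem_E: "g \<in> E \<longleftrightarrow> (\<exists>n\<in>N. \<exists>\<gamma>\<in>\<Gamma>. g = n \<otimes> \<gamma>)"
  by (simp add: N_ext_def mem_set_mult)

lemma E_sub: "subgroup E G"
proof (rule subgroupI)
  show "E \<subseteq> carrier G" using base.N_carrier Gamma_carrier by (auto simp: mem_E)
  have "\<one> \<otimes> \<one> \<in> E"
    using subgroup.one_closed[OF base.N_sub] subgroup.one_closed[OF Gamma_sub] mem_E by blast
  thus "E \<noteq> {}" by blast
  show "inv g \<in> E" if g: "g \<in> E" for g
  proof -
    obtain n \<gamma> where *: "n \<in> N" "\<gamma> \<in> \<Gamma>" "g = n \<otimes> \<gamma>" using g mem_E by blast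
    have "inv g = (inv \<gamma> \<otimes> inv n \<otimes> \<gamma>) \<otimes> inv \<gamma>"
      using * base.N_carrier Gamma_carrier by (simp add: inv_mult_group m_assoc)
    thus ?thesis unfolding mem_E
      using Gamma_conj(4)[OF *(2)] subgroup.m_inv_closed[OF base.N_sub *(1)]
        subgroup.m_inv_closed[OF Gamma_sub *(2)] by blast
  qed
  show "g \<otimes> h \<in> E" if g: "g \<in> E" "h \<in> E" for g h
  proof -
    obtain n \<gamma> m \<delta> where *: "n \<in> N" "\<gamma> \<in> \<Gamma>" "g = n \<otimes> \<gamma>" "m \<in> N" "\<delta> \<in> \<Gamma>" "h = m \<otimes> \<delta>"
      using g mem_E by blast
    have cl: "n \<in> carrier G" "\<gamma> \<in> carrier G" "m \<in> carrier G" "\<delta> \<in> carrier G"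
      using * base.N_carrier Gamma_carrier by auto
    have "(n \<otimes> (\<gamma> \<otimes> m \<otimes> inv \<gamma>)) \<otimes> (\<gamma> \<otimes> \<delta>) = n \<otimes> \<gamma> \<otimes> m \<otimes> (inv \<gamma> \<otimes> \<gamma>) \<otimes> \<delta>"
      using cl by (simp only: m_assoc m_closed inv_closed)
    also have "\<dots> = g \<otimes> h" using * cl by (simp add: m_assoc)
    finally have "g \<otimes> h = (n \<otimes> (\<gamma> \<otimes> m \<otimes> inv \<gamma>)) \<otimes> (\<gamma> \<otimes> \<delta>)" ..
    thus ?thesis unfolding mem_E
      using * Gamma_conj(3)[OF *(2,4)] subgroup.m_closed[OF base.N_sub]
        subgroup.m_closed[OF Gamma_sub] by blast
  qed
qed

lemma N_in_E: "n \<in> N \<Longrightarrow> n \<in> E"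
  unfolding mem_E using subgroup.one_closed[OF Gamma_sub] base.N_carrier
  by (intro bexI[of _ n] bexI[of _ \<one>]) auto

lemma Gamma_in_E: "\<gamma> \<in> \<Gamma> \<Longrightarrow> \<gamma> \<in> E"
  unfolding mem_E using subgroup.one_closed[OF base.N_sub] Gamma_carrier
  by (intro bexI[of _ \<gamma>] bexI[of _ \<one>]) auto

lemma B_normalizes: "b \<in> B \<Longrightarrow> b \<in> normalizer G B"
  using subgroup.mem_carrier[OF base.B_sub] subgroup.m_closed[OF base.B_sub]
    subgroup.m_inv_closed[OF base.B_sub] by (intro normalizerI[OF base.B_sub]) auto

text \<open>The factor \<open>n\<close> is \<open>t\<close> times the inverse of \<gamma>, hence
  normalizes \<open>B\<close> and falls under \<open>normalizing_in_B\<close>; then \<gamma> lies in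
  \<open>B\<close> as well.\<close>

lemma T_ext_split:
  assumes "t \<in> B" "t \<in> E"
  obtains n \<gamma> where "n \<in> B" "n \<in> N" "\<gamma> \<in> B" "\<gamma> \<in> \<Gamma>" "t = n \<otimes> \<gamma>"
proof -
  obtain n \<gamma> where *: "n \<in> N" "\<gamma> \<in> \<Gamma>" "t = n \<otimes> \<gamma>" using assms mem_E by blast
  have cl: "n \<in> carrier G" "\<gamma> \<in> carrier G" using * base.N_carrier Gamma_carrier by auto
  note NB = normalizer_imp_subgroup[OF subgroup.subset[OF base.B_sub]]
  have "n = t \<otimes> inv \<gamma>" using * cl by (simp add: m_assoc)
  moreover have "inv \<gamma> \<in> normalizer G B"
    using * subgroup.m_inv_closed[OF NB] by (auto simp: Gamma_grp_def)
  ultimately have "n \<in> normalizer G B"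
    using subgroup.m_closed[OF NB B_normalizes[OF assms(1)]] by simp
  hence n: "n \<in> B" using normalizing_in_B * by blast
  have "\<gamma> = inv n \<otimes> t" using * cl by (simp flip: m_assoc)
  hence "\<gamma> \<in> B" using n assms subgroup.m_closed[OF base.B_sub] subgroup.m_inv_closed[OF base.B_sub]
    by simp
  thus ?thesis using that n * by blast
qed

text \<open>Conjugation by an element of \<open>\<Gamma> \<inter> B\<close> preserves the double
  cosets of \<open>B\<close>, so by \<open>cox.C_inj\<close> it acts trivially on \<open>W\<close>.
  Hence \<open>m\<close> times the conjugate \<open>?m\<close> of its inverse lies in
  \<open>B\<close>, and multiplying by \<gamma> gives the claim.\<close>

lemma N_conj_Gamma_B:
  assumes m: "m \<in> N" and \<gamma>: "\<gamma> \<in> \<Gamma>" "\<gamma> \<in> B"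
  shows "m \<otimes> \<gamma> \<otimes> inv m \<in> B"
proof -
  let ?m = "\<gamma> \<otimes> inv m \<otimes> inv \<gamma>"
  have mi: "inv m \<in> N" using subgroup.m_inv_closed[OF base.N_sub m] .
  have m': "?m \<in> N" using Gamma_conj(3)[OF \<gamma>(1) mi] .
  have cl: "m \<in> carrier G" "\<gamma> \<in> carrier G" using m \<gamma> base.N_carrier Gamma_carrier by auto
  have "?m \<in> dcoset G B (base.cls (inv m))"
    using base.mem_dcoset_cls[OF mi] \<gamma>(2) subgroup.m_inv_closed[OF base.B_sub] by blast
  hence eq: "base.cls ?m = base.cls (inv m)"
    using cox.C_inj base.self_in_dcoset[OF m'] base.cls_closed m' mi by blast
  have "base.cls (m \<otimes> ?m) = base.cls m \<otimes>\<^bsub>base.W\<^esub> base.cls (inv m)"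
    using base.cls_mult[OF m m'] eq by simp
  also have "\<dots> = \<one>\<^bsub>base.W\<^esub>" using base.cls_mult[OF m mi] cl base.cls_one by simp
  finally have "m \<otimes> ?m \<in> B"
    using base.self_in_cls[of "m \<otimes> ?m"] subgroup.m_closed[OF base.N_sub m m'] base.one_W by simp
  hence "(m \<otimes> ?m) \<otimes> \<gamma> \<in> B" using subgroup.m_closed[OF base.B_sub] \<gamma> by blast
  moreover have "(m \<otimes> ?m) \<otimes> \<gamma> = m \<otimes> \<gamma> \<otimes> inv m" using cl by (simp add: m_assoc)
  ultimately show ?thesis by simp
qed

text \<open>Conjugation by the part of \<open>g\<close> in \<Gamma> preserves \<open>B\<close> and
  \<open>E\<close>. The result splits into an element of \<open>B \<inter> N\<close>, which is
  normal in \<open>N\<close>, and an element of \<open>\<Gamma> \<inter> B\<close>, handled by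
  \<open>N_conj_Gamma_B\<close>.\<close>

lemma T_ext_normal: "(B \<inter> E) \<lhd> (G\<lparr>carrier := E\<rparr>)"
proof -
  interpret E: group "G\<lparr>carrier := E\<rparr>" using subgroup_imp_group[OF E_sub] .
  have "g \<otimes> t \<otimes> inv g \<in> B" if g: "g \<in> E" and t: "t \<in> B" "t \<in> E" for g t
  proof -
    obtain m \<delta> where *: "m \<in> N" "\<delta> \<in> \<Gamma>" "g = m \<otimes> \<delta>" using g mem_E by blast
    let ?t = "\<delta> \<otimes> t \<otimes> inv \<delta>"
    have "?t \<in> B" using Gamma_conj(1)[OF *(2) t(1)] .
    moreover have "?t \<in> E"
      using t subgroup.m_closed[OF E_sub] subgroup.m_inv_closed[OF E_sub] Gamma_in_E[OF *(2)] by blast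
    ultimately obtain n \<gamma> where s: "n \<in> B" "n \<in> N" "\<gamma> \<in> B" "\<gamma> \<in> \<Gamma>" "?t = n \<otimes> \<gamma>"
      using T_ext_split by blast
    have cl: "m \<in> carrier G" "\<delta> \<in> carrier G" "t \<in> carrier G" "n \<in> carrier G" "\<gamma> \<in> carrier G"
      using * s t base.N_carrier base.B_carrier Gamma_carrier by auto
    have "inv m \<in> N" "m \<otimes> n \<in> N"
      using subgroup.m_inv_closed[OF base.N_sub] subgroup.m_closed[OF base.N_sub] * s by auto
    hence "m \<otimes> n \<otimes> inv m \<in> N" using subgroup.m_closed[OF base.N_sub] by blast
    moreover have "base.cls (m \<otimes> n \<otimes> inv m) = \<one>\<^bsub>base.W\<^esub>"
    proof -
      have "base.cls (m \<otimes> n \<otimes> inv m) = base.cls m \<otimes>\<^bsub>base.W\<^esub> base.cls n \<otimes>\<^bsub>base.W\<^esub> base.cls (inv m)"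
        using * s \<open>inv m \<in> N\<close> \<open>m \<otimes> n \<in> N\<close> by (simp add: base.cls_mult)
      also have "\<dots> = base.cls m \<otimes>\<^bsub>base.W\<^esub> base.cls (inv m)"
        using base.cls_eq_one[OF s(2,1)] base.cls_closed[OF *(1)] by simp
      finally show ?thesis using base.cls_mult[OF *(1) \<open>inv m \<in> N\<close>] cl base.cls_one by simp
    qed
    ultimately have "m \<otimes> n \<otimes> inv m \<in> B" using base.self_in_cls base.one_W by blast
    hence "(m \<otimes> n \<otimes> inv m) \<otimes> (m \<otimes> \<gamma> \<otimes> inv m) \<in> B"
      using N_conj_Gamma_B[OF *(1) s(4,3)] subgroup.m_closed[OF base.B_sub] by blast
    also have "(m \<otimes> n \<otimes> inv m) \<otimes> (m \<otimes> \<gamma> \<otimes> inv m) = m \<otimes> n \<otimes> (inv m \<otimes> m) \<otimes> \<gamma> \<otimes> inv m"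
      using cl by (simp only: m_assoc m_closed inv_closed)
    also have "\<dots> = m \<otimes> ?t \<otimes> inv m" using cl by (simp add: s(5) m_assoc)
    also have "\<dots> = g \<otimes> t \<otimes> inv g" using cl * by (simp add: inv_mult_group m_assoc)
    finally show ?thesis .
  qed
  moreover have "subgroup (B \<inter> E) (G\<lparr>carrier := E\<rparr>)"
    using subgroup_incl[OF subgroups_Inter_pair[OF base.B_sub E_sub] E_sub] by simp
  ultimately show ?thesis
    using subgroup.m_closed[OF E_sub] subgroup.m_inv_closed[OF E_sub]
    by (auto simp: E.normal_inv_iff m_inv_consistent[OF E_sub])
qed

end

sublocale extended_tits \<subseteq> ext: weyl_pair G B "N_ext G B N"
  using is_group base.B_sub E_sub T_ext_normal by (intro weyl_pair.intro weyl_pair_axioms.intro)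

lemma set_subset_image_map:
  assumes "set ts \<subseteq> f ` A" shows "\<exists>ss. ts = map f ss \<and> set ss \<subseteq> A"
proof -
  have "ts \<in> lists (f ` A)" using assms by auto
  hence "ts \<in> map f ` lists A" by (simp only: lists_image)
  thus ?thesis by auto
qed

context extended_tits
begin

section \<open>Embedding of \<open>W\<close> into the extended Weyl group\<close>

lemma W_ext_eq: "W_ext G B N = ext.W"
  by (simp add: W_ext_def weyl_group_def T_ext_def Int_commute)

lemma T_ext_eq: "T_ext G B N = B \<inter> E"
  by (auto simp: T_ext_def)

abbreviation emb where "emb \<equiv> W_emb G B N"

lemma emb_cls: assumes "n \<in> N" shows "emb (base.cls n) = ext.cls n"
proof (intro equalityI subsetI)
  fix g assume "g \<in> emb (base.cls n)"
  then obtain t u where *: "t \<in> B \<inter> E" "u \<in> B \<inter> N" "g = t \<otimes> (u \<otimes> n)"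
    by (auto simp: W_emb_def T_ext_eq mem_set_mult base.cls_def r_coset_def)
  have "t \<otimes> u \<in> B \<inter> E"
    using * N_in_E subgroup.m_closed[OF subgroups_Inter_pair[OF base.B_sub E_sub]] by blast
  moreover have "g = (t \<otimes> u) \<otimes> n"
    using * assms base.B_carrier base.N_carrier by (simp add: m_assoc)
  ultimately show "g \<in> ext.cls n" by (auto simp: ext.cls_def r_coset_def)
next
  fix g assume "g \<in> ext.cls n"
  then obtain t where "t \<in> B \<inter> E" "g = t \<otimes> n" by (auto simp: ext.cls_def r_coset_def)
  thus "g \<in> emb (base.cls n)"
    using base.self_in_cls[OF assms] by (auto simp: W_emb_def T_ext_eq mem_set_mult)
qed

lemma emb_closed: "x \<in> carrier base.W \<Longrightarrow> emb x \<in> carrier ext.W"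
  using emb_cls ext.cls_closed N_in_E by (auto simp: base.carrier_W)

lemma emb_mult:
  assumes "x \<in> carrier base.W" "y \<in> carrier base.W"
  shows "emb (x \<otimes>\<^bsub>base.W\<^esub> y) = emb x \<otimes>\<^bsub>ext.W\<^esub> emb y"
proof -
  obtain m n where "m \<in> N" "x = base.cls m" "n \<in> N" "y = base.cls n"
    using assms by (auto simp: base.carrier_W)
  thus ?thesis
    using subgroup.m_closed[OF base.N_sub] by (simp add: base.cls_mult emb_cls ext.cls_mult N_in_E)
qed

lemma emb_one: "emb \<one>\<^bsub>base.W\<^esub> = \<one>\<^bsub>ext.W\<^esub>"
  using emb_cls[OF subgroup.one_closed[OF base.N_sub]] by (simp add: base.cls_one ext.cls_one)

lemma emb_list_prod:
  "set ss \<subseteq> carrier base.W \<Longrightarrow> list_prod ext.W (map emb ss) = emb (list_prod base.W ss)"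
  by (induction ss)
    (simp_all add: emb_one emb_mult monoid.list_prod_closed[OF group.is_monoid[OF base.group_W]])

text \<open>As \<gamma> normalizes \<open>B\<close>, it can be moved out of the double coset to the
  right. Double cosets of the extended system are thus translates of those of \<open>W\<close>,
  which carries the exchange axiom and the parametrisation over.\<close>

lemma dcoset_ext_cls:
  assumes n: "n \<in> N" and \<gamma>: "\<gamma> \<in> \<Gamma>"
  shows "dcoset G B (ext.cls (n \<otimes> \<gamma>)) = dcoset G B (base.cls n) #> \<gamma>"
proof (intro equalityI subsetI)
  have nE: "n \<otimes> \<gamma> \<in> E" using n \<gamma> mem_E by blast
  have cl: "n \<in> carrier G" "\<gamma> \<in> carrier G" using n \<gamma> base.N_carrier Gamma_carrier by auto
  fix g
  {
    assume "g \<in> dcoset G B (ext.cls (n \<otimes> \<gamma>))"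
    then obtain b b' where b: "b \<in> B" "b' \<in> B" "g = b \<otimes> (n \<otimes> \<gamma>) \<otimes> b'"
      using ext.mem_dcoset_cls[OF nE] by blast
    let ?b = "\<gamma> \<otimes> b' \<otimes> inv \<gamma>"
    have "g = (b \<otimes> n \<otimes> ?b) \<otimes> \<gamma>" using b cl base.B_carrier by (simp add: m_assoc)
    moreover have "b \<otimes> n \<otimes> ?b \<in> dcoset G B (base.cls n)"
      using base.mem_dcoset_cls[OF n] b Gamma_conj(1)[OF \<gamma> b(2)] by blast
    ultimately show "g \<in> dcoset G B (base.cls n) #> \<gamma>" by (auto simp: r_coset_def)
  next
    assume "g \<in> dcoset G B (base.cls n) #> \<gamma>"
    then obtain b b' where b: "b \<in> B" "b' \<in> B" "g = (b \<otimes> n \<otimes> b') \<otimes> \<gamma>"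
      using base.mem_dcoset_cls[OF n] by (auto simp: r_coset_def)
    let ?b = "inv \<gamma> \<otimes> b' \<otimes> \<gamma>"
    have "b \<otimes> (n \<otimes> \<gamma>) \<otimes> ?b = b \<otimes> n \<otimes> (\<gamma> \<otimes> inv \<gamma>) \<otimes> b' \<otimes> \<gamma>"
      using b cl base.B_carrier by (simp only: m_assoc m_closed inv_closed)
    also have "\<dots> = g" using b cl base.B_carrier by simp
    finally show "g \<in> dcoset G B (ext.cls (n \<otimes> \<gamma>))"
      using ext.mem_dcoset_cls[OF nE] b Gamma_conj(2)[OF \<gamma> b(2)] by blast
  }
qed

lemma dcoset_emb: assumes "x \<in> carrier base.W" shows "dcoset G B (emb x) = dcoset G B x"
proof -
  obtain n where n: "n \<in> N" "x = base.cls n" using assms by (auto simp: base.carrier_W)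
  have "dcoset G B (base.cls n) \<subseteq> carrier G"
    using base.mem_dcoset_cls[OF n(1)] base.B_carrier base.N_carrier[OF n(1)] by auto
  thus ?thesis
    using dcoset_ext_cls[OF n(1) subgroup.one_closed[OF Gamma_sub]] n base.N_carrier
    by (simp add: emb_cls coset_mult_one)
qed

lemma carrier_ext:
  assumes "x \<in> carrier ext.W"
  obtains n \<gamma> where "n \<in> N" "\<gamma> \<in> \<Gamma>" "x = ext.cls (n \<otimes> \<gamma>)"
    "x = emb (base.cls n) \<otimes>\<^bsub>ext.W\<^esub> ext.cls \<gamma>"
proof -
  obtain g where "g \<in> E" "x = ext.cls g" using assms by (auto simp: ext.carrier_W)
  then obtain n \<gamma> where *: "n \<in> N" "\<gamma> \<in> \<Gamma>" "x = ext.cls (n \<otimes> \<gamma>)" using mem_E by auto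
  thus ?thesis using that by (simp add: emb_cls ext.cls_mult N_in_E Gamma_in_E)
qed

lemma emb_eq_one:
  assumes "x \<in> carrier base.W" "emb x = \<one>\<^bsub>ext.W\<^esub>" shows "x = \<one>\<^bsub>base.W\<^esub>"
proof -
  obtain n where n: "n \<in> N" "x = base.cls n" using assms(1) by (auto simp: base.carrier_W)
  have "n \<in> B" using ext.self_in_cls[OF N_in_E[OF n(1)]] assms n emb_cls ext.one_W by simp
  thus ?thesis using base.cls_eq_one n by simp
qed

lemma exchange_emb:
  assumes s: "s \<in> S" and x: "x \<in> carrier ext.W"
  shows "dcoset G B (emb s) <#> dcoset G B x \<subseteq>
    dcoset G B x \<union> dcoset G B (emb s \<otimes>\<^bsub>ext.W\<^esub> x)"
proof
  fix g assume g: "g \<in> dcoset G B (emb s) <#> dcoset G B x"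
  have sc: "s \<in> carrier base.W" using s S_carrier by blast
  obtain m where m: "m \<in> N" "s = base.cls m" using sc by (auto simp: base.carrier_W)
  obtain n \<gamma> where n: "n \<in> N" "\<gamma> \<in> \<Gamma>" "x = ext.cls (n \<otimes> \<gamma>)" using carrier_ext[OF x] .
  let ?y = "base.cls n"
  have yc: "?y \<in> carrier base.W" using base.cls_closed[OF n(1)] .
  have mn: "m \<otimes> n \<in> N" using subgroup.m_closed[OF base.N_sub m(1) n(1)] .
  have E: "n \<otimes> \<gamma> \<in> E" using n mem_E by blast
  have cl: "m \<in> carrier G" "n \<in> carrier G" "\<gamma> \<in> carrier G"
    using m n base.N_carrier Gamma_carrier by auto
  have "emb s \<otimes>\<^bsub>ext.W\<^esub> x = ext.cls (m \<otimes> n \<otimes> \<gamma>)"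
    using m n cl E by (simp add: emb_cls ext.cls_mult N_in_E m_assoc)
  hence sx: "dcoset G B (emb s \<otimes>\<^bsub>ext.W\<^esub> x) = dcoset G B (s \<otimes>\<^bsub>base.W\<^esub> ?y) #> \<gamma>"
    using dcoset_ext_cls[OF mn n(2)] m n by (simp add: base.cls_mult)
  have xy: "dcoset G B x = dcoset G B ?y #> \<gamma>" using dcoset_ext_cls n by simp
  obtain a c where ac: "a \<in> dcoset G B s" "c \<in> dcoset G B ?y" "g = a \<otimes> (c \<otimes> \<gamma>)"
    using g by (auto simp: xy dcoset_emb[OF sc] mem_set_mult r_coset_def)
  have "a \<otimes> c \<in> dcoset G B ?y \<union> dcoset G B (s \<otimes>\<^bsub>base.W\<^esub> ?y)"
    using exchange_dcoset[OF s yc] set_multI[OF ac(1,2)] by blast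
  moreover have "g = (a \<otimes> c) \<otimes> \<gamma>"
    using ac cl cox.C_closed[OF sc] cox.C_closed[OF yc] by (simp add: m_assoc)
  ultimately show "g \<in> dcoset G B x \<union> dcoset G B (emb s \<otimes>\<^bsub>ext.W\<^esub> x)"
    unfolding xy sx r_coset_def by blast
qed

end

text \<open>The generators are the images of \<open>S\<close>, and \<Omega> appears as the classes
  of \<Gamma> in the quotient; \<open>Omega_emb_cls\<close> links these to
  \<open>Omega_grp\<close>.\<close>

sublocale extended_tits \<subseteq>
  ecox: double_coset_system G "weyl_group G B (N_ext G B N)" B "dcoset G B" "W_emb G B N ` S"
    "weyl_pair.cls G B (N_ext G B N) ` Gamma_grp G B N"
proof (rule ext.double_coset_systemI)
  interpret W: group ext.W by (rule ext.group_W)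
  show "emb ` S \<subseteq> carrier ext.W" using emb_closed S_carrier by blast
  show "s \<otimes>\<^bsub>ext.W\<^esub> s = \<one>\<^bsub>ext.W\<^esub>" if "s \<in> emb ` S" for s
    using that S_carrier S_involution(1) by (auto simp: emb_one simp flip: emb_mult)
  show "\<one>\<^bsub>ext.W\<^esub> \<notin> emb ` S"
  proof
    assume "\<one>\<^bsub>ext.W\<^esub> \<in> emb ` S"
    then obtain s where "s \<in> S" "emb s = \<one>\<^bsub>ext.W\<^esub>" by auto
    thus False using emb_eq_one[of s] S_carrier S_involution(2)[of s] by blast
  qed
  show "dcoset G B s <#> dcoset G B s \<noteq> B" if "s \<in> emb ` S" for s
    using that dcoset_square dcoset_emb S_carrier by auto
  show "ext.cls ` \<Gamma> \<subseteq> ext.cls ` (E \<inter> normalizer G B)"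
    using Gamma_in_E by (auto simp: Gamma_grp_def)
  show "subgroup (ext.cls ` \<Gamma>) ext.W"
  proof (rule W.subgroupI)
    show "ext.cls ` \<Gamma> \<subseteq> carrier ext.W" using ext.cls_closed Gamma_in_E by blast
    show "ext.cls ` \<Gamma> \<noteq> {}" using subgroup.one_closed[OF Gamma_sub] by blast
    show "inv\<^bsub>ext.W\<^esub> x \<in> ext.cls ` \<Gamma>" if "x \<in> ext.cls ` \<Gamma>" for x
      using that subgroup.m_inv_closed[OF Gamma_sub] Gamma_in_E by (auto simp: ext.cls_inv)
    show "x \<otimes>\<^bsub>ext.W\<^esub> y \<in> ext.cls ` \<Gamma>" if "x \<in> ext.cls ` \<Gamma>" "y \<in> ext.cls ` \<Gamma>" for x y
      using that subgroup.m_closed[OF Gamma_sub] Gamma_in_E by (auto simp: ext.cls_mult)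
  qed
  show "\<exists>ss r. set ss \<subseteq> emb ` S \<and> r \<in> ext.cls ` \<Gamma> \<and> x = list_prod ext.W ss \<otimes>\<^bsub>ext.W\<^esub> r"
    if x: "x \<in> carrier ext.W" for x
  proof -
    obtain n \<gamma> where n: "n \<in> N" "\<gamma> \<in> \<Gamma>" "x = emb (base.cls n) \<otimes>\<^bsub>ext.W\<^esub> ext.cls \<gamma>"
      using carrier_ext[OF x] by blast
    obtain ss where ss: "set ss \<subseteq> S" "base.cls n = list_prod base.W ss"
      using base.cls_closed[OF n(1)] base_words by blast
    hence "x = list_prod ext.W (map emb ss) \<otimes>\<^bsub>ext.W\<^esub> ext.cls \<gamma>"
      using n S_carrier by (subst emb_list_prod) auto
    moreover have "set (map emb ss) \<subseteq> emb ` S" using ss by auto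
    ultimately show ?thesis using n(2) by blast
  qed
qed (use exchange_emb in auto)

section \<open>Uniqueness of the decomposition and the extended length\<close>

context extended_tits
begin

text \<open>If \<open>b \<gamma>\<close> lies in \<Gamma>, then so does \<open>b\<close>, and
  elements of \<open>\<Gamma> \<inter> B\<close> belong to \<open>T_ext\<close>. So the choice of an
  element of \<Gamma> in the coset does not matter.\<close>

lemma Omega_emb_cls:
  assumes \<gamma>: "\<gamma> \<in> \<Gamma>"
  shows "Omega_emb G B N (B #> \<gamma>) = ext.cls \<gamma>"
proof (intro equalityI subsetI)
  fix g assume "g \<in> Omega_emb G B N (B #> \<gamma>)"
  then obtain t b where *: "t \<in> B \<inter> E" "b \<in> B" "b \<otimes> \<gamma> \<in> \<Gamma>" "g = t \<otimes> (b \<otimes> \<gamma>)"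
    by (auto simp: Omega_emb_def T_ext_eq mem_set_mult r_coset_def)
  have cl: "t \<in> carrier G" "b \<in> carrier G" "\<gamma> \<in> carrier G"
    using * \<gamma> base.B_carrier Gamma_carrier by auto
  have "b = (b \<otimes> \<gamma>) \<otimes> inv \<gamma>" using cl by (simp add: m_assoc)
  hence "b \<in> \<Gamma>" using subgroup.m_closed[OF Gamma_sub *(3) subgroup.m_inv_closed[OF Gamma_sub \<gamma>]] by simp
  hence "t \<otimes> b \<in> B \<inter> E"
    using * Gamma_in_E subgroup.m_closed[OF subgroups_Inter_pair[OF base.B_sub E_sub]] by blast
  moreover have "g = (t \<otimes> b) \<otimes> \<gamma>" using * cl by (simp add: m_assoc)
  ultimately show "g \<in> ext.cls \<gamma>" by (auto simp: ext.cls_def r_coset_def)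
next
  fix g assume "g \<in> ext.cls \<gamma>"
  then obtain t where t: "t \<in> B \<inter> E" "g = t \<otimes> \<gamma>" by (auto simp: ext.cls_def r_coset_def)
  have "\<one> \<otimes> \<gamma> \<in> B #> \<gamma>"
    using subgroup.one_closed[OF base.B_sub] unfolding r_coset_def by blast
  hence "\<gamma> \<in> (B #> \<gamma>) \<inter> \<Gamma>" using \<gamma> Gamma_carrier by simp
  thus "g \<in> Omega_emb G B N (B #> \<gamma>)"
    using t by (auto simp: Omega_emb_def T_ext_eq mem_set_mult)
qed

text \<open>The set \<open>Omega_emb G B N \<rho>\<close> is empty exactly when \<rho> misses
  \<Gamma>, so nonemptiness supplies the lift \<gamma>. It is automatic for a factor of an element
  of \<open>ext.W\<close>, as that element is a nonempty coset.\<close>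

lemma Omega_cases:
  assumes \<rho>: "\<rho> \<in> carrier (Omega_grp G B)" and ne: "Omega_emb G B N \<rho> \<noteq> {}"
  obtains \<gamma> where "\<gamma> \<in> \<Gamma>" "\<rho> = B #> \<gamma>" "Omega_emb G B N \<rho> = ext.cls \<gamma>"
proof -
  obtain \<gamma> where \<gamma>: "\<gamma> \<in> \<rho>" "\<gamma> \<in> \<Gamma>" using ne by (auto simp: Omega_emb_def mem_set_mult set_mult_def)
  obtain g where g: "g \<in> carrier G" "\<rho> = B #> g"
    using \<rho> normalizer_iff[OF subgroup.subset[OF base.B_sub]]
    by (auto simp: Omega_grp_def carrier_FactGroup r_coset_def)
  have "\<rho> = B #> \<gamma>" using repr_independence[OF _ g(1) base.B_sub] \<gamma> g by blast
  thus ?thesis using that \<gamma>(2) Omega_emb_cls by blast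
qed

lemma Omega_carrier: "\<gamma> \<in> \<Gamma> \<Longrightarrow> B #> \<gamma> \<in> carrier (Omega_grp G B)"
  by (auto simp: Omega_grp_def carrier_FactGroup Gamma_grp_def r_coset_def)

lemma ext_decomposition_cases:
  assumes "x \<in> carrier ext.W" "\<sigma> \<in> carrier base.W" "\<rho> \<in> carrier (Omega_grp G B)"
    "x = emb \<sigma> \<otimes>\<^bsub>ext.W\<^esub> Omega_emb G B N \<rho>"
  obtains n \<gamma> where "n \<in> N" "\<gamma> \<in> \<Gamma>" "\<sigma> = base.cls n" "\<rho> = B #> \<gamma>"
    "Omega_emb G B N \<rho> = ext.cls \<gamma>" "x = ext.cls (n \<otimes> \<gamma>)"
proof -
  obtain n where n: "n \<in> N" "\<sigma> = base.cls n" using assms(2) by (auto simp: base.carrier_W)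
  have "x \<noteq> {}" using assms(1) ext.self_in_cls by (auto simp: ext.carrier_W)
  hence "Omega_emb G B N \<rho> \<noteq> {}" using assms(4) by (auto simp: ext.mult_W set_mult_def)
  then obtain \<gamma> where "\<gamma> \<in> \<Gamma>" "\<rho> = B #> \<gamma>" "Omega_emb G B N \<rho> = ext.cls \<gamma>"
    using Omega_cases[OF assms(3)] by blast
  thus ?thesis using that n assms(4) by (simp add: emb_cls ext.cls_mult N_in_E Gamma_in_E)
qed

text \<open>The equation rewrites the inverse of \<open>m\<close> times \<open>n\<close> as an
  element of \<open>B\<close> times an element of \<Gamma>. So this element of \<open>N\<close>
  normalizes \<open>B\<close>, and \<open>normalizing_in_B\<close> applies.\<close>

lemma ext_decomposition_unique:
  assumes "n \<in> N" "\<gamma> \<in> \<Gamma>" "m \<in> N" "\<delta> \<in> \<Gamma>" "ext.cls (n \<otimes> \<gamma>) = ext.cls (m \<otimes> \<delta>)"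
  shows "base.cls n = base.cls m"
proof -
  have E: "n \<otimes> \<gamma> \<in> E" "m \<otimes> \<delta> \<in> E" using assms mem_E by blast+
  have cl: "n \<in> carrier G" "\<gamma> \<in> carrier G" "m \<in> carrier G" "\<delta> \<in> carrier G"
    using assms base.N_carrier Gamma_carrier by auto
  have "n \<otimes> \<gamma> \<in> ext.cls (m \<otimes> \<delta>)" using ext.self_in_cls[OF E(1)] assms by simp
  then obtain t where t: "t \<in> B" "t \<in> E" "n \<otimes> \<gamma> = t \<otimes> (m \<otimes> \<delta>)"
    by (auto simp: ext.cls_def r_coset_def)
  \<comment> \<open>Moving \<open>t\<close> past the inverse of \<open>m\<close> produces this
    conjugate, which is in \<open>B\<close> because \<open>T_ext\<close> is normal in
    \<open>E\<close>.\<close>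
  let ?u = "inv m \<otimes> t \<otimes> m"
  have mE: "inv m \<in> E" using subgroup.m_inv_closed[OF E_sub N_in_E[OF assms(3)]] .
  have "inv m \<otimes> t \<otimes> inv (inv m) \<in> B \<inter> E"
  proof -
    interpret E: group "G\<lparr>carrier := E\<rparr>" using subgroup_imp_group[OF E_sub] .
    show ?thesis using T_ext_normal mE t unfolding E.normal_inv_iff
      by (auto simp: m_inv_consistent[OF E_sub])
  qed
  hence u: "?u \<in> B" using cl by simp
  note NB = normalizer_imp_subgroup[OF subgroup.subset[OF base.B_sub]]
  have tc: "t \<in> carrier G" using t base.B_carrier by blast
  have "inv m \<otimes> n = inv m \<otimes> (n \<otimes> \<gamma>) \<otimes> inv \<gamma>" using cl by (simp add: m_assoc)
  also have "\<dots> = ?u \<otimes> (\<delta> \<otimes> inv \<gamma>)" using cl tc by (simp add: t(3) m_assoc)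
  finally have eq: "inv m \<otimes> n = ?u \<otimes> (\<delta> \<otimes> inv \<gamma>)" .
  have "\<delta> \<otimes> inv \<gamma> \<in> normalizer G B"
    using subgroup.m_closed[OF Gamma_sub assms(4) subgroup.m_inv_closed[OF Gamma_sub assms(2)]]
    by (simp add: Gamma_grp_def)
  hence "inv m \<otimes> n \<in> normalizer G B"
    unfolding eq using subgroup.m_closed[OF NB B_normalizes[OF u]] by blast
  moreover have mi: "inv m \<in> N" using subgroup.m_inv_closed[OF base.N_sub] assms by blast
  moreover have mn: "inv m \<otimes> n \<in> N" using subgroup.m_closed[OF base.N_sub mi] assms by blast
  ultimately have "inv m \<otimes> n \<in> B" using normalizing_in_B by blast
  hence "base.cls (inv m \<otimes> n) = \<one>\<^bsub>base.W\<^esub>" using base.cls_eq_one mn by blast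
  hence "inv\<^bsub>base.W\<^esub> base.cls m \<otimes>\<^bsub>base.W\<^esub> base.cls n = \<one>\<^bsub>base.W\<^esub>"
    using assms mi by (simp add: base.cls_inv base.cls_mult)
  thus ?thesis
    using cox.W.inv_solve_left'[of "\<one>\<^bsub>base.W\<^esub>" "base.cls m" "base.cls n"] assms base.cls_closed by simp
qed

text \<open>Uniqueness of the part in \<open>W\<close> gives the definite description a value, the
  length of that part. It equals \<open>ecox.len\<close> because words in \<open>S\<close>
  correspond to words in the images, and the factor in \<Gamma> is not counted.\<close>

lemma ext_length_eq:
  assumes x: "x \<in> carrier ext.W" shows "ext_length G B N S x = ecox.len x"
proof -
  obtain n \<gamma> where n: "n \<in> N" "\<gamma> \<in> \<Gamma>" "x = ext.cls (n \<otimes> \<gamma>)"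
    "x = emb (base.cls n) \<otimes>\<^bsub>ext.W\<^esub> ext.cls \<gamma>" using carrier_ext[OF x] .
  have nc: "base.cls n \<in> carrier base.W" using base.cls_closed n by blast
  have "ext_length G B N S x = cox.len (base.cls n)"
    unfolding ext_length_def W_ext_eq word_length_eq
  proof (rule the_equality)
    show "\<exists>\<sigma>\<in>carrier base.W. \<exists>\<rho>\<in>carrier (Omega_grp G B).
        x = emb \<sigma> \<otimes>\<^bsub>ext.W\<^esub> Omega_emb G B N \<rho> \<and> cox.len (base.cls n) = cox.len \<sigma>"
      using nc n Omega_carrier[OF n(2)] Omega_emb_cls[OF n(2)] by (intro bexI) auto
    show "m = cox.len (base.cls n)" if ex: "\<exists>\<sigma>\<in>carrier base.W. \<exists>\<rho>\<in>carrier (Omega_grp G B).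
        x = emb \<sigma> \<otimes>\<^bsub>ext.W\<^esub> Omega_emb G B N \<rho> \<and> m = cox.len \<sigma>" for m
    proof -
      obtain \<sigma> \<rho> where *: "\<sigma> \<in> carrier base.W" "\<rho> \<in> carrier (Omega_grp G B)"
        "x = emb \<sigma> \<otimes>\<^bsub>ext.W\<^esub> Omega_emb G B N \<rho>" "m = cox.len \<sigma>"
        using ex by blast
      obtain n' \<gamma>' where "n' \<in> N" "\<gamma>' \<in> \<Gamma>" "\<sigma> = base.cls n'" "x = ext.cls (n' \<otimes> \<gamma>')"
        using ext_decomposition_cases[OF x *(1-3)] by blast
      thus ?thesis using ext_decomposition_unique[of n' \<gamma>' n \<gamma>] n *(4) by simp
    qed
  qed
  also have "\<dots> = ecox.len x"
  proof (rule antisym)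
    obtain ss r where ss: "set ss \<subseteq> emb ` S" "r \<in> ext.cls ` \<Gamma>" "length ss = ecox.len x"
      "x = list_prod ext.W ss \<otimes>\<^bsub>ext.W\<^esub> r" using ecox.len_factorization[OF x] .
    obtain ts where ts: "ss = map emb ts" "set ts \<subseteq> S"
      using set_subset_image_map[OF ss(1)] by blast
    obtain \<delta> where \<delta>: "\<delta> \<in> \<Gamma>" "r = ext.cls \<delta>" using ss(2) by blast
    have tsc: "list_prod base.W ts \<in> carrier base.W" using ts cox.word_closed by blast
    then obtain m where m: "m \<in> N" "list_prod base.W ts = base.cls m" by (auto simp: base.carrier_W)
    have "list_prod ext.W ss = emb (base.cls m)"
      using emb_list_prod[of ts] ts S_carrier m by auto
    hence "x = ext.cls (m \<otimes> \<delta>)"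
      using ss(4) \<delta> m by (simp add: emb_cls ext.cls_mult N_in_E Gamma_in_E)
    \<comment> \<open>A shortest factorization in the extended group might a priori have another
      part in \<open>W\<close>; uniqueness rules this out.\<close>
    hence "base.cls n = list_prod base.W ts"
      using ext_decomposition_unique[of n \<gamma> m \<delta>] n m \<delta> by simp
    thus "cox.len (base.cls n) \<le> ecox.len x" using cox.len_word_le[OF ts(2)] ss(3) ts(1) by simp
  next
    obtain ss r where ss: "set ss \<subseteq> S" "r \<in> {\<one>\<^bsub>base.W\<^esub>}" "length ss = cox.len (base.cls n)"
      "base.cls n = list_prod base.W ss \<otimes>\<^bsub>base.W\<^esub> r" using cox.len_factorization[OF nc] .
    hence "base.cls n = list_prod base.W ss" using cox.word_closed[OF ss(1)] by simp
    hence "x = list_prod ext.W (map emb ss) \<otimes>\<^bsub>ext.W\<^esub> ext.cls \<gamma>"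
      using n(4) emb_list_prod[of ss] ss S_carrier by auto
    thus "ecox.len x \<le> cox.len (base.cls n)"
      using ecox.len_le[of "map emb ss" "ext.cls \<gamma>"] ss n(2) by auto
  qed
  finally show ?thesis .
qed

section \<open>Parabolic subgroups and minimal representatives in the abstract setting\<close>

lemma W_par_ext_eq:
  assumes "X \<subseteq> S" shows "W_par_ext G B N X = ecox.words (emb ` X)"
proof -
  have "W_par_ext G B N X = emb ` cox.words X"
    using cox.words_eq_generate[OF assms] by (simp add: W_par_ext_def W_par_def)
  also have "\<dots> = ecox.words (emb ` X)"
  proof (intro equalityI subsetI)
    fix x assume "x \<in> emb ` cox.words X"
    then obtain ss where ss: "set ss \<subseteq> X" "x = emb (list_prod base.W ss)" by (auto simp: cox.words_def)
    hence "x = list_prod ext.W (map emb ss)" using emb_list_prod[of ss] assms S_carrier by simp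
    moreover have "set (map emb ss) \<subseteq> emb ` X" using ss(1) by auto
    ultimately show "x \<in> ecox.words (emb ` X)" unfolding ecox.words_def by blast
  next
    fix x assume "x \<in> ecox.words (emb ` X)"
    then obtain ts where ts: "set ts \<subseteq> emb ` X" "x = list_prod ext.W ts" by (auto simp: ecox.words_def)
    obtain ss where ss: "ts = map emb ss" "set ss \<subseteq> X"
      using set_subset_image_map[OF ts(1)] by blast
    thus "x \<in> emb ` cox.words X"
      using emb_list_prod[of ss] assms S_carrier ts by (auto simp: cox.words_def)
  qed
  finally show ?thesis .
qed

lemma K_par_eq:
  assumes X: "X \<subseteq> S" shows "K_par G B N X = ecox.par (emb ` X)"
proof -
  have "K_par G B N X = (\<Union>x\<in>W_par G B N X. dcoset G B x)"
    by (auto simp: K_par_def dcoset_def set_mult_def)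
  also have "\<dots> = (\<Union>x\<in>W_par G B N X. dcoset G B (emb x))"
    using dcoset_emb cox.words_closed[OF X] cox.words_eq_generate[OF X] by (auto simp: W_par_def)
  also have "\<dots> = ecox.par (emb ` X)"
    by (simp add: ecox.par_def W_par_ext_def flip: W_par_ext_eq[OF X])
  finally show ?thesis .
qed

lemma min_coset_reps_eq:
  assumes X: "X \<subseteq> S" and Y: "Y \<subseteq> S" and w: "w \<in> carrier ext.W"
  shows "min_coset_reps G B N S X Y w = ecox.min_left_reps (emb ` X) (emb ` Y) w"
proof -
  have XS: "emb ` X \<subseteq> emb ` S" "emb ` Y \<subseteq> emb ` S" using X Y by auto
  have inter: "u \<in> W_par_inter G B N X Y w \<longleftrightarrow>
      u \<in> ecox.words (emb ` X) \<and> (\<exists>y\<in>ecox.words (emb ` Y). u \<otimes>\<^bsub>ext.W\<^esub> w = w \<otimes>\<^bsub>ext.W\<^esub> y)" for u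
  proof (cases "u \<in> ecox.words (emb ` X)")
    case True
    have uc: "u \<in> carrier ext.W" using ecox.words_closed[OF XS(1) True] .
    have "u = w \<otimes>\<^bsub>ext.W\<^esub> y \<otimes>\<^bsub>ext.W\<^esub> inv\<^bsub>ext.W\<^esub> w \<longleftrightarrow> u \<otimes>\<^bsub>ext.W\<^esub> w = w \<otimes>\<^bsub>ext.W\<^esub> y"
      if "y \<in> ecox.words (emb ` Y)" for y
      using ecox.W.inv_solve_right[of u "w \<otimes>\<^bsub>ext.W\<^esub> y" w] uc w ecox.words_closed[OF XS(2) that] by auto
    thus ?thesis using True
      by (auto simp: W_par_inter_def W_ext_eq W_par_ext_eq[OF X] W_par_ext_eq[OF Y]
          l_coset_def r_coset_def)
  qed (auto simp: W_par_inter_def W_par_ext_eq[OF X])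
  hence set_eq: "W_par_inter G B N X Y w = {u \<in> ecox.words (emb ` X).
      \<exists>y\<in>ecox.words (emb ` Y). u \<otimes>\<^bsub>ext.W\<^esub> w = w \<otimes>\<^bsub>ext.W\<^esub> y}" by blast
  have "ext_length G B N S \<tau> \<le> ext_length G B N S (\<tau> \<otimes>\<^bsub>ext.W\<^esub> u) \<longleftrightarrow>
      ecox.len \<tau> \<le> ecox.len (\<tau> \<otimes>\<^bsub>ext.W\<^esub> u)"
    if "\<tau> \<in> ecox.words (emb ` X)" "u \<in> ecox.words (emb ` X)" for \<tau> u
    using ecox.words_closed[OF XS(1)] that by (simp add: ext_length_eq)
  thus ?thesis
    unfolding min_coset_reps_def ecox.min_left_reps_def W_par_ext_eq[OF X] W_ext_eq set_eq
    by (auto simp: l_coset_def)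
qed

lemma min_double_coset_repsD:
  assumes X: "X \<subseteq> S" and Y: "Y \<subseteq> S" and w: "w \<in> min_double_coset_reps G B N S X Y"
  shows "w \<in> carrier ext.W"
    "y \<in> ecox.words (emb ` Y) \<Longrightarrow> ecox.len w \<le> ecox.len (w \<otimes>\<^bsub>ext.W\<^esub> y)"
proof -
  show wc: "w \<in> carrier ext.W" using w by (simp add: min_double_coset_reps_def W_ext_eq)
  assume y: "y \<in> ecox.words (emb ` Y)"
  have yc: "y \<in> carrier ext.W" using ecox.words_closed[OF _ y] Y by blast
  \<comment> \<open>The elements \<open>w y\<close> enter the double coset with the trivial left
    factor.\<close>
  have "\<one>\<^bsub>ext.W\<^esub> \<otimes>\<^bsub>ext.W\<^esub> w \<otimes>\<^bsub>ext.W\<^esub> y \<in>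
      ecox.words (emb ` X) #>\<^bsub>ext.W\<^esub> w <#>\<^bsub>ext.W\<^esub> ecox.words (emb ` Y)"
    using y ecox.one_in_words[of "emb ` X"] by (intro set_multI) (auto simp: r_coset_def)
  hence "ext_length G B N S w \<le> ext_length G B N S (w \<otimes>\<^bsub>ext.W\<^esub> y)"
    using w wc by (auto simp: min_double_coset_reps_def W_ext_eq W_par_ext_eq[OF X] W_par_ext_eq[OF Y])
  thus "ecox.len w \<le> ecox.len (w \<otimes>\<^bsub>ext.W\<^esub> y)" using wc yc by (simp add: ext_length_eq)
qed

section \<open>Representatives of \<open>BvB / B\<close> for a chosen reduced decomposition\<close>

context
  fixes k :: "'a set \<Rightarrow> 'a set" and v \<rho> :: "'a set" and ss :: "'a set list" and r :: 'a
  assumes reps: "\<And>s. s \<in> S \<Longrightarrow> left_coset_reps G (dcoset G B s) B (k s)"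
    and v: "v \<in> carrier ext.W" and red: "reduced_decomposition G B N S v ss \<rho>" and r: "r \<in> \<rho>"
begin

text \<open>The lift \<open>r\<close> differs from \<gamma> by an element of \<open>B\<close>, which
  may be placed on the right because \<gamma> normalizes \<open>B\<close>. The word is shortest in
  \<open>W\<close>, since a shorter word for the same element would lower the extended length of
  \<open>v\<close>.\<close>

lemma reduced_decomposition_lift:
  obtains n \<gamma> b where "n \<in> N" "\<gamma> \<in> \<Gamma>" "b \<in> B" "list_prod base.W ss = base.cls n" "r = \<gamma> \<otimes> b"
    "dcoset G B v = dcoset G B (list_prod base.W ss) #> \<gamma>" "cox.shortest S ss"
proof -
  have ss: "set ss \<subseteq> S" "\<rho> \<in> carrier (Omega_grp G B)" "length ss = ecox.len v"
    "v = emb (list_prod base.W ss) \<otimes>\<^bsub>ext.W\<^esub> Omega_emb G B N \<rho>"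
    using red v by (auto simp: reduced_decomposition_def W_ext_eq ext_length_eq)
  have c: "list_prod base.W ss \<in> carrier base.W" using cox.word_closed[OF ss(1)] .
  obtain n \<gamma> where n: "n \<in> N" "\<gamma> \<in> \<Gamma>" "list_prod base.W ss = base.cls n" "\<rho> = B #> \<gamma>"
    "Omega_emb G B N \<rho> = ext.cls \<gamma>" "v = ext.cls (n \<otimes> \<gamma>)"
    using ext_decomposition_cases[OF v c ss(2,4)] .
  have "length ss \<le> length ts"
    if ts: "set ts \<subseteq> S" "list_prod base.W ts = list_prod base.W ss" for ts
  proof -
    have "v = list_prod ext.W (map emb ts) \<otimes>\<^bsub>ext.W\<^esub> ext.cls \<gamma>"
      using ss(4) n(5) ts S_carrier by (subst emb_list_prod) auto
    thus ?thesis using ecox.len_le[of "map emb ts" "ext.cls \<gamma>"] ts n(2) ss(3) by auto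
  qed
  hence sh: "cox.shortest S ss" using ss(1) by (simp add: cox.shortest_def)
  obtain b where b: "b \<in> B" "r = b \<otimes> \<gamma>" using r n(4) by (auto simp: r_coset_def)
  have "r = \<gamma> \<otimes> (inv \<gamma> \<otimes> b \<otimes> \<gamma>)"
    using b base.B_carrier Gamma_carrier[OF n(2)] by (simp flip: m_assoc)
  moreover have "inv \<gamma> \<otimes> b \<otimes> \<gamma> \<in> B" using Gamma_conj(2)[OF n(2) b(1)] .
  ultimately show ?thesis using that n sh dcoset_ext_cls by simp
qed

lemma X_map_mem:
  assumes "\<kappa> \<in> k_prod k ss" shows "X_map G r \<kappa> \<in> dcoset G B v"
proof -
  obtain n \<gamma> b where *: "n \<in> N" "\<gamma> \<in> \<Gamma>" "b \<in> B" "list_prod base.W ss = base.cls n"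
    "r = \<gamma> \<otimes> b" "dcoset G B v = dcoset G B (list_prod base.W ss) #> \<gamma>" "cox.shortest S ss"
    using reduced_decomposition_lift .
  have "list_prod G \<kappa> \<in> dcoset G B (list_prod base.W ss)"
    using cox.reduced_mem[OF *(7) reps] assms by (simp add: k_prod_def)
  moreover from this have "list_prod G \<kappa> \<in> carrier G"
    using cox.C_closed base.cls_closed *(1,4) by metis
  ultimately have "list_prod G \<kappa> \<otimes> \<gamma> \<in> dcoset G B v" by (auto simp: *(6) r_coset_def)
  hence "list_prod G \<kappa> \<otimes> \<gamma> \<otimes> b \<in> dcoset G B v" using ecox.C_mult_right[OF v] *(3) by blast
  thus ?thesis using * \<open>list_prod G \<kappa> \<in> carrier G\<close> Gamma_carrier base.B_carrier
    by (simp add: X_map_def m_assoc)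
qed

lemma X_map_cover:
  assumes "g \<in> dcoset G B v"
  shows "\<exists>\<kappa>\<in>k_prod k ss. \<exists>b\<in>B. g = X_map G r \<kappa> \<otimes> b"
proof -
  obtain n \<gamma> b where *: "n \<in> N" "\<gamma> \<in> \<Gamma>" "b \<in> B" "list_prod base.W ss = base.cls n"
    "r = \<gamma> \<otimes> b" "dcoset G B v = dcoset G B (list_prod base.W ss) #> \<gamma>" "cox.shortest S ss"
    using reduced_decomposition_lift .
  obtain h where h: "h \<in> dcoset G B (list_prod base.W ss)" "g = h \<otimes> \<gamma>"
    using assms *(6) by (auto simp: r_coset_def)
  obtain \<kappa> c where \<kappa>: "\<kappa> \<in> k_prod k ss" "c \<in> B" "h = list_prod G \<kappa> \<otimes> c"
    using cox.reduced_cover[OF *(7) reps h(1)] by (auto simp: k_prod_def)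
  have "list_prod G \<kappa> \<in> carrier G"
    using cox.reduced_mem[OF *(7) reps, of \<kappa>] \<kappa>(1) cox.C_closed[OF base.cls_closed[OF *(1)]] *(4)
    by (simp add: k_prod_def)
  hence cl: "list_prod G \<kappa> \<in> carrier G" "\<gamma> \<in> carrier G" "b \<in> carrier G" "c \<in> carrier G"
    using * \<kappa> Gamma_carrier base.B_carrier by auto
  \<comment> \<open>Solved from \<open>list_prod G \<kappa> c \<gamma> = list_prod G \<kappa>
    \<gamma> b ?b\<close>.\<close>
  let ?b = "inv b \<otimes> (inv \<gamma> \<otimes> c \<otimes> \<gamma>)"
  have "X_map G r \<kappa> \<otimes> ?b = list_prod G \<kappa> \<otimes> (\<gamma> \<otimes> (b \<otimes> inv b) \<otimes> inv \<gamma>) \<otimes> c \<otimes> \<gamma>"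
    unfolding X_map_def *(5) using cl by (simp only: m_assoc m_closed inv_closed)
  also have "\<dots> = g" using cl h \<kappa> by (simp add: m_assoc)
  finally have "g = X_map G r \<kappa> \<otimes> ?b" ..
  moreover have "?b \<in> B"
    using Gamma_conj(2)[OF *(2) \<kappa>(2)] *(3) subgroup.m_closed[OF base.B_sub]
      subgroup.m_inv_closed[OF base.B_sub] by blast
  ultimately show ?thesis using \<kappa>(1) by blast
qed

lemma X_map_unique:
  assumes "\<kappa> \<in> k_prod k ss" "\<kappa>' \<in> k_prod k ss" "inv (X_map G r \<kappa>) \<otimes> X_map G r \<kappa>' \<in> B"
  shows "\<kappa> = \<kappa>'"
proof -
  obtain n \<gamma> b where *: "n \<in> N" "\<gamma> \<in> \<Gamma>" "b \<in> B" "list_prod base.W ss = base.cls n"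
    "r = \<gamma> \<otimes> b" "dcoset G B v = dcoset G B (list_prod base.W ss) #> \<gamma>" "cox.shortest S ss"
    using reduced_decomposition_lift .
  let ?p = "list_prod G \<kappa>" and ?q = "list_prod G \<kappa>'"
  have "?p \<in> carrier G" "?q \<in> carrier G"
    using cox.reduced_mem[OF *(7) reps, of \<kappa>] cox.reduced_mem[OF *(7) reps, of \<kappa>'] assms(1,2)
      cox.C_closed[OF base.cls_closed[OF *(1)]] *(4) by (simp_all add: k_prod_def)
  hence cl: "?p \<in> carrier G" "?q \<in> carrier G" "\<gamma> \<in> carrier G" "b \<in> carrier G"
    using * Gamma_carrier base.B_carrier by auto
  define c where "c = inv (X_map G r \<kappa>) \<otimes> X_map G r \<kappa>'"
  \<comment> \<open>Conjugation by the common right factor \<open>\<gamma> b\<close> preserves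
    \<open>B\<close> and turns \<open>c\<close> into the quotient of the two products of
    representatives.\<close>
  have "b \<otimes> c \<otimes> inv b \<in> B"
    using assms(3) *(3) subgroup.m_closed[OF base.B_sub] subgroup.m_inv_closed[OF base.B_sub]
    by (simp add: c_def)
  hence "\<gamma> \<otimes> (b \<otimes> c \<otimes> inv b) \<otimes> inv \<gamma> \<in> B" using Gamma_conj(1)[OF *(2)] by blast
  moreover have "\<gamma> \<otimes> (b \<otimes> c \<otimes> inv b) \<otimes> inv \<gamma> =
      (\<gamma> \<otimes> (b \<otimes> inv b) \<otimes> inv \<gamma>) \<otimes> (inv ?p \<otimes> ?q) \<otimes> (\<gamma> \<otimes> (b \<otimes> inv b) \<otimes> inv \<gamma>)"
    unfolding c_def X_map_def *(5) using cl
    by (simp only: m_assoc m_closed inv_closed inv_mult_group)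
  moreover have "\<dots> = inv ?p \<otimes> ?q" using cl by simp
  ultimately have "inv ?p \<otimes> ?q \<in> B" by simp
  thus ?thesis using cox.reduced_unique[OF *(7) reps] assms(1,2) by (simp add: k_prod_def)
qed

end

section \<open>The decomposition of the parabolic double coset\<close>

lemma K_par_decomposition:
  fixes k :: "'a set \<Rightarrow> 'a set" and dec :: "'a set \<Rightarrow> 'a set list"
    and rho :: "'a set \<Rightarrow> 'a set" and lft :: "'a set \<Rightarrow> 'a" and w :: "'a set"
    and X Y :: "'a set set"
  defines "K \<equiv> K_par G B N Y" and "M \<equiv> min_coset_reps G B N S X Y w"
    and "Xi \<equiv> \<lambda>\<tau> \<kappa>. X_map G (lft (\<tau> \<otimes>\<^bsub>W_ext G B N\<^esub> w)) \<kappa>"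
    and "I \<equiv> \<lambda>\<tau>. k_prod k (dec (\<tau> \<otimes>\<^bsub>W_ext G B N\<^esub> w))"
  assumes reps: "\<And>s. s \<in> S \<Longrightarrow> left_coset_reps G (B <#> s <#> B) B (k s)"
    and dec: "\<And>v. v \<in> carrier (W_ext G B N) \<Longrightarrow>
      reduced_decomposition G B N S v (dec v) (rho v) \<and> lft v \<in> rho v"
    and X: "X \<subseteq> S" and Y: "Y \<subseteq> S" and w: "w \<in> min_double_coset_reps G B N S X Y"
  shows "K_par G B N X <#> w <#> K = (\<Union>\<tau>\<in>M. \<Union>\<kappa>\<in>I \<tau>. Xi \<tau> \<kappa> <# K)"
    and "disjoint_family_on (\<lambda>(\<tau>, \<kappa>). Xi \<tau> \<kappa> <# K) (SIGMA \<tau> : M. I \<tau>)"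
proof -
  have XS: "emb ` X \<subseteq> emb ` S" "emb ` Y \<subseteq> emb ` S" using X Y by auto
  note wc = min_double_coset_repsD(1)[OF X Y w]
  note min = min_double_coset_repsD(2)[OF X Y w]
  have reps': "left_coset_reps G (dcoset G B s) B (k s)" if "s \<in> S" for s
    using reps[OF that] by (simp add: dcoset_def)
  have dec': "reduced_decomposition G B N S v (dec v) (rho v)" "lft v \<in> rho v"
    if "v \<in> carrier ext.W" for v
    using dec[of v] that by (simp_all add: W_ext_eq)
  have K: "K = ecox.par (emb ` Y)" and M: "M = ecox.min_left_reps (emb ` X) (emb ` Y) w"
    by (simp_all add: K_def M_def K_par_eq[OF Y] min_coset_reps_eq[OF X Y wc])
  have Ksub: "subgroup K G" using ecox.par_subgroup[OF XS(2)] K by simp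
  have BK: "b \<in> ecox.par (emb ` Z)" if "b \<in> B" for b Z
    using that ecox.one_in_words ecox.C_one by (force simp: ecox.par_def)
  have vc: "\<tau> \<otimes>\<^bsub>ext.W\<^esub> w \<in> carrier ext.W" if "\<tau> \<in> M" for \<tau>
    using that ecox.words_closed[OF XS(1)] wc by (auto simp: M ecox.min_left_reps_def)
  have Xi: "Xi \<tau> \<kappa> \<in> dcoset G B (\<tau> \<otimes>\<^bsub>ext.W\<^esub> w)" if "\<tau> \<in> M" "\<kappa> \<in> I \<tau>" for \<tau> \<kappa>
    using X_map_mem[OF reps' vc[OF that(1)] dec'[OF vc[OF that(1)]]] that(2)
    by (simp add: Xi_def I_def W_ext_eq)
  \<comment> \<open>Since \<open>B\<close> lies in \<open>K\<close>, representatives of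
    \<open>BvB\<close> modulo \<open>B\<close> still cover the product with \<open>K\<close> modulo
    \<open>K\<close>. Their distinctness modulo \<open>K\<close> is a separate matter, settled
    below.\<close>
  have cosets: "dcoset G B (\<tau> \<otimes>\<^bsub>ext.W\<^esub> w) <#> K = (\<Union>\<kappa>\<in>I \<tau>. Xi \<tau> \<kappa> <# K)" if \<tau>: "\<tau> \<in> M" for \<tau>
  proof (intro equalityI subsetI)
    fix g assume "g \<in> dcoset G B (\<tau> \<otimes>\<^bsub>ext.W\<^esub> w) <#> K"
    then obtain a h where ah: "a \<in> dcoset G B (\<tau> \<otimes>\<^bsub>ext.W\<^esub> w)" "h \<in> K" "g = a \<otimes> h"
      by (auto simp: mem_set_mult)
    then obtain \<kappa> b where \<kappa>: "\<kappa> \<in> I \<tau>" "b \<in> B" "a = Xi \<tau> \<kappa> \<otimes> b"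
      using X_map_cover[OF reps' vc[OF \<tau>] dec'[OF vc[OF \<tau>]] ah(1)]
      by (auto simp: Xi_def I_def W_ext_eq)
    have "b \<otimes> h \<in> K" using subgroup.m_closed[OF Ksub _ ah(2)] BK \<kappa>(2) by (simp add: K)
    moreover have "g = Xi \<tau> \<kappa> \<otimes> (b \<otimes> h)"
      using ah \<kappa> ecox.C_closed[OF vc[OF \<tau>] Xi[OF \<tau> \<kappa>(1)]] base.B_carrier subgroup.mem_carrier[OF Ksub]
      by (simp add: m_assoc)
    ultimately show "g \<in> (\<Union>\<kappa>\<in>I \<tau>. Xi \<tau> \<kappa> <# K)" using \<kappa>(1) by (auto simp: l_coset_def)
  next
    fix g assume "g \<in> (\<Union>\<kappa>\<in>I \<tau>. Xi \<tau> \<kappa> <# K)"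
    thus "g \<in> dcoset G B (\<tau> \<otimes>\<^bsub>ext.W\<^esub> w) <#> K"
      using Xi[OF \<tau>] by (auto simp: l_coset_def mem_set_mult)
  qed
  have "K_par G B N X <#> w <#> K = ecox.par (emb ` X) <#> dcoset G B w <#> ecox.par (emb ` Y)"
  proof (intro equalityI)
    have "w \<subseteq> dcoset G B w"
      using ext.self_in_dcoset ext.cls_eqI[OF wc] by blast
    thus "K_par G B N X <#> w <#> K \<subseteq> ecox.par (emb ` X) <#> dcoset G B w <#> ecox.par (emb ` Y)"
      unfolding K K_par_eq[OF X] by (intro mono_set_mult) auto
    have wG: "w \<subseteq> carrier G" using ext.cls_eqI(1)[OF wc] ext.N_carrier by blast
    \<comment> \<open>The factors from \<open>B\<close> inside the double coset are absorbed by the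
      subgroups on either side, so \<open>w\<close> may replace \<open>BwB\<close>.\<close>
    have "P <#> dcoset G B w <#> Q \<subseteq> P <#> w <#> Q"
      if P: "subgroup P G" "B \<subseteq> P" and Q: "subgroup Q G" "B \<subseteq> Q" for P Q
    proof
      fix g assume "g \<in> P <#> dcoset G B w <#> Q"
      then obtain p b n b' q where *: "p \<in> P" "b \<in> B" "n \<in> w" "b' \<in> B" "q \<in> Q"
        "g = p \<otimes> (b \<otimes> n \<otimes> b') \<otimes> q" by (auto simp: dcoset_def set_mult_def)
      have "g = (p \<otimes> b) \<otimes> n \<otimes> (b' \<otimes> q)"
        using * wG base.B_carrier subgroup.mem_carrier[OF P(1)] subgroup.mem_carrier[OF Q(1)]
        by (simp add: m_assoc subset_iff)
      moreover have "p \<otimes> b \<in> P" "b' \<otimes> q \<in> Q"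
        using *(1,2,4,5) P(2) Q(2) subgroup.m_closed[OF P(1)] subgroup.m_closed[OF Q(1)] by auto
      ultimately show "g \<in> P <#> w <#> Q" using *(3) by (auto intro!: set_multI)
    qed
    thus "ecox.par (emb ` X) <#> dcoset G B w <#> ecox.par (emb ` Y) \<subseteq> K_par G B N X <#> w <#> K"
      unfolding K K_par_eq[OF X]
      using ecox.par_subgroup[OF XS(1)] ecox.par_subgroup[OF XS(2)] BK by blast
  qed
  also have "\<dots> = (\<Union>\<tau>\<in>M. dcoset G B (\<tau> \<otimes>\<^bsub>ext.W\<^esub> w) <#> K)"
    using ecox.double_coset_decomposition[OF XS wc] K M by simp
  also have "\<dots> = (\<Union>\<tau>\<in>M. \<Union>\<kappa>\<in>I \<tau>. Xi \<tau> \<kappa> <# K)" using cosets by simp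
  finally show "K_par G B N X <#> w <#> K = (\<Union>\<tau>\<in>M. \<Union>\<kappa>\<in>I \<tau>. Xi \<tau> \<kappa> <# K)" .
  \<comment> \<open>Cosets of \<open>K\<close> that meet have the same \<tau> and representatives
    that agree modulo \<open>B\<close>, not merely modulo \<open>K\<close>; this finer agreement
    determines \<kappa>.\<close>
  have "\<tau> = \<tau>' \<and> \<kappa> = \<kappa>'"
    if \<tau>: "\<tau> \<in> M" "\<kappa> \<in> I \<tau>" "\<tau>' \<in> M" "\<kappa>' \<in> I \<tau>'" and "(Xi \<tau> \<kappa> <# K) \<inter> (Xi \<tau>' \<kappa>' <# K) \<noteq> {}"
    for \<tau> \<kappa> \<tau>' \<kappa>'
  proof -
    have *: "\<tau> = \<tau>'" "inv (Xi \<tau> \<kappa>) \<otimes> Xi \<tau>' \<kappa>' \<in> B"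
      using ecox.par_cosets_meet[OF XS wc min _ _ Xi[OF \<tau>(1,2)] Xi[OF \<tau>(3,4)]] that K M by auto
    moreover have "\<kappa> = \<kappa>'"
      using X_map_unique[OF reps' vc[OF \<tau>(1)] dec'[OF vc[OF \<tau>(1)]]] \<tau> *
      by (auto simp: Xi_def I_def W_ext_eq)
    ultimately show ?thesis by blast
  qed
  thus "disjoint_family_on (\<lambda>(\<tau>, \<kappa>). Xi \<tau> \<kappa> <# K) (SIGMA \<tau> : M. I \<tau>)"
    unfolding disjoint_family_on_def by blast
qed

end

theorem theorem5:
  fixes Gt :: "('a, 'b) monoid_scheme" and G B N :: "'a set" and S X Y :: "'a set set"
    and k :: "'a set \<Rightarrow> 'a set"
    and dec :: "'a set \<Rightarrow> 'a set list" and rho :: "'a set \<Rightarrow> 'a set" and lft :: "'a set \<Rightarrow> 'a"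
    and w :: "'a set"
  assumes "group Gt" and "subgroup G Gt"
    and "tits_system (Gt\<lparr>carrier := G\<rparr>) B N S"
    and "\<And>s. s \<in> S \<Longrightarrow> finite (left_cosets_in Gt (B <#>\<^bsub>Gt\<^esub> s <#>\<^bsub>Gt\<^esub> B) B)"
    and "BN_adapted Gt G B N"
    and "\<And>s. s \<in> S \<Longrightarrow> left_coset_reps Gt (B <#>\<^bsub>Gt\<^esub> s <#>\<^bsub>Gt\<^esub> B) B (k s)"
    and "\<And>v. v \<in> carrier (W_ext Gt B N) \<Longrightarrow>
           reduced_decomposition Gt B N S v (dec v) (rho v) \<and> lft v \<in> rho v"
    and "X \<subseteq> S" and "Y \<subseteq> S"
    and "w \<in> min_double_coset_reps Gt B N S X Y"
  shows "K_par Gt B N X <#>\<^bsub>Gt\<^esub> w <#>\<^bsub>Gt\<^esub> K_par Gt B N Y =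
           (\<Union>\<tau> \<in> min_coset_reps Gt B N S X Y w.
              \<Union>\<kappa> \<in> k_prod k (dec (\<tau> \<otimes>\<^bsub>W_ext Gt B N\<^esub> w)).
                X_map Gt (lft (\<tau> \<otimes>\<^bsub>W_ext Gt B N\<^esub> w)) \<kappa> <#\<^bsub>Gt\<^esub> K_par Gt B N Y) \<and>
         disjoint_family_on
           (\<lambda>(\<tau>, \<kappa>). X_map Gt (lft (\<tau> \<otimes>\<^bsub>W_ext Gt B N\<^esub> w)) \<kappa> <#\<^bsub>Gt\<^esub> K_par Gt B N Y)
           (SIGMA \<tau> : min_coset_reps Gt B N S X Y w. k_prod k (dec (\<tau> \<otimes>\<^bsub>W_ext Gt B N\<^esub> w)))"
proof -
  interpret extended_tits Gt G B N S
    using assms(1-3) by (intro extended_tits.intro extended_tits_axioms.intro)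
  show ?thesis using K_par_decomposition[OF assms(6-10)] by blast
qed

end
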